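(* For each symmetric monoidal category $\mathcal C$ let an arbitrary choice $U\mathcal C=U_\kappa\mathcal C$ of underlying multicategory be made (the sequence $\kappa=\kappa^{\mathcal C}$ being allowed to depend on $\mathcal C$). For symmetric monoidal categories $\mathcal C$ and $\mathcal D$, a multifunctor $U\mathcal C\to U\mathcal D$ determines and is determined by a lax symmetric monoidal functor $\mathcal C\to\mathcal D$; that is, for each lax symmetric monoidal functor $F:\mathcal C\to\mathcal D$ the map $UF:U\mathcal C\to U\mathcal D$ described in the context is a multifunctor, and every multifunctor $U\mathcal C\to U\mathcal D$ is of the form $UF$ for exactly one lax symmetric monoidal functor $F$. The assignment $\mathcal C\mapsto U\mathcal C$, $F\mapsto UF$ is a fully faithful functor from the category of symmetric monoidal categories and lax symmetric monoidal functors to the category of multicategories and multifunctors.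
   Context: "Multicategory" means symmetric multicategory (with right actions $\sigma^*:M(\mathbf x;y)\to M(\sigma^{-1}\mathbf x;y)$, $\sigma\in\Sigma_n$, where $\sigma^{-1}\mathbf x=(x_{\sigma(1)},\dots,x_{\sigma(n)})$, units, and an associative, unital, equivariant multiproduct $\Gamma$); a multifunctor is a map on objects and morphism sets preserving identities, composition and symmetric group actions. $\odot$ denotes concatenation of tuples. A symmetric monoidal category $(\mathcal C,\oplus,e_{\mathcal C})$ has unit isomorphism $c_a:a\oplus e_{\mathcal C}\to a$, associator $\alpha:(a\oplus b)\oplus c\to a\oplus(b\oplus c)$ and symmetry $\tau:a\oplus b\to b\oplus a$. A lax symmetric monoidal functor $F:\mathcal C\to\mathcal D$ is a functor with a map $\eta:e_{\mathcal D}\to Fe_{\mathcal C}$ and natural maps $\xi:Fa\oplus Fb\to F(a\oplus b)$ satisfying $F(c_a)\circ\xi\circ(1\oplus\eta)=c_{Fa}$, $F(\alpha)\circ\xi\circ(\xi\oplus1)=\xi\circ(1\oplus\xi)\circ\alpha$ and $F(\tau)\circ\xi=\xi\circ\tau$. The categorical operad $Y$. The objects of $Y$ form the free symmetric operad of sets on a generator $0$ of arity $0$ and a generator $m$ of arity $2$. Concretely an object $w$ of $Y(n)$ is a complete binary parenthesization of a list of $k\ge\max(n,1)$ slots, with the variables $x_1,\dots,x_n$ placed each exactly once, in any order, in $n$ of the slots, and the remaining slots filled by the symbol $e$. The operad unit $1\in Y(1)$ is the word $x_1$; $0\in Y(0)$ is the word $e$; $m\in Y(2)$ is the word $x_1\oplus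 x_2$. Between any two objects of $Y(n)$ there is exactly one morphism, which is therefore an isomorphism. $Y$ acts on every symmetric monoidal category $\mathcal C$: an object $w\in Y(n)$ gives the functor $w:\mathcal C^n\to\mathcal C$ evaluating the word (with $\oplus$ the monoidal product and $e$ sent to $e_{\mathcal C}$), and the unique morphism $w\to w'$ gives the canonical natural isomorphism of functors $\mathcal C^n\to\mathcal C$ built from $\alpha$, $c$, $\tau$ and inverses (unique by coherence). The operad composition $\gamma$ of $Y$ is substitution, so $\gamma(w;w_1,\dots,w_n)(\odot_s\mathbf x_s)=w(w_1(\mathbf x_1),\dots,w_n(\mathbf x_n))$, and the right $\Sigma_n$-action on $Y(n)$ satisfies $(w\cdot\sigma)(\sigma^{-1}\mathbf x)=w(\mathbf x)$. Underlying multicategories. Let $\kappa_n:\mathrm{Ob}\,\mathcal C^n\to\mathrm{Ob}\,Y(n)$, $n\ge0$, be any sequence of functions. For $\mathbf x\in\mathrm{Ob}\,\mathcal C^n$ put $\bar\kappa\mathbf x=\kappa_n(\mathbf x)(\mathbf x)$. The multicategory $U_\kappa\mathcal C$ has the objects of $\mathcal C$, and $U_\kappa\mathcal C(\mathbf x;y)=\mathcal C(\bar\kappa\mathbf x,y)$ (elements tagged by the source tuple $\mathbf x$, so that morphism sets with different sources are disjoint). - Identities: the identity in $U_\kappa\mathcal C(a;a)$ is the map $\bar\kappa(a)\to a$ induced by the unique isomorphism $\kappa_1(a)\to1$ in $Y(1)$. - Symmetric group action: $\sigma^*f=f\circ\theta(\mathbf x,\sigma)$, where $\theta(\mathbf x,\sigma):\bar\kappa(\sigma^{-1}\mathbf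 x)\to(\kappa_n(\mathbf x)\cdot\sigma)(\sigma^{-1}\mathbf x)=\bar\kappa\mathbf x$ is induced by the unique isomorphism $\kappa_n(\sigma^{-1}\mathbf x)\to\kappa_n(\mathbf x)\cdot\sigma$ in $Y(n)$. - Composition: $\Gamma(g;f_1,\dots,f_n)=g\circ\kappa_n(\mathbf y)(f_1,\dots,f_n)\circ\phi$ for $g\in\mathcal C(\bar\kappa\mathbf y,z)$, $f_s\in\mathcal C(\bar\kappa\mathbf x_s,y_s)$, $\mathbf x_s$ a $j_s$-tuple, $j=\sum_sj_s$, where $\phi:\bar\kappa(\odot_s\mathbf x_s)\to\kappa_n(\mathbf y)(\bar\kappa\mathbf x_1,\dots,\bar\kappa\mathbf x_n)$ is induced by the unique isomorphism $\kappa_j(\odot_s\mathbf x_s)\to\gamma(\kappa_n(\mathbf y);\kappa_{j_1}(\mathbf x_1),\dots,\kappa_{j_n}(\mathbf x_n))$ in $Y(j)$. For two sequences $\kappa,\lambda$ the canonical isomorphism $U_\kappa\mathcal C\to U_\lambda\mathcal C$ is the identity on objects and sends $f\in\mathcal C(\bar\kappa\mathbf x,y)$ to its composite with the isomorphism $\bar\lambda\mathbf x\to\bar\kappa\mathbf x$ induced by the unique isomorphism $\lambda_n(\mathbf x)\to\kappa_n(\mathbf x)$ in $Y(n)$. The map $UF$. First let $k_n\in\mathrm{Ob}\,Y(n)$ be the left-parenthesized words: $k_0=0$, $k_1=1$, $k_n=\gamma(m;k_{n-1},1)$ for $n\ge2$ (so $k_2=m$), and regard $k=(k_n)$ as a sequence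 of constant functions, with $\bar k\mathbf x=k_n(\mathbf x)$. For a lax symmetric monoidal functor $F:\mathcal C\to\mathcal D$ and $\mathbf x\in\mathrm{Ob}\,\mathcal C^n$, with $F\mathbf x=(Fx_1,\dots,Fx_n)$, define $\xi_n:\bar kF\mathbf x\to F\bar k\mathbf x$ by $\xi_0=\eta$, $\xi_1=\mathrm{id}_{Fx_1}$, and, for $n\ge2$ with $\hat{\mathbf x}=(x_1,\dots,x_{n-1})$, $\xi_n=\xi\circ(\xi_{n-1}\oplus1):\bar kF\hat{\mathbf x}\oplus Fx_n\to F\bar k\hat{\mathbf x}\oplus Fx_n\to F(\bar k\hat{\mathbf x}\oplus x_n)$. The map $U_kF:U_k\mathcal C\to U_k\mathcal D$ is $F$ on objects and sends $f\in\mathcal C(\bar k\mathbf x,y)$ to $F(f)\circ\xi_n\in\mathcal D(\bar kF\mathbf x,Fy)$. For arbitrary choices $U\mathcal C$, $U\mathcal D$, the map $UF$ is the composite $U\mathcal C\cong U_k\mathcal C\xrightarrow{U_kF}U_k\mathcal D\cong U\mathcal D$ with the canonical isomorphisms. *)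

theory Defs
  imports "HOL-Combinatorics.Permutations" "HOL-Library.FuncSet"
begin

record ('o, 'a) cat =
  Ob  :: "'o set"
  Arr :: "'a set"
  Dom :: "'a \<Rightarrow> 'o"
  Cod :: "'a \<Rightarrow> 'o"
  idn :: "'o \<Rightarrow> 'a"
  cmp :: "'a \<Rightarrow> 'a \<Rightarrow> 'a" (infixl "\<cdot>\<index>" 65)

definition hom :: "('o, 'a, 'z) cat_scheme \<Rightarrow> 'o \<Rightarrow> 'o \<Rightarrow> 'a set" where
  "hom C a b = {f \<in> Arr C. Dom C f = a \<and> Cod C f = b}"

definition inverses :: "('o, 'a, 'z) cat_scheme \<Rightarrow> 'a \<Rightarrow> 'a \<Rightarrow> bool" where
  "inverses C f g \<longleftrightarrow>
     f \<in> Arr C \<and> g \<in> hom C (Cod C f) (Dom C f) \<and>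
     g \<cdot>\<^bsub>C\<^esub> f = idn C (Dom C f) \<and> f \<cdot>\<^bsub>C\<^esub> g = idn C (Cod C f)"

definition is_iso :: "('o, 'a, 'z) cat_scheme \<Rightarrow> 'a \<Rightarrow> bool" where
  "is_iso C f \<longleftrightarrow> (\<exists>g. inverses C f g)"

locale category =
  fixes C :: "('o, 'a, 'z) cat_scheme" (structure)
  assumes Dom_in: "f \<in> Arr C \<Longrightarrow> Dom C f \<in> Ob C"
    and Cod_in: "f \<in> Arr C \<Longrightarrow> Cod C f \<in> Ob C"
    and idn_hom: "a \<in> Ob C \<Longrightarrow> idn C a \<in> hom C a a"
    and cmp_hom: "\<lbrakk>f \<in> hom C a b; g \<in> hom C b c\<rbrakk> \<Longrightarrow> g \<cdot> f \<in> hom C a c"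
    and idn_left: "f \<in> hom C a b \<Longrightarrow> idn C b \<cdot> f = f"
    and idn_right: "f \<in> hom C a b \<Longrightarrow> f \<cdot> idn C a = f"
    and cmp_assoc: "\<lbrakk>f \<in> hom C a b; g \<in> hom C b c; h \<in> hom C c d\<rbrakk>
                      \<Longrightarrow> (h \<cdot> g) \<cdot> f = h \<cdot> (g \<cdot> f)"

definition is_functor ::
  "('o1, 'a1, 'z1) cat_scheme \<Rightarrow> ('o2, 'a2, 'z2) cat_scheme \<Rightarrow> ('o1 \<Rightarrow> 'o2) \<Rightarrow> ('a1 \<Rightarrow> 'a2) \<Rightarrow> bool"
  where
  "is_functor A B Fo Fa \<longleftrightarrow>
     category A \<and> category B \<and>
     (\<forall>a\<in>Ob A. Fo a \<in> Ob B) \<and>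
     (\<forall>f\<in>Arr A. Fa f \<in> hom B (Fo (Dom A f)) (Fo (Cod A f))) \<and>
     (\<forall>a\<in>Ob A. Fa (idn A a) = idn B (Fo a)) \<and>
     (\<forall>f\<in>Arr A. \<forall>g\<in>Arr A. Cod A f = Dom A g \<longrightarrow> Fa (g \<cdot>\<^bsub>A\<^esub> f) = Fa g \<cdot>\<^bsub>B\<^esub> Fa f)"

definition is_fully_faithful ::
  "('o1, 'a1, 'z1) cat_scheme \<Rightarrow> ('o2, 'a2, 'z2) cat_scheme \<Rightarrow> ('o1 \<Rightarrow> 'o2) \<Rightarrow> ('a1 \<Rightarrow> 'a2) \<Rightarrow> bool"
  where
  "is_fully_faithful A B Fo Fa \<longleftrightarrow>
     (\<forall>a\<in>Ob A. \<forall>b\<in>Ob A. bij_betw Fa (hom A a b) (hom B (Fo a) (Fo b)))"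

text \<open>The unit isomorphism \<open>runit C a\<close> goes from \<open>a \<oplus> e\<close> to \<open>a\<close>; the left unit
  isomorphism is \<open>runit C a \<cdot> sym C e a\<close>.\<close>

record ('o, 'a) smc = "('o, 'a) cat" +
  tenO  :: "'o \<Rightarrow> 'o \<Rightarrow> 'o" (infixl "\<oplus>\<index>" 70)
  tenA  :: "'a \<Rightarrow> 'a \<Rightarrow> 'a" (infixl "\<boxplus>\<index>" 70)
  munit :: "'o"
  assc  :: "'o \<Rightarrow> 'o \<Rightarrow> 'o \<Rightarrow> 'a"
  runit :: "'o \<Rightarrow> 'a"
  sym   :: "'o \<Rightarrow> 'o \<Rightarrow> 'a"

locale symmetric_monoidal_category = category C
  for C :: "('o, 'a) smc" (structure) +
  assumes tenO_in: "\<lbrakk>a \<in> Ob C; b \<in> Ob C\<rbrakk> \<Longrightarrow> a \<oplus> b \<in> Ob C"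
    and tenA_hom: "\<lbrakk>f \<in> hom C a a'; g \<in> hom C b b'\<rbrakk> \<Longrightarrow> f \<boxplus> g \<in> hom C (a \<oplus> b) (a' \<oplus> b')"
    and tenA_idn: "\<lbrakk>a \<in> Ob C; b \<in> Ob C\<rbrakk> \<Longrightarrow> idn C a \<boxplus> idn C b = idn C (a \<oplus> b)"
    and tenA_cmp: "\<lbrakk>f \<in> hom C a a'; f' \<in> hom C a' a''; g \<in> hom C b b'; g' \<in> hom C b' b''\<rbrakk>
                    \<Longrightarrow> (f' \<cdot> f) \<boxplus> (g' \<cdot> g) = (f' \<boxplus> g') \<cdot> (f \<boxplus> g)"
    and munit_in: "munit C \<in> Ob C"
    and assc_hom: "\<lbrakk>a \<in> Ob C; b \<in> Ob C; c \<in> Ob C\<rbrakk>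
                    \<Longrightarrow> assc C a b c \<in> hom C ((a \<oplus> b) \<oplus> c) (a \<oplus> (b \<oplus> c))"
    and assc_iso: "\<lbrakk>a \<in> Ob C; b \<in> Ob C; c \<in> Ob C\<rbrakk> \<Longrightarrow> is_iso C (assc C a b c)"
    and assc_nat: "\<lbrakk>f \<in> hom C a a'; g \<in> hom C b b'; h \<in> hom C c c'\<rbrakk>
                    \<Longrightarrow> assc C a' b' c' \<cdot> ((f \<boxplus> g) \<boxplus> h) = (f \<boxplus> (g \<boxplus> h)) \<cdot> assc C a b c"
    and runit_hom: "a \<in> Ob C \<Longrightarrow> runit C a \<in> hom C (a \<oplus> munit C) a"
    and runit_iso: "a \<in> Ob C \<Longrightarrow> is_iso C (runit C a)"
    and runit_nat: "f \<in> hom C a a' \<Longrightarrow> runit C a' \<cdot> (f \<boxplus> idn C (munit C)) = f \<cdot> runit C a"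
    and sym_hom: "\<lbrakk>a \<in> Ob C; b \<in> Ob C\<rbrakk> \<Longrightarrow> sym C a b \<in> hom C (a \<oplus> b) (b \<oplus> a)"
    and sym_nat: "\<lbrakk>f \<in> hom C a a'; g \<in> hom C b b'\<rbrakk>
                    \<Longrightarrow> sym C a' b' \<cdot> (f \<boxplus> g) = (g \<boxplus> f) \<cdot> sym C a b"
    and sym_sym: "\<lbrakk>a \<in> Ob C; b \<in> Ob C\<rbrakk> \<Longrightarrow> sym C b a \<cdot> sym C a b = idn C (a \<oplus> b)"
    and triangle: "\<lbrakk>a \<in> Ob C; b \<in> Ob C\<rbrakk>
                    \<Longrightarrow> (idn C a \<boxplus> (runit C b \<cdot> sym C (munit C) b)) \<cdot> assc C a (munit C) b
                          = runit C a \<boxplus> idn C b"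
    and pentagon: "\<lbrakk>a \<in> Ob C; b \<in> Ob C; c \<in> Ob C; d \<in> Ob C\<rbrakk>
                    \<Longrightarrow> assc C a b (c \<oplus> d) \<cdot> assc C (a \<oplus> b) c d
                          = (idn C a \<boxplus> assc C b c d) \<cdot> assc C a (b \<oplus> c) d \<cdot> (assc C a b c \<boxplus> idn C d)"
    and hexagon: "\<lbrakk>a \<in> Ob C; b \<in> Ob C; c \<in> Ob C\<rbrakk>
                    \<Longrightarrow> assc C b c a \<cdot> sym C a (b \<oplus> c) \<cdot> assc C a b c
                          = (idn C b \<boxplus> sym C a c) \<cdot> assc C b a c \<cdot> (sym C a b \<boxplus> idn C c)"

record ('o1, 'a1, 'o2, 'a2) lax =
  FOb  :: "'o1 \<Rightarrow> 'o2"
  FArr :: "'a1 \<Rightarrow> 'a2"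
  Feta :: "'a2"
  Fxi  :: "'o1 \<Rightarrow> 'o1 \<Rightarrow> 'a2"

text \<open>All components are required to be \<open>undefined\<close> outside their mathematical domain, so that
  equality of records is equality of lax symmetric monoidal functors.\<close>

definition lax_smf ::
  "('o1, 'a1) smc \<Rightarrow> ('o2, 'a2) smc \<Rightarrow> ('o1, 'a1, 'o2, 'a2) lax \<Rightarrow> bool" where
  "lax_smf C D F \<longleftrightarrow>
     is_functor C D (FOb F) (FArr F) \<and>
     FOb F \<in> extensional (Ob C) \<and> FArr F \<in> extensional (Arr C) \<and>
     (\<forall>a b. \<not> (a \<in> Ob C \<and> b \<in> Ob C) \<longrightarrow> Fxi F a b = undefined) \<and>
     Feta F \<in> hom D (munit D) (FOb F (munit C)) \<and>
     (\<forall>a\<in>Ob C. \<forall>b\<in>Ob C. Fxi F a b \<in> hom D (FOb F a \<oplus>\<^bsub>D\<^esub> FOb F b) (FOb F (a \<oplus>\<^bsub>C\<^esub> b))) \<and>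
     (\<forall>f\<in>Arr C. \<forall>g\<in>Arr C.
        FArr F (f \<boxplus>\<^bsub>C\<^esub> g) \<cdot>\<^bsub>D\<^esub> Fxi F (Dom C f) (Dom C g)
          = Fxi F (Cod C f) (Cod C g) \<cdot>\<^bsub>D\<^esub> (FArr F f \<boxplus>\<^bsub>D\<^esub> FArr F g)) \<and>
     (\<forall>a\<in>Ob C.
        FArr F (runit C a) \<cdot>\<^bsub>D\<^esub> Fxi F a (munit C) \<cdot>\<^bsub>D\<^esub> (idn D (FOb F a) \<boxplus>\<^bsub>D\<^esub> Feta F)
          = runit D (FOb F a)) \<and>
     (\<forall>a\<in>Ob C. \<forall>b\<in>Ob C. \<forall>c\<in>Ob C.
        FArr F (assc C a b c) \<cdot>\<^bsub>D\<^esub> Fxi F (a \<oplus>\<^bsub>C\<^esub> b) c \<cdot>\<^bsub>D\<^esub> (Fxi F a b \<boxplus>\<^bsub>D\<^esub> idn D (FOb F c))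
          = Fxi F a (b \<oplus>\<^bsub>C\<^esub> c) \<cdot>\<^bsub>D\<^esub> (idn D (FOb F a) \<boxplus>\<^bsub>D\<^esub> Fxi F b c)
              \<cdot>\<^bsub>D\<^esub> assc D (FOb F a) (FOb F b) (FOb F c)) \<and>
     (\<forall>a\<in>Ob C. \<forall>b\<in>Ob C.
        FArr F (sym C a b) \<cdot>\<^bsub>D\<^esub> Fxi F a b = Fxi F b a \<cdot>\<^bsub>D\<^esub> sym D (FOb F a) (FOb F b))"

definition lax_id :: "('o, 'a) smc \<Rightarrow> ('o, 'a, 'o, 'a) lax" where
  "lax_id C = \<lparr>FOb = restrict (\<lambda>a. a) (Ob C), FArr = restrict (\<lambda>f. f) (Arr C),
     Feta = idn C (munit C),
     Fxi = (\<lambda>a b. if a \<in> Ob C \<and> b \<in> Ob C then idn C (a \<oplus>\<^bsub>C\<^esub> b) else undefined)\<rparr>"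

definition lax_comp ::
  "('o1, 'a1) smc \<Rightarrow> ('o3, 'a3) smc \<Rightarrow> ('o2, 'a2, 'o3, 'a3) lax \<Rightarrow> ('o1, 'a1, 'o2, 'a2) lax
     \<Rightarrow> ('o1, 'a1, 'o3, 'a3) lax" where
  "lax_comp C E G F = \<lparr>FOb = compose (Ob C) (FOb G) (FOb F),
     FArr = compose (Arr C) (FArr G) (FArr F),
     Feta = FArr G (Feta F) \<cdot>\<^bsub>E\<^esub> Feta G,
     Fxi = (\<lambda>a b. if a \<in> Ob C \<and> b \<in> Ob C
              then FArr G (Fxi F a b) \<cdot>\<^bsub>E\<^esub> Fxi G (FOb F a) (FOb F b) else undefined)\<rparr>"

definition SMCat :: "(('o, 'a) smc, ('o, 'a) smc \<times> ('o, 'a, 'o, 'a) lax \<times> ('o, 'a) smc) cat" where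
  "SMCat = \<lparr>Ob = {C. symmetric_monoidal_category C},
     Arr = {(C, F, D). symmetric_monoidal_category C \<and> symmetric_monoidal_category D \<and> lax_smf C D F},
     Dom = (\<lambda>(C, F, D). C), Cod = (\<lambda>(C, F, D). D),
     idn = (\<lambda>C. (C, lax_id C, C)),
     cmp = (\<lambda>(D, G, E) (C, F, D'). (C, lax_comp C E G F, E))\<rparr>"

text \<open>A morphism carries its source tuple and its target, so the morphism set with source \<open>xs\<close> and
  target \<open>y\<close> is the set of \<open>f \<in> MArr M\<close> with \<open>MSrc M f = xs\<close> and \<open>MTgt M f = y\<close>.  Tuples are
  indexed from 0, and the tuple written with the inverse of \<open>\<sigma>\<close> acting on \<open>xs\<close>, that is
  \<open>i \<mapsto> xs ! \<sigma> i\<close>, is \<open>permute_list \<sigma> xs\<close>.\<close>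

record ('o, 'm) multicat =
  MOb   :: "'o set"
  MArr  :: "'m set"
  MSrc  :: "'m \<Rightarrow> 'o list"
  MTgt  :: "'m \<Rightarrow> 'o"
  MId   :: "'o \<Rightarrow> 'm"
  MComp :: "'m \<Rightarrow> 'm list \<Rightarrow> 'm"
  MAct  :: "(nat \<Rightarrow> nat) \<Rightarrow> 'm \<Rightarrow> 'm"

definition composable :: "('o, 'm) multicat \<Rightarrow> 'm \<Rightarrow> 'm list \<Rightarrow> bool" where
  "composable M g fs \<longleftrightarrow> g \<in> MArr M \<and> set fs \<subseteq> MArr M \<and> MSrc M g = map (MTgt M) fs"

text \<open>\<open>blocks js\<close> cuts the positions below \<open>sum_list js\<close> into consecutive blocks of lengths \<open>js\<close>.
  The block permutation of \<open>\<sigma>\<close> satisfies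
  \<open>permute_list (block_perm \<sigma> (map length xss)) (concat xss) = concat (permute_list \<sigma> xss)\<close>, and
  \<open>sum_perm \<sigma>s js\<close> is the block sum of the permutations \<open>\<sigma>s\<close>.\<close>

definition blocks :: "nat list \<Rightarrow> nat list list" where
  "blocks js = map (\<lambda>s. [sum_list (take s js)..<sum_list (take (Suc s) js)]) [0..<length js]"

definition list_perm :: "nat list \<Rightarrow> nat \<Rightarrow> nat" where
  "list_perm ps i = (if i < length ps then ps ! i else i)"

definition block_perm :: "(nat \<Rightarrow> nat) \<Rightarrow> nat list \<Rightarrow> nat \<Rightarrow> nat" where
  "block_perm \<sigma> js = list_perm (concat (permute_list \<sigma> (blocks js)))"

definition sum_perm :: "(nat \<Rightarrow> nat) list \<Rightarrow> nat list \<Rightarrow> nat \<Rightarrow> nat" where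
  "sum_perm \<sigma>s js = list_perm (concat (map2 permute_list \<sigma>s (blocks js)))"

locale multicategory =
  fixes M :: "('o, 'm) multicat"
  assumes src_in: "f \<in> MArr M \<Longrightarrow> set (MSrc M f) \<subseteq> MOb M"
    and tgt_in: "f \<in> MArr M \<Longrightarrow> MTgt M f \<in> MOb M"
    and id_in: "a \<in> MOb M \<Longrightarrow> MId M a \<in> MArr M \<and> MSrc M (MId M a) = [a] \<and> MTgt M (MId M a) = a"
    and comp_in: "composable M g fs \<Longrightarrow>
          MComp M g fs \<in> MArr M \<and> MSrc M (MComp M g fs) = concat (map (MSrc M) fs) \<and>
          MTgt M (MComp M g fs) = MTgt M g"
    and act_in: "\<lbrakk>f \<in> MArr M; \<sigma> permutes {..<length (MSrc M f)}\<rbrakk> \<Longrightarrow>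
          MAct M \<sigma> f \<in> MArr M \<and> MSrc M (MAct M \<sigma> f) = permute_list \<sigma> (MSrc M f) \<and>
          MTgt M (MAct M \<sigma> f) = MTgt M f"
    and unit_left: "f \<in> MArr M \<Longrightarrow> MComp M (MId M (MTgt M f)) [f] = f"
    and unit_right: "f \<in> MArr M \<Longrightarrow> MComp M f (map (MId M) (MSrc M f)) = f"
    and comp_assoc: "\<lbrakk>composable M h gs; list_all2 (composable M) gs fss\<rbrakk> \<Longrightarrow>
          MComp M (MComp M h gs) (concat fss) = MComp M h (map2 (MComp M) gs fss)"
    and act_id: "f \<in> MArr M \<Longrightarrow> MAct M id f = f"
    and act_comp: "\<lbrakk>f \<in> MArr M; \<sigma> permutes {..<length (MSrc M f)};
            \<tau> permutes {..<length (MSrc M f)}\<rbrakk> \<Longrightarrow>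
          MAct M \<tau> (MAct M \<sigma> f) = MAct M (\<sigma> \<circ> \<tau>) f"
    and equivariance_outer: "\<lbrakk>composable M g fs; \<sigma> permutes {..<length fs}\<rbrakk> \<Longrightarrow>
          MComp M (MAct M \<sigma> g) (permute_list \<sigma> fs)
            = MAct M (block_perm \<sigma> (map (\<lambda>f. length (MSrc M f)) fs)) (MComp M g fs)"
    and equivariance_inner: "\<lbrakk>composable M g fs;
            list_all2 (\<lambda>\<sigma> f. \<sigma> permutes {..<length (MSrc M f)}) \<sigma>s fs\<rbrakk> \<Longrightarrow>
          MComp M g (map2 (MAct M) \<sigma>s fs)
            = MAct M (sum_perm \<sigma>s (map (\<lambda>f. length (MSrc M f)) fs)) (MComp M g fs)"

text \<open>A multifunctor is a pair of an object map and a morphism map, both \<open>undefined\<close> outside their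
  mathematical domain.\<close>

type_synonym ('o1, 'm1, 'o2, 'm2) mfun = "('o1 \<Rightarrow> 'o2) \<times> ('m1 \<Rightarrow> 'm2)"

definition multifunctor ::
  "('o1, 'm1) multicat \<Rightarrow> ('o2, 'm2) multicat \<Rightarrow> ('o1, 'm1, 'o2, 'm2) mfun \<Rightarrow> bool" where
  "multifunctor M N G \<longleftrightarrow>
     multicategory M \<and> multicategory N \<and>
     fst G \<in> extensional (MOb M) \<and> snd G \<in> extensional (MArr M) \<and>
     (\<forall>a\<in>MOb M. fst G a \<in> MOb N) \<and>
     (\<forall>f\<in>MArr M. snd G f \<in> MArr N \<and> MSrc N (snd G f) = map (fst G) (MSrc M f) \<and>
        MTgt N (snd G f) = fst G (MTgt M f)) \<and>
     (\<forall>a\<in>MOb M. snd G (MId M a) = MId N (fst G a)) \<and>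
     (\<forall>g fs. composable M g fs \<longrightarrow> snd G (MComp M g fs) = MComp N (snd G g) (map (snd G) fs)) \<and>
     (\<forall>f\<in>MArr M. \<forall>\<sigma>. \<sigma> permutes {..<length (MSrc M f)} \<longrightarrow>
        snd G (MAct M \<sigma> f) = MAct N \<sigma> (snd G f))"

definition mfun_id :: "('o, 'm) multicat \<Rightarrow> ('o, 'm, 'o, 'm) mfun" where
  "mfun_id M = (restrict (\<lambda>a. a) (MOb M), restrict (\<lambda>f. f) (MArr M))"

definition mfun_comp ::
  "('o1, 'm1) multicat \<Rightarrow> ('o2, 'm2, 'o3, 'm3) mfun \<Rightarrow> ('o1, 'm1, 'o2, 'm2) mfun
     \<Rightarrow> ('o1, 'm1, 'o3, 'm3) mfun" where
  "mfun_comp M H G = (compose (MOb M) (fst H) (fst G), compose (MArr M) (snd H) (snd G))"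

definition MultCat ::
  "(('o, 'm) multicat, ('o, 'm) multicat \<times> ('o, 'm, 'o, 'm) mfun \<times> ('o, 'm) multicat) cat" where
  "MultCat = \<lparr>Ob = {M. multicategory M},
     Arr = {(M, G, N). multicategory M \<and> multicategory N \<and> multifunctor M N G},
     Dom = (\<lambda>(M, G, N). M), Cod = (\<lambda>(M, G, N). N),
     idn = (\<lambda>M. (M, mfun_id M, M)),
     cmp = (\<lambda>(N, H, P) (M, G, N'). (M, mfun_comp M H G, P))\<rparr>"

text \<open>\<open>WVar i\<close> is the variable with (0-based) index \<open>i\<close>; \<open>Y n\<close> is the set of objects of the
  category of \<open>n\<close>-ary operations.  Its morphisms need no separate representation: there is exactly
  one for every pair of words.\<close>

datatype word = WE | WVar nat | WTen word word

primrec wvars :: "word \<Rightarrow> nat list" where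
  "wvars WE = []"
| "wvars (WVar i) = [i]"
| "wvars (WTen u v) = wvars u @ wvars v"

definition Y :: "nat \<Rightarrow> word set" where
  "Y n = {w. distinct (wvars w) \<and> set (wvars w) = {..<n}}"

definition arity :: "word \<Rightarrow> nat" where
  "arity w = length (wvars w)"

primrec wsubst :: "(nat \<Rightarrow> word) \<Rightarrow> word \<Rightarrow> word" where
  "wsubst \<rho> WE = WE"
| "wsubst \<rho> (WVar i) = \<rho> i"
| "wsubst \<rho> (WTen u v) = WTen (wsubst \<rho> u) (wsubst \<rho> v)"

definition wgamma :: "word \<Rightarrow> word list \<Rightarrow> word" where
  "wgamma w ws = wsubst (\<lambda>s. wsubst (\<lambda>i. WVar (sum_list (map arity (take s ws)) + i)) (ws ! s)) w"

text \<open>The right action: \<open>wact w \<sigma>\<close> evaluated at \<open>permute_list \<sigma> xs\<close> is \<open>w\<close> evaluated at \<open>xs\<close>.\<close>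

definition wact :: "word \<Rightarrow> (nat \<Rightarrow> nat) \<Rightarrow> word" where
  "wact w \<sigma> = wsubst (\<lambda>i. WVar (inv \<sigma> i)) w"

primrec evO :: "('o, 'a) smc \<Rightarrow> word \<Rightarrow> 'o list \<Rightarrow> 'o" where
  "evO C WE xs = munit C"
| "evO C (WVar i) xs = xs ! i"
| "evO C (WTen u v) xs = evO C u xs \<oplus>\<^bsub>C\<^esub> evO C v xs"

primrec evA :: "('o, 'a) smc \<Rightarrow> word \<Rightarrow> 'a list \<Rightarrow> 'a" where
  "evA C WE fs = idn C (munit C)"
| "evA C (WVar i) fs = fs ! i"
| "evA C (WTen u v) fs = evA C u fs \<boxplus>\<^bsub>C\<^esub> evA C v fs"

text \<open>\<open>canonical C xs w w' f\<close>: the morphism \<open>f\<close> is the component at \<open>xs\<close> of a natural isomorphism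
  from \<open>w\<close> to \<open>w'\<close> built from the structure isomorphisms.  Derivations refer to the formal words and
  not to their values, so entries of \<open>xs\<close> that happen to be equal are not confused.  For \<open>w\<close> and
  \<open>w'\<close> in \<open>Y n\<close> such an \<open>f\<close> is unique by the coherence theorem.\<close>

inductive canonical :: "('o, 'a) smc \<Rightarrow> 'o list \<Rightarrow> word \<Rightarrow> word \<Rightarrow> 'a \<Rightarrow> bool"
  for C xs where
  can_id: "canonical C xs w w (idn C (evO C w xs))"
| can_comp: "\<lbrakk>canonical C xs u v f; canonical C xs v w g\<rbrakk> \<Longrightarrow> canonical C xs u w (g \<cdot>\<^bsub>C\<^esub> f)"
| can_inv: "\<lbrakk>canonical C xs u v f; inverses C f g\<rbrakk> \<Longrightarrow> canonical C xs v u g"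
| can_ten: "\<lbrakk>canonical C xs u u' f; canonical C xs v v' g\<rbrakk>
              \<Longrightarrow> canonical C xs (WTen u v) (WTen u' v') (f \<boxplus>\<^bsub>C\<^esub> g)"
| can_assc: "canonical C xs (WTen (WTen u v) w) (WTen u (WTen v w))
              (assc C (evO C u xs) (evO C v xs) (evO C w xs))"
| can_runit: "canonical C xs (WTen u WE) u (runit C (evO C u xs))"
| can_sym: "canonical C xs (WTen u v) (WTen v u) (sym C (evO C u xs) (evO C v xs))"

definition can :: "('o, 'a) smc \<Rightarrow> word \<Rightarrow> word \<Rightarrow> 'o list \<Rightarrow> 'a" where
  "can C w w' xs = (THE f. canonical C xs w w' f)"

text \<open>A sequence of functions \<open>\<kappa>\<^sub>n\<close> on \<open>n\<close>-tuples is one function on tuples of arbitrary length.\<close>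

definition word_choice :: "('o, 'a) smc \<Rightarrow> ('o list \<Rightarrow> word) \<Rightarrow> bool" where
  "word_choice C \<kappa> \<longleftrightarrow> (\<forall>xs. set xs \<subseteq> Ob C \<longrightarrow> \<kappa> xs \<in> Y (length xs))"

definition Umult :: "('o, 'a) smc \<Rightarrow> ('o list \<Rightarrow> word) \<Rightarrow> ('o, 'o list \<times> 'a) multicat" where
  "Umult C \<kappa> = \<lparr>MOb = Ob C,
     MArr = {(xs, f). set xs \<subseteq> Ob C \<and> f \<in> Arr C \<and> Dom C f = evO C (\<kappa> xs) xs},
     MSrc = fst,
     MTgt = (\<lambda>(xs, f). Cod C f),
     MId = (\<lambda>a. ([a], can C (\<kappa> [a]) (WVar 0) [a])),
     MComp = (\<lambda>(ys, g) fs. let xss = map fst fs in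
        (concat xss,
         g \<cdot>\<^bsub>C\<^esub> evA C (\<kappa> ys) (map snd fs)
           \<cdot>\<^bsub>C\<^esub> can C (\<kappa> (concat xss)) (wgamma (\<kappa> ys) (map \<kappa> xss)) (concat xss))),
     MAct = (\<lambda>\<sigma> (xs, f). let xs' = permute_list \<sigma> xs in
        (xs', f \<cdot>\<^bsub>C\<^esub> can C (\<kappa> xs') (wact (\<kappa> xs) \<sigma>) xs'))\<rparr>"

definition Ucan ::
  "('o, 'a) smc \<Rightarrow> ('o list \<Rightarrow> word) \<Rightarrow> ('o list \<Rightarrow> word)
     \<Rightarrow> ('o, 'o list \<times> 'a, 'o, 'o list \<times> 'a) mfun" where
  "Ucan C \<kappa> \<mu> =
     (restrict (\<lambda>a. a) (Ob C),
      restrict (\<lambda>(xs, f). (xs, f \<cdot>\<^bsub>C\<^esub> can C (\<mu> xs) (\<kappa> xs) xs)) (MArr (Umult C \<kappa>)))"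

fun kword :: "nat \<Rightarrow> word" where
  "kword 0 = WE"
| "kword (Suc 0) = WVar 0"
| "kword (Suc (Suc n)) = wgamma (WTen (WVar 0) (WVar 1)) [kword (Suc n), WVar 0]"

definition kchoice :: "'o list \<Rightarrow> word" where
  "kchoice xs = kword (length xs)"

text \<open>\<open>xin C D F n xs\<close> is the map \<open>\<xi>\<^sub>n\<close> for the tuple of the first \<open>n\<close> entries of \<open>xs\<close>.\<close>

fun xin :: "('o1, 'a1) smc \<Rightarrow> ('o2, 'a2) smc \<Rightarrow> ('o1, 'a1, 'o2, 'a2) lax \<Rightarrow> nat \<Rightarrow> 'o1 list \<Rightarrow> 'a2"
  where
  "xin C D F 0 xs = Feta F"
| "xin C D F (Suc 0) xs = idn D (FOb F (xs ! 0))"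
| "xin C D F (Suc (Suc n)) xs =
     Fxi F (evO C (kword (Suc n)) (take (Suc n) xs)) (xs ! Suc n)
       \<cdot>\<^bsub>D\<^esub> (xin C D F (Suc n) xs \<boxplus>\<^bsub>D\<^esub> idn D (FOb F (xs ! Suc n)))"

definition UkF ::
  "('o1, 'a1) smc \<Rightarrow> ('o2, 'a2) smc \<Rightarrow> ('o1, 'a1, 'o2, 'a2) lax
     \<Rightarrow> ('o1, 'o1 list \<times> 'a1, 'o2, 'o2 list \<times> 'a2) mfun" where
  "UkF C D F =
     (FOb F,
      restrict (\<lambda>(xs, f). (map (FOb F) xs, FArr F f \<cdot>\<^bsub>D\<^esub> xin C D F (length xs) xs))
        (MArr (Umult C kchoice)))"

definition UF ::
  "('o1, 'a1) smc \<Rightarrow> ('o1 list \<Rightarrow> word) \<Rightarrow> ('o2, 'a2) smc \<Rightarrow> ('o2 list \<Rightarrow> word)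
     \<Rightarrow> ('o1, 'a1, 'o2, 'a2) lax \<Rightarrow> ('o1, 'o1 list \<times> 'a1, 'o2, 'o2 list \<times> 'a2) mfun" where
  "UF C \<kappa> D \<mu> F =
     mfun_comp (Umult C \<kappa>) (Ucan D kchoice \<mu>)
       (mfun_comp (Umult C \<kappa>) (UkF C D F) (Ucan C \<kappa> kchoice))"

end

theory Submission
  imports Defs
begin

text \<open>
  The proof rests on the coherence theorem and on one change of presentation.

  Coherence (\<open>smc_tuple.coherence\<close>) says that there is at most one canonical arrow between two words
  with distinct variables.  It is proved by letting words act on lists \<open>l\<close> of variables.  Write
  \<open>N l\<close> for the right-nested product of the variables in \<open>l\<close>.  The isomorphism \<open>absorb w l\<close> goes from
  \<open>w \<oplus> N l\<close> to \<open>N l'\<close>, where \<open>l'\<close> is \<open>l\<close> with the variables of \<open>w\<close> inserted in order, and every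
  canonical \<open>f\<close> from \<open>u\<close> to \<open>v\<close> satisfies \<open>absorb v l \<cdot> (f \<boxplus> 1) = absorb u l\<close>.  The case \<open>l = []\<close>
  determines \<open>f\<close>, because \<open>absorb v []\<close> is invertible and tensoring with the unit object is faithful.
  For the associator this identity is the pentagon and for the unit it is the triangle.  For the
  symmetry it says that the actions of two words commute; this reduces to the actions of two
  variables, and there it is the Yang-Baxter equation for \<open>swap\<close>, a consequence of the hexagon.

  The change of presentation is \<open>mor w xs f\<close>.  An arrow \<open>f\<close> out of the value of any word \<open>w\<close>, not only
  the chosen word \<open>\<kappa> xs\<close>, presents a multimorphism with source \<open>xs\<close>, namely \<open>f\<close> composed with the
  canonical isomorphism from \<open>\<kappa> xs\<close> to \<open>w\<close>.  In this presentation the choice \<open>\<kappa>\<close> is invisible: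
  identities are presented by identities at the word \<open>x\<^sub>1\<close>, composites by plain composites at the word
  \<open>wgamma w ws\<close>, and the group action changes only the word, to \<open>wact w \<sigma>\<close>.  The axioms of a
  multicategory become the axioms of the operad of words.

  A lax functor \<open>F\<close> has a structure map \<open>xi_word w\<close> for every word \<open>w\<close>, and these maps commute with all
  canonical isomorphisms.  Hence \<open>UF\<close> sends \<open>mor w xs f\<close> to \<open>mor w (F xs) (F f \<cdot> xi_word w xs)\<close>, for
  any \<open>w\<close>, and is a multifunctor.  Conversely a multifunctor \<open>G\<close> sends the multimorphism presented by
  \<open>f\<close> at \<open>w\<close> to one presented at \<open>w\<close> by an arrow \<open>G_word w xs f\<close>.  The lax functor is read off at three
  words: \<open>F f\<close> at \<open>x\<^sub>1\<close>, the unit map at \<open>e\<close>, the product map at \<open>x\<^sub>1 \<oplus> x\<^sub>2\<close>.  Each of its axioms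
  comes from writing one word as a substitution instance in two ways, or from two words related by a
  canonical isomorphism.  Since the words \<open>k\<^sub>n\<close> are operadic composites of \<open>e\<close>, \<open>x\<^sub>1\<close> and \<open>x\<^sub>1 \<oplus> x\<^sub>2\<close>,
  these values determine \<open>G\<close>, and the two constructions are mutually inverse.

  Identities and composites of multifunctors are again multifunctors, and reading them off at the three
  words gives the identity and the composite of lax functors.  So the assignment is functorial, and the
  category laws for lax functors follow from those for multifunctors because \<open>UF\<close> is injective.
\<close>

section \<open>Symmetric monoidal categories\<close>

text \<open>The laws of a category are restated with \<open>Arr\<close>, \<open>Dom\<close> and \<open>Cod\<close> in place of \<open>hom\<close>.  In this form the
  simplifier discharges the typing conditions itself and nests all composites to the right.\<close>

context category begin

lemma arr_cmp [simp]: "\<lbrakk>f \<in> Arr C; g \<in> Arr C; Cod C f = Dom C g\<rbrakk> \<Longrightarrow> g \<cdot> f \<in> Arr C"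
  and dom_cmp [simp]: "\<lbrakk>f \<in> Arr C; g \<in> Arr C; Cod C f = Dom C g\<rbrakk> \<Longrightarrow> Dom C (g \<cdot> f) = Dom C f"
  and cod_cmp [simp]: "\<lbrakk>f \<in> Arr C; g \<in> Arr C; Cod C f = Dom C g\<rbrakk> \<Longrightarrow> Cod C (g \<cdot> f) = Cod C g"
  using cmp_hom[of f "Dom C f" "Cod C f" g "Cod C g"] by (auto simp: hom_def)

lemma arr_idn [simp]: "a \<in> Ob C \<Longrightarrow> idn C a \<in> Arr C"
  and dom_idn [simp]: "a \<in> Ob C \<Longrightarrow> Dom C (idn C a) = a"
  and cod_idn [simp]: "a \<in> Ob C \<Longrightarrow> Cod C (idn C a) = a"
  using idn_hom[of a] by (auto simp: hom_def)

lemma idn_cmp [simp]: "\<lbrakk>f \<in> Arr C; Cod C f = b\<rbrakk> \<Longrightarrow> idn C b \<cdot> f = f"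
  and cmp_idn [simp]: "\<lbrakk>f \<in> Arr C; Dom C f = a\<rbrakk> \<Longrightarrow> f \<cdot> idn C a = f"
  using idn_left idn_right by (auto simp: hom_def)

lemma cmp_assoc' [simp]:
  "\<lbrakk>f \<in> Arr C; g \<in> Arr C; h \<in> Arr C; Cod C f = Dom C g; Cod C g = Dom C h\<rbrakk>
    \<Longrightarrow> (h \<cdot> g) \<cdot> f = h \<cdot> (g \<cdot> f)"
  using cmp_assoc[of f "Dom C f" "Cod C f" g "Cod C g" h "Cod C h"] by (auto simp: hom_def)

lemma Dom_in' [simp]: "f \<in> Arr C \<Longrightarrow> Dom C f \<in> Ob C"
  and Cod_in' [simp]: "f \<in> Arr C \<Longrightarrow> Cod C f \<in> Ob C"
  using Dom_in Cod_in by auto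

text \<open>Composites are nested to the right, so an equation for \<open>g \<cdot> f\<close> matches inside a longer composite only
  in this extended form.\<close>

lemma cmp_extend:
  assumes "g \<cdot> f = k" "t \<in> Arr C" "f \<in> Arr C" "g \<in> Arr C" "Cod C f = Dom C g" "Cod C t = Dom C f"
  shows "g \<cdot> (f \<cdot> t) = k \<cdot> t"
  using assms cmp_assoc'[of t f g] by simp

lemma inverses_sym: "inverses C f g \<Longrightarrow> inverses C g f"
  by (auto simp: inverses_def hom_def)

lemma iso_epi:
  assumes "is_iso C f" "g \<cdot> f = h \<cdot> f" "g \<in> Arr C" "h \<in> Arr C" "Dom C g = Cod C f" "Dom C h = Cod C f"
  shows "g = h"
proof -
  obtain k where k: "inverses C f k" using assms(1) is_iso_def by metis
  hence k': "k \<in> Arr C" "Dom C k = Cod C f" "Cod C k = Dom C f" "f \<cdot> k = idn C (Cod C f)" "f \<in> Arr C"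
    by (auto simp: inverses_def hom_def)
  have "g = g \<cdot> (f \<cdot> k)" using assms k' by simp
  also have "\<dots> = (h \<cdot> f) \<cdot> k" using assms k' cmp_assoc'[of k f g] by simp
  also have "\<dots> = h" using assms k' by simp
  finally show ?thesis .
qed

lemma iso_mono:
  assumes "is_iso C f" "f \<cdot> g = f \<cdot> h" "g \<in> Arr C" "h \<in> Arr C" "Cod C g = Dom C f" "Cod C h = Dom C f"
  shows "g = h"
proof -
  obtain k where k: "inverses C f k" using assms(1) is_iso_def by metis
  hence k': "k \<in> Arr C" "Dom C k = Cod C f" "Cod C k = Dom C f" "k \<cdot> f = idn C (Dom C f)" "f \<in> Arr C"
    by (auto simp: inverses_def hom_def)
  have "g = (k \<cdot> f) \<cdot> g" using assms(3,5) k' by simp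
  also have "\<dots> = k \<cdot> (f \<cdot> g)" by (rule cmp_assoc') (use assms k' in simp_all)
  also have "\<dots> = k \<cdot> (f \<cdot> h)" by (simp only: assms(2))
  also have "\<dots> = (k \<cdot> f) \<cdot> h" by (rule cmp_assoc'[symmetric]) (use assms k' in simp_all)
  also have "\<dots> = h" using assms(4,6) k' by simp
  finally show ?thesis .
qed

lemma is_iso_idn: "a \<in> Ob C \<Longrightarrow> is_iso C (idn C a)"
  unfolding is_iso_def inverses_def by (rule exI[of _ "idn C a"]) (simp add: hom_def)

lemma is_iso_cmp:
  assumes "is_iso C f" "is_iso C g" "Cod C f = Dom C g"
  shows "is_iso C (g \<cdot> f)"
proof -
  obtain f' g' where i: "inverses C f f'" "inverses C g g'" using assms is_iso_def by metis
  hence f: "f' \<in> Arr C" "Dom C f' = Cod C f" "Cod C f' = Dom C f" "f \<in> Arr C"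
      "f' \<cdot> f = idn C (Dom C f)" "f \<cdot> f' = idn C (Cod C f)"
    and g: "g' \<in> Arr C" "Dom C g' = Cod C g" "Cod C g' = Dom C g" "g \<in> Arr C"
      "g' \<cdot> g = idn C (Dom C g)" "g \<cdot> g' = idn C (Cod C g)"
    by (auto simp: inverses_def hom_def)
  have "g' \<cdot> (g \<cdot> f) = f" using cmp_extend[OF g(5), of f] f g assms(3) by simp
  moreover have "f \<cdot> (f' \<cdot> g') = g'" using cmp_extend[OF f(6), of g'] f g assms(3) by simp
  ultimately show ?thesis using f g assms(3)
    unfolding is_iso_def inverses_def by (intro exI[of _ "f' \<cdot> g'"]) (simp add: hom_def)
qed

lemma is_iso_inverses: "inverses C f g \<Longrightarrow> is_iso C g"
  unfolding is_iso_def by (rule exI) (rule inverses_sym)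

end

context symmetric_monoidal_category begin

lemma munit_Ob [simp]: "munit C \<in> Ob C" by (rule munit_in)

lemma tenO_Ob [simp]: "\<lbrakk>a \<in> Ob C; b \<in> Ob C\<rbrakk> \<Longrightarrow> a \<oplus> b \<in> Ob C" by (rule tenO_in)

lemma arr_ten [simp]: "\<lbrakk>f \<in> Arr C; g \<in> Arr C\<rbrakk> \<Longrightarrow> f \<boxplus> g \<in> Arr C"
  and dom_ten [simp]: "\<lbrakk>f \<in> Arr C; g \<in> Arr C\<rbrakk> \<Longrightarrow> Dom C (f \<boxplus> g) = Dom C f \<oplus> Dom C g"
  and cod_ten [simp]: "\<lbrakk>f \<in> Arr C; g \<in> Arr C\<rbrakk> \<Longrightarrow> Cod C (f \<boxplus> g) = Cod C f \<oplus> Cod C g"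
  using tenA_hom[of f "Dom C f" "Cod C f" g "Dom C g" "Cod C g"] by (auto simp: hom_def)

lemma ten_idn [simp]: "\<lbrakk>a \<in> Ob C; b \<in> Ob C\<rbrakk> \<Longrightarrow> idn C a \<boxplus> idn C b = idn C (a \<oplus> b)"
  by (rule tenA_idn)

lemma ten_cmp:
  "\<lbrakk>f \<in> Arr C; f' \<in> Arr C; g \<in> Arr C; g' \<in> Arr C; Cod C f = Dom C f'; Cod C g = Dom C g'\<rbrakk>
    \<Longrightarrow> (f' \<boxplus> g') \<cdot> (f \<boxplus> g) = (f' \<cdot> f) \<boxplus> (g' \<cdot> g)"
  using tenA_cmp[of f "Dom C f" "Cod C f" f' "Cod C f'" g "Dom C g" "Cod C g" g' "Cod C g'"]
  by (auto simp: hom_def)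

lemma ten_cmp':
  "\<lbrakk>f \<in> Arr C; f' \<in> Arr C; g \<in> Arr C; g' \<in> Arr C; Cod C f = Dom C f'; Cod C g = Dom C g';
    t \<in> Arr C; Cod C t = Dom C f \<oplus> Dom C g\<rbrakk>
    \<Longrightarrow> (f' \<boxplus> g') \<cdot> ((f \<boxplus> g) \<cdot> t) = ((f' \<cdot> f) \<boxplus> (g' \<cdot> g)) \<cdot> t"
  by (rule cmp_extend) (auto simp: ten_cmp)

lemma whisker_left:
  "\<lbrakk>a \<in> Ob C; f \<in> Arr C; g \<in> Arr C; Cod C f = Dom C g\<rbrakk>
    \<Longrightarrow> idn C a \<boxplus> (g \<cdot> f) = (idn C a \<boxplus> g) \<cdot> (idn C a \<boxplus> f)"
  by (simp add: ten_cmp)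

lemma whisker_right:
  "\<lbrakk>a \<in> Ob C; f \<in> Arr C; g \<in> Arr C; Cod C f = Dom C g\<rbrakk>
    \<Longrightarrow> (g \<cdot> f) \<boxplus> idn C a = (g \<boxplus> idn C a) \<cdot> (f \<boxplus> idn C a)"
  by (simp add: ten_cmp)

lemma is_iso_ten:
  assumes "is_iso C f" "is_iso C g"
  shows "is_iso C (f \<boxplus> g)"
proof -
  obtain f' g' where i: "inverses C f f'" "inverses C g g'" using assms is_iso_def by metis
  thus ?thesis
    unfolding is_iso_def inverses_def by (intro exI[of _ "f' \<boxplus> g'"]) (simp add: hom_def ten_cmp)
qed

lemma assc_arr [simp]: "\<lbrakk>a \<in> Ob C; b \<in> Ob C; c \<in> Ob C\<rbrakk> \<Longrightarrow> assc C a b c \<in> Arr C"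
  and assc_dom [simp]: "\<lbrakk>a \<in> Ob C; b \<in> Ob C; c \<in> Ob C\<rbrakk> \<Longrightarrow> Dom C (assc C a b c) = (a \<oplus> b) \<oplus> c"
  and assc_cod [simp]: "\<lbrakk>a \<in> Ob C; b \<in> Ob C; c \<in> Ob C\<rbrakk> \<Longrightarrow> Cod C (assc C a b c) = a \<oplus> (b \<oplus> c)"
  using assc_hom[of a b c] by (auto simp: hom_def)

lemma runit_arr [simp]: "a \<in> Ob C \<Longrightarrow> runit C a \<in> Arr C"
  and runit_dom [simp]: "a \<in> Ob C \<Longrightarrow> Dom C (runit C a) = a \<oplus> munit C"
  and runit_cod [simp]: "a \<in> Ob C \<Longrightarrow> Cod C (runit C a) = a"
  using runit_hom[of a] by (auto simp: hom_def)

lemma sym_arr [simp]: "\<lbrakk>a \<in> Ob C; b \<in> Ob C\<rbrakk> \<Longrightarrow> sym C a b \<in> Arr C"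
  and sym_dom [simp]: "\<lbrakk>a \<in> Ob C; b \<in> Ob C\<rbrakk> \<Longrightarrow> Dom C (sym C a b) = a \<oplus> b"
  and sym_cod [simp]: "\<lbrakk>a \<in> Ob C; b \<in> Ob C\<rbrakk> \<Longrightarrow> Cod C (sym C a b) = b \<oplus> a"
  using sym_hom[of a b] by (auto simp: hom_def)

lemma is_iso_sym: "\<lbrakk>a \<in> Ob C; b \<in> Ob C\<rbrakk> \<Longrightarrow> is_iso C (sym C a b)"
  unfolding is_iso_def inverses_def
  by (rule exI[of _ "sym C b a"]) (simp add: hom_def sym_sym)

lemma assc_natural:
  "\<lbrakk>f \<in> Arr C; g \<in> Arr C; h \<in> Arr C\<rbrakk> \<Longrightarrow>
    assc C (Cod C f) (Cod C g) (Cod C h) \<cdot> ((f \<boxplus> g) \<boxplus> h) =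
    (f \<boxplus> (g \<boxplus> h)) \<cdot> assc C (Dom C f) (Dom C g) (Dom C h)"
  by (rule assc_nat) (auto simp: hom_def)

lemma sym_natural:
  "\<lbrakk>f \<in> Arr C; g \<in> Arr C\<rbrakk> \<Longrightarrow>
    sym C (Cod C f) (Cod C g) \<cdot> (f \<boxplus> g) = (g \<boxplus> f) \<cdot> sym C (Dom C f) (Dom C g)"
  by (rule sym_nat) (auto simp: hom_def)

definition iassc :: "'o \<Rightarrow> 'o \<Rightarrow> 'o \<Rightarrow> 'a" where
  "iassc a b c = (SOME g. inverses C (assc C a b c) g)"

lemma inverses_assc:
  assumes "a \<in> Ob C" "b \<in> Ob C" "c \<in> Ob C"
  shows "inverses C (assc C a b c) (iassc a b c)"
  using assc_iso[OF assms] unfolding is_iso_def iassc_def by (rule someI_ex)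

lemma iassc_arr [simp]: "\<lbrakk>a \<in> Ob C; b \<in> Ob C; c \<in> Ob C\<rbrakk> \<Longrightarrow> iassc a b c \<in> Arr C"
  and iassc_dom [simp]: "\<lbrakk>a \<in> Ob C; b \<in> Ob C; c \<in> Ob C\<rbrakk> \<Longrightarrow> Dom C (iassc a b c) = a \<oplus> (b \<oplus> c)"
  and iassc_cod [simp]: "\<lbrakk>a \<in> Ob C; b \<in> Ob C; c \<in> Ob C\<rbrakk> \<Longrightarrow> Cod C (iassc a b c) = (a \<oplus> b) \<oplus> c"
  and iassc_assc [simp]: "\<lbrakk>a \<in> Ob C; b \<in> Ob C; c \<in> Ob C\<rbrakk> \<Longrightarrow>
      iassc a b c \<cdot> assc C a b c = idn C ((a \<oplus> b) \<oplus> c)"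
  and assc_iassc [simp]: "\<lbrakk>a \<in> Ob C; b \<in> Ob C; c \<in> Ob C\<rbrakk> \<Longrightarrow>
      assc C a b c \<cdot> iassc a b c = idn C (a \<oplus> (b \<oplus> c))"
  using inverses_assc[of a b c] by (auto simp: inverses_def hom_def)

lemma iassc_assc' [simp]: "\<lbrakk>a \<in> Ob C; b \<in> Ob C; c \<in> Ob C; t \<in> Arr C; Cod C t = (a \<oplus> b) \<oplus> c\<rbrakk> \<Longrightarrow>
      iassc a b c \<cdot> (assc C a b c \<cdot> t) = t"
  by (subst cmp_extend[OF iassc_assc]) auto

lemma assc_iassc' [simp]: "\<lbrakk>a \<in> Ob C; b \<in> Ob C; c \<in> Ob C; t \<in> Arr C; Cod C t = a \<oplus> (b \<oplus> c)\<rbrakk> \<Longrightarrow>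
      assc C a b c \<cdot> (iassc a b c \<cdot> t) = t"
  by (subst cmp_extend[OF assc_iassc]) auto

lemma iassc_natural:
  assumes "f \<in> Arr C" "g \<in> Arr C" "h \<in> Arr C"
  shows "((f \<boxplus> g) \<boxplus> h) \<cdot> iassc (Dom C f) (Dom C g) (Dom C h) =
    iassc (Cod C f) (Cod C g) (Cod C h) \<cdot> (f \<boxplus> (g \<boxplus> h))"
proof (rule iso_mono[OF assc_iso[of "Cod C f" "Cod C g" "Cod C h"]])
  show "assc C (Cod C f) (Cod C g) (Cod C h) \<cdot> (((f \<boxplus> g) \<boxplus> h) \<cdot> iassc (Dom C f) (Dom C g) (Dom C h)) =
     assc C (Cod C f) (Cod C g) (Cod C h) \<cdot> (iassc (Cod C f) (Cod C g) (Cod C h) \<cdot> (f \<boxplus> (g \<boxplus> h)))"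
    using cmp_extend[OF assc_natural[OF assms], of "iassc (Dom C f) (Dom C g) (Dom C h)"] assms
    by simp
qed (use assms in simp_all)

definition lunit :: "'o \<Rightarrow> 'a" where
  "lunit a = runit C a \<cdot> sym C (munit C) a"

lemma lunit_arr [simp]: "a \<in> Ob C \<Longrightarrow> lunit a \<in> Arr C"
  and lunit_dom [simp]: "a \<in> Ob C \<Longrightarrow> Dom C (lunit a) = munit C \<oplus> a"
  and lunit_cod [simp]: "a \<in> Ob C \<Longrightarrow> Cod C (lunit a) = a"
  by (auto simp: lunit_def)

lemma is_iso_lunit: "a \<in> Ob C \<Longrightarrow> is_iso C (lunit a)"
  unfolding lunit_def by (rule is_iso_cmp) (auto simp: is_iso_sym runit_iso)

lemma lunit_natural:
  assumes "f \<in> Arr C"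
  shows "lunit (Cod C f) \<cdot> (idn C (munit C) \<boxplus> f) = f \<cdot> lunit (Dom C f)"
proof -
  have "lunit (Cod C f) \<cdot> (idn C (munit C) \<boxplus> f) =
      runit C (Cod C f) \<cdot> ((f \<boxplus> idn C (munit C)) \<cdot> sym C (munit C) (Dom C f))"
    using sym_natural[of "idn C (munit C)" f] assms by (simp add: lunit_def)
  also have "\<dots> = f \<cdot> lunit (Dom C f)"
    using cmp_extend[OF runit_nat[of f "Dom C f" "Cod C f"], of "sym C (munit C) (Dom C f)"] assms
    by (simp add: hom_def lunit_def)
  finally show ?thesis .
qed

lemma triangle':
  "\<lbrakk>a \<in> Ob C; b \<in> Ob C\<rbrakk> \<Longrightarrow>
    (idn C a \<boxplus> lunit b) \<cdot> assc C a (munit C) b = runit C a \<boxplus> idn C b"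
  unfolding lunit_def by (rule triangle)

text \<open>By naturality of the left unit isomorphism, \<open>1 \<boxplus> f\<close> is conjugate to \<open>f\<close>.\<close>

lemma munit_ten_faithful:
  assumes "idn C (munit C) \<boxplus> f = idn C (munit C) \<boxplus> g" "f \<in> Arr C" "g \<in> Arr C"
    "Dom C f = Dom C g" "Cod C f = Cod C g"
  shows "f = g"
proof (rule iso_epi[OF is_iso_lunit[of "Dom C f"]])
  show "f \<cdot> lunit (Dom C f) = g \<cdot> lunit (Dom C f)"
    using lunit_natural[of f] lunit_natural[of g] assms by simp
qed (use assms in simp_all)

text \<open>Kelly's argument: tensoring with the unit object on the left is faithful, and after that the pentagon
  and two instances of the triangle identify both sides, precomposed with the isomorphism \<open>?r\<close>.\<close>

lemma lunit_ten:
  assumes b: "b \<in> Ob C" and c: "c \<in> Ob C"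
  shows "lunit (b \<oplus> c) \<cdot> assc C (munit C) b c = lunit b \<boxplus> idn C c"
proof (rule munit_ten_faithful)
  let ?e = "munit C"
  let ?r = "assc C ?e (?e \<oplus> b) c \<cdot> (assc C ?e ?e b \<boxplus> idn C c)"
  \<comment> \<open>\<open>?r\<close> is the part of the pentagon for \<open>e\<close>, \<open>e\<close>, \<open>b\<close>, \<open>c\<close> that precedes \<open>1 \<boxplus> assc\<close>.\<close>
  have iso: "is_iso C ?r"
    by (intro is_iso_cmp assc_iso is_iso_ten is_iso_idn) (auto simp: b c)
  have "(idn C ?e \<boxplus> (lunit (b \<oplus> c) \<cdot> assc C ?e b c)) \<cdot> ?r =
     (idn C ?e \<boxplus> lunit (b \<oplus> c)) \<cdot> (((idn C ?e \<boxplus> assc C ?e b c) \<cdot> assc C ?e (?e \<oplus> b) c) \<cdot> (assc C ?e ?e b \<boxplus> idn C c))"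
    by (simp add: b c whisker_left)
  also have "\<dots> = (idn C ?e \<boxplus> lunit (b \<oplus> c)) \<cdot> (assc C ?e ?e (b \<oplus> c) \<cdot> assc C (?e \<oplus> ?e) b c)"
    by (subst pentagon) (simp_all add: b c)
  also have "\<dots> = (runit C ?e \<boxplus> idn C (b \<oplus> c)) \<cdot> assc C (?e \<oplus> ?e) b c"
    by (subst cmp_extend[OF triangle']) (simp_all add: b c)
  also have "\<dots> = assc C ?e b c \<cdot> ((runit C ?e \<boxplus> idn C b) \<boxplus> idn C c)"
    using assc_natural[of "runit C ?e" "idn C b" "idn C c"] by (simp add: b c)
  also have "\<dots> = assc C ?e b c \<cdot> (((idn C ?e \<boxplus> lunit b) \<boxplus> idn C c) \<cdot> (assc C ?e ?e b \<boxplus> idn C c))"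
    by (simp add: b c triangle'[symmetric] whisker_right)
  also have "\<dots> = (idn C ?e \<boxplus> (lunit b \<boxplus> idn C c)) \<cdot> ?r"
    using cmp_extend[OF assc_natural[of "idn C ?e" "lunit b" "idn C c"], of "assc C ?e ?e b \<boxplus> idn C c"]
    by (simp add: b c)
  finally show "idn C ?e \<boxplus> (lunit (b \<oplus> c) \<cdot> assc C ?e b c) = idn C ?e \<boxplus> (lunit b \<boxplus> idn C c)"
    by (rule iso_epi[OF iso]) (simp_all add: b c)
qed (simp_all add: b c)

text \<open>The exchange of the first two factors of a right-nested product; these exchanges are the adjacent
  transpositions from which the sorting isomorphisms below are built.\<close>

definition swap :: "'o \<Rightarrow> 'o \<Rightarrow> 'o \<Rightarrow> 'a" where
  "swap a b c = assc C b a c \<cdot> ((sym C a b \<boxplus> idn C c) \<cdot> iassc a b c)"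

lemma swap_arr [simp]: "\<lbrakk>a \<in> Ob C; b \<in> Ob C; c \<in> Ob C\<rbrakk> \<Longrightarrow> swap a b c \<in> Arr C"
  and swap_dom [simp]: "\<lbrakk>a \<in> Ob C; b \<in> Ob C; c \<in> Ob C\<rbrakk> \<Longrightarrow> Dom C (swap a b c) = a \<oplus> (b \<oplus> c)"
  and swap_cod [simp]: "\<lbrakk>a \<in> Ob C; b \<in> Ob C; c \<in> Ob C\<rbrakk> \<Longrightarrow> Cod C (swap a b c) = b \<oplus> (a \<oplus> c)"
  by (auto simp: swap_def)

lemma swap_assc: "\<lbrakk>a \<in> Ob C; b \<in> Ob C; c \<in> Ob C\<rbrakk> \<Longrightarrow>
    swap a b c \<cdot> assc C a b c = assc C b a c \<cdot> (sym C a b \<boxplus> idn C c)"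
  by (simp add: swap_def)

lemma swap_swap:
  assumes "a \<in> Ob C" "b \<in> Ob C" "c \<in> Ob C"
  shows "swap b a c \<cdot> swap a b c = idn C (a \<oplus> (b \<oplus> c))"
  using assms by (simp add: swap_def ten_cmp' sym_sym)

lemma swap_natural:
  assumes "f \<in> Arr C" "g \<in> Arr C" "h \<in> Arr C"
  shows "swap (Cod C f) (Cod C g) (Cod C h) \<cdot> (f \<boxplus> (g \<boxplus> h)) =
    (g \<boxplus> (f \<boxplus> h)) \<cdot> swap (Dom C f) (Dom C g) (Dom C h)"
proof -
  have "swap (Cod C f) (Cod C g) (Cod C h) \<cdot> (f \<boxplus> (g \<boxplus> h)) =
    assc C (Cod C g) (Cod C f) (Cod C h) \<cdot> ((sym C (Cod C f) (Cod C g) \<boxplus> idn C (Cod C h)) \<cdot>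
      (((f \<boxplus> g) \<boxplus> h) \<cdot> iassc (Dom C f) (Dom C g) (Dom C h)))"
    using assms by (simp add: swap_def iassc_natural)
  also have "\<dots> = assc C (Cod C g) (Cod C f) (Cod C h) \<cdot> (((g \<boxplus> f) \<boxplus> h) \<cdot>
     ((sym C (Dom C f) (Dom C g) \<boxplus> idn C (Dom C h)) \<cdot> iassc (Dom C f) (Dom C g) (Dom C h)))"
    using assms by (simp add: ten_cmp' sym_natural)
  also have "\<dots> = (g \<boxplus> (f \<boxplus> h)) \<cdot> swap (Dom C f) (Dom C g) (Dom C h)"
    unfolding swap_def using assms by (subst cmp_extend[OF assc_natural]) simp_all
  finally show ?thesis .
qed

lemma swap_unit:
  assumes "b \<in> Ob C" "c \<in> Ob C"
  shows "(idn C b \<boxplus> lunit c) \<cdot> swap (munit C) b c = lunit (b \<oplus> c)"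
proof -
  have "(idn C b \<boxplus> lunit c) \<cdot> swap (munit C) b c =
     (runit C b \<boxplus> idn C c) \<cdot> ((sym C (munit C) b \<boxplus> idn C c) \<cdot> iassc (munit C) b c)"
    unfolding swap_def using assms by (subst cmp_extend[OF triangle']) simp_all
  also have "\<dots> = (lunit b \<boxplus> idn C c) \<cdot> iassc (munit C) b c"
    using assms by (simp add: ten_cmp' lunit_def)
  also have "\<dots> = lunit (b \<oplus> c)"
    using assms by (simp add: lunit_ten[symmetric])
  finally show ?thesis .
qed

text \<open>Precomposing with two associators turns both sides into composites to which the pentagon applies;
  what remains is the hexagon, tensored with \<open>c\<close>.\<close>

lemma swap_ten_right:
  assumes "a \<in> Ob C" "b \<in> Ob C" "b' \<in> Ob C" "c \<in> Ob C"
  shows "assc C b b' (a \<oplus> c) \<cdot> swap a (b \<oplus> b') c =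
    (idn C b \<boxplus> swap a b' c) \<cdot> (swap a b (b' \<oplus> c) \<cdot> (idn C a \<boxplus> assc C b b' c))"
proof -
  let ?r = "assc C a (b \<oplus> b') c \<cdot> (assc C a b b' \<boxplus> idn C c)"
  let ?m = "assc C b (a \<oplus> b') c \<cdot> ((assc C b a b' \<boxplus> idn C c) \<cdot> ((sym C a b \<boxplus> idn C b') \<boxplus> idn C c))"
  have iso: "is_iso C ?r"
    by (intro is_iso_cmp assc_iso is_iso_ten is_iso_idn) (auto simp: assms)
  have "(assc C b b' (a \<oplus> c) \<cdot> swap a (b \<oplus> b') c) \<cdot> ?r =
      assc C b b' (a \<oplus> c) \<cdot> (assc C (b \<oplus> b') a c \<cdot> ((sym C a (b \<oplus> b') \<boxplus> idn C c) \<cdot> (assc C a b b' \<boxplus> idn C c)))"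
    using assms by (simp add: cmp_extend[OF swap_assc])
  also have "\<dots> = (idn C b \<boxplus> assc C b' a c) \<cdot> (assc C b (b' \<oplus> a) c \<cdot>
       ((assc C b b' a \<cdot> sym C a (b \<oplus> b') \<cdot> assc C a b b') \<boxplus> idn C c))"
    using assms by (subst cmp_extend[OF pentagon]) (simp_all add: whisker_right)
  also have "\<dots> = (idn C b \<boxplus> assc C b' a c) \<cdot> (assc C b (b' \<oplus> a) c \<cdot>
      (((idn C b \<boxplus> sym C a b') \<boxplus> idn C c) \<cdot> ((assc C b a b' \<boxplus> idn C c) \<cdot> ((sym C a b \<boxplus> idn C b') \<boxplus> idn C c))))"
    using assms by (subst hexagon) (simp_all add: whisker_right)
  also have "\<dots> = (idn C b \<boxplus> assc C b' a c) \<cdot> ((idn C b \<boxplus> (sym C a b' \<boxplus> idn C c)) \<cdot> ?m)"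
    using assms cmp_extend[OF assc_natural[of "idn C b" "sym C a b'" "idn C c"],
       of "(assc C b a b' \<boxplus> idn C c) \<cdot> ((sym C a b \<boxplus> idn C b') \<boxplus> idn C c)"] by simp
  finally have 1: "(assc C b b' (a \<oplus> c) \<cdot> swap a (b \<oplus> b') c) \<cdot> ?r = 
     (idn C b \<boxplus> (assc C b' a c \<cdot> (sym C a b' \<boxplus> idn C c))) \<cdot> ?m"
    using assms by (simp add: whisker_left)
  have "((idn C b \<boxplus> swap a b' c) \<cdot> (swap a b (b' \<oplus> c) \<cdot> (idn C a \<boxplus> assc C b b' c))) \<cdot> ?r =
     (idn C b \<boxplus> swap a b' c) \<cdot> (swap a b (b' \<oplus> c) \<cdot> ((idn C a \<boxplus> assc C b b' c) \<cdot> assc C a (b \<oplus> b') c \<cdot> (assc C a b b' \<boxplus> idn C c)))"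
    using assms by simp
  also have "\<dots> = (idn C b \<boxplus> swap a b' c) \<cdot> (assc C b a (b' \<oplus> c) \<cdot> ((sym C a b \<boxplus> idn C (b' \<oplus> c)) \<cdot> assc C (a \<oplus> b) b' c))"
    using assms by (subst pentagon[symmetric]) (simp_all add: cmp_extend[OF swap_assc])
  also have "\<dots> = (idn C b \<boxplus> swap a b' c) \<cdot> (assc C b a (b' \<oplus> c) \<cdot> (assc C (b \<oplus> a) b' c \<cdot> ((sym C a b \<boxplus> idn C b') \<boxplus> idn C c)))"
    using assms assc_natural[of "sym C a b" "idn C b'" "idn C c"] by simp
  also have "\<dots> = (idn C b \<boxplus> swap a b' c) \<cdot> ((idn C b \<boxplus> assc C a b' c) \<cdot> ?m)"
    using assms by (subst cmp_extend[OF pentagon]) simp_all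
  also have "\<dots> = (idn C b \<boxplus> (assc C b' a c \<cdot> (sym C a b' \<boxplus> idn C c))) \<cdot> ?m"
    using assms by (subst ten_cmp') (simp_all add: swap_assc)
  finally have "(assc C b b' (a \<oplus> c) \<cdot> swap a (b \<oplus> b') c) \<cdot> ?r =
     ((idn C b \<boxplus> swap a b' c) \<cdot> (swap a b (b' \<oplus> c) \<cdot> (idn C a \<boxplus> assc C b b' c))) \<cdot> ?r"
    using 1 by simp
  thus ?thesis by (rule iso_epi[OF iso]) (use assms in simp_all)
qed

lemma is_iso_swap: "\<lbrakk>a \<in> Ob C; b \<in> Ob C; c \<in> Ob C\<rbrakk> \<Longrightarrow> is_iso C (swap a b c)"
  unfolding is_iso_def inverses_def by (rule exI[of _ "swap b a c"]) (simp add: hom_def swap_swap)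

text \<open>\<open>swap a b c\<close> is inverse to \<open>swap b a c\<close>, so this is \<open>swap_ten_right\<close> with all arrows inverted.\<close>

lemma swap_ten_left:
  assumes "a \<in> Ob C" "a' \<in> Ob C" "b \<in> Ob C" "c \<in> Ob C"
  shows "(idn C b \<boxplus> assc C a a' c) \<cdot> swap (a \<oplus> a') b c =
    swap a b (a' \<oplus> c) \<cdot> ((idn C a \<boxplus> swap a' b c) \<cdot> assc C a a' (b \<oplus> c))"
proof (rule iso_mono[OF is_iso_swap[of b a "a' \<oplus> c"]])
  have "(idn C a \<boxplus> swap b a' c) \<cdot> (swap b a (a' \<oplus> c) \<cdot> ((idn C b \<boxplus> assc C a a' c) \<cdot> swap (a \<oplus> a') b c)) =
      ((idn C a \<boxplus> swap b a' c) \<cdot> (swap b a (a' \<oplus> c) \<cdot> (idn C b \<boxplus> assc C a a' c))) \<cdot> swap (a \<oplus> a') b c"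
    using assms by simp
  also have "\<dots> = (assc C a a' (b \<oplus> c) \<cdot> swap b (a \<oplus> a') c) \<cdot> swap (a \<oplus> a') b c"
    using assms by (subst swap_ten_right[symmetric]) simp_all
  also have "\<dots> = (idn C a \<boxplus> swap b a' c) \<cdot> ((idn C a \<boxplus> swap a' b c) \<cdot> assc C a a' (b \<oplus> c))"
    using assms by (simp add: swap_swap ten_cmp')
  finally have "swap b a (a' \<oplus> c) \<cdot> ((idn C b \<boxplus> assc C a a' c) \<cdot> swap (a \<oplus> a') b c) =
     (idn C a \<boxplus> swap a' b c) \<cdot> assc C a a' (b \<oplus> c)"
    by (rule iso_mono[rotated]) (use assms in \<open>simp_all add: is_iso_ten is_iso_idn is_iso_swap\<close>)
  thus "swap b a (a' \<oplus> c) \<cdot> ((idn C b \<boxplus> assc C a a' c) \<cdot> swap (a \<oplus> a') b c) =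
    swap b a (a' \<oplus> c) \<cdot> (swap a b (a' \<oplus> c) \<cdot> ((idn C a \<boxplus> swap a' b c) \<cdot> assc C a a' (b \<oplus> c)))"
    using assms by (simp add: cmp_extend[OF swap_swap])
qed (use assms in simp_all)

text \<open>By \<open>swap_ten_left\<close>, moving \<open>d\<close> past \<open>a\<close> and \<open>b\<close> one after the other is moving it past \<open>a \<oplus> b\<close>, and this
  is natural with respect to the symmetry of \<open>a\<close> and \<open>b\<close>.\<close>

lemma yang_baxter:
  assumes "a \<in> Ob C" "b \<in> Ob C" "d \<in> Ob C" "c \<in> Ob C"
  shows "(idn C d \<boxplus> swap a b c) \<cdot> (swap a d (b \<oplus> c) \<cdot> (idn C a \<boxplus> swap b d c)) =
    swap b d (a \<oplus> c) \<cdot> ((idn C b \<boxplus> swap a d c) \<cdot> swap a b (d \<oplus> c))"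
proof -
  have "(idn C d \<boxplus> swap a b c) \<cdot> (swap a d (b \<oplus> c) \<cdot> (idn C a \<boxplus> swap b d c)) =
     (idn C d \<boxplus> swap a b c) \<cdot> ((swap a d (b \<oplus> c) \<cdot> ((idn C a \<boxplus> swap b d c) \<cdot> assc C a b (d \<oplus> c))) \<cdot> iassc a b (d \<oplus> c))"
    using assms by simp
  also have "\<dots> = (idn C d \<boxplus> swap a b c) \<cdot> ((idn C d \<boxplus> assc C a b c) \<cdot> (swap (a \<oplus> b) d c \<cdot> iassc a b (d \<oplus> c)))"
    using assms by (subst swap_ten_left[symmetric]) simp_all
  also have "\<dots> = (idn C d \<boxplus> assc C b a c) \<cdot> ((idn C d \<boxplus> (sym C a b \<boxplus> idn C c)) \<cdot> (swap (a \<oplus> b) d c \<cdot> iassc a b (d \<oplus> c)))"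
    using assms by (simp add: ten_cmp' swap_assc)
  also have "\<dots> = (idn C d \<boxplus> assc C b a c) \<cdot> (swap (b \<oplus> a) d c \<cdot> ((sym C a b \<boxplus> idn C (d \<oplus> c)) \<cdot> iassc a b (d \<oplus> c)))"
    using assms cmp_extend[OF swap_natural[of "sym C a b" "idn C d" "idn C c", symmetric], of "iassc a b (d \<oplus> c)"] by simp
  also have "\<dots> = swap b d (a \<oplus> c) \<cdot> ((idn C b \<boxplus> swap a d c) \<cdot> swap a b (d \<oplus> c))"
    using assms by (simp add: cmp_extend[OF swap_ten_left] swap_def[of a b "d \<oplus> c"])
  finally show ?thesis .
qed

end

section \<open>Coherence\<close>

text \<open>Structure isomorphisms permute the variables of a word but never create, copy or delete one.\<close>

lemma canonical_mset: "canonical C xs u v f \<Longrightarrow> mset (wvars u) = mset (wvars v)"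
  by (induction rule: canonical.induct) auto

lemma mset_set_distinct:
  assumes "mset a = mset b"
  shows "set a = set b" "distinct a = distinct b"
  using assms mset_eq_setD mset_eq_imp_distinct_iff by blast+

text \<open>Right-nested words serve as normal forms: every word with distinct variables is canonically isomorphic
  to the nested word on its sorted variables.\<close>

primrec nested :: "nat list \<Rightarrow> word" where
  "nested [] = WE"
| "nested (i # l) = WTen (WVar i) (nested l)"

primrec merge :: "word \<Rightarrow> nat list \<Rightarrow> nat list" where
  "merge WE l = l"
| "merge (WVar i) l = insort i l"
| "merge (WTen u v) l = merge u (merge v l)"

lemma wvars_nested [simp]: "wvars (nested l) = l"
  by (induction l) auto

lemma mset_merge: "mset (merge w l) = mset (wvars w) + mset l"
  by (induction w arbitrary: l) auto

lemma set_merge [simp]: "set (merge w l) = set (wvars w) \<union> set l"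
  by (metis mset_merge set_mset_mset set_mset_union)

lemma sorted_merge: "sorted l \<Longrightarrow> sorted (merge w l)"
  by (induction w arbitrary: l) (auto simp: sorted_insort)

lemma merge_insort: "merge w (insort i l) = insort i (merge w l)"
  by (induction w arbitrary: l) (auto simp: insort_left_comm)

lemma merge_merge: "merge u (merge v l) = merge v (merge u l)"
  by (induction u arbitrary: l) (auto simp: merge_insort)

locale smc_tuple = symmetric_monoidal_category +
  fixes xs :: "'a list"
  assumes xs_Ob: "set xs \<subseteq> Ob C"
begin

abbreviation ob :: "word \<Rightarrow> 'a" where
  "ob w \<equiv> evO C w xs"

abbreviation nob :: "nat list \<Rightarrow> 'a" where
  "nob l \<equiv> ob (nested l)"

abbreviation in_range :: "nat list \<Rightarrow> bool" where
  "in_range l \<equiv> set l \<subseteq> {..<length xs}"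

lemma nth_Ob [simp]: "i < length xs \<Longrightarrow> xs ! i \<in> Ob C"
  using xs_Ob by auto

lemma ob_Ob [simp]: "in_range (wvars w) \<Longrightarrow> ob w \<in> Ob C"
  by (induction w) auto

text \<open>The arrow that realizes \<open>insort\<close>: the new head is exchanged with the next factor until the
  next variable is not smaller.\<close>

primrec ins :: "nat \<Rightarrow> nat list \<Rightarrow> 'b" where
  "ins i [] = idn C (nob [i])"
| "ins i (j # l) =
     (if i \<le> j then idn C (nob (i # j # l))
      else (idn C (xs ! j) \<boxplus> ins i l) \<cdot> swap (xs ! i) (xs ! j) (nob l))"

text \<open>The arrow that realizes \<open>merge\<close>.  A word acts through its variables, the unit acts trivially up to the
  left unit isomorphism, and a product acts by its factors in succession.\<close>

primrec absorb :: "word \<Rightarrow> nat list \<Rightarrow> 'b" where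
  "absorb WE l = lunit (nob l)"
| "absorb (WVar i) l = ins i l"
| "absorb (WTen u v) l =
     absorb u (merge v l) \<cdot> ((idn C (ob u) \<boxplus> absorb v l) \<cdot> assc C (ob u) (ob v) (nob l))"

lemma ins_hom:
  "\<lbrakk>i < length xs; in_range l\<rbrakk> \<Longrightarrow>
    ins i l \<in> Arr C \<and> Dom C (ins i l) = xs ! i \<oplus> nob l \<and> Cod C (ins i l) = nob (insort i l)"
  by (induction l) auto

lemma absorb_hom:
  "\<lbrakk>in_range (wvars w); in_range l\<rbrakk> \<Longrightarrow>
    absorb w l \<in> Arr C \<and> Dom C (absorb w l) = ob w \<oplus> nob l \<and> Cod C (absorb w l) = nob (merge w l)"
proof (induction w arbitrary: l)
  case (WVar i)
  then show ?case using ins_hom[of i l] by simp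
qed auto

lemma absorb_simps [simp]:
  assumes "in_range (wvars w)" "in_range l"
  shows "absorb w l \<in> Arr C" "Dom C (absorb w l) = ob w \<oplus> nob l" "Cod C (absorb w l) = nob (merge w l)"
  using absorb_hom[OF assms] by auto

lemma ins_simps [simp]:
  assumes "i < length xs" "in_range l"
  shows "ins i l \<in> Arr C" "Dom C (ins i l) = xs ! i \<oplus> nob l" "Cod C (ins i l) = nob (insort i l)"
  using ins_hom[OF assms] by auto

lemma is_iso_ins: "\<lbrakk>i < length xs; in_range l\<rbrakk> \<Longrightarrow> is_iso C (ins i l)"
  by (induction l) (auto intro!: is_iso_cmp is_iso_ten is_iso_swap is_iso_idn)

lemma is_iso_absorb: "\<lbrakk>in_range (wvars w); in_range l\<rbrakk> \<Longrightarrow> is_iso C (absorb w l)"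
  by (induction w arbitrary: l)
    (auto intro!: is_iso_cmp is_iso_ten is_iso_lunit is_iso_idn assc_iso is_iso_ins)

lemma canonical_swap:
  assumes "in_range (wvars u)" "in_range (wvars v)" "in_range (wvars w)"
  shows "canonical C xs (WTen u (WTen v w)) (WTen v (WTen u w)) (swap (ob u) (ob v) (ob w))"
proof -
  have "canonical C xs (WTen u (WTen v w)) (WTen (WTen u v) w) (iassc (ob u) (ob v) (ob w))"
    by (rule can_inv[OF can_assc inverses_assc]) (use assms in auto)
  thus ?thesis
    unfolding swap_def by (rule can_comp[OF can_comp[OF _ can_ten[OF can_sym can_id]] can_assc])
qed

lemma canonical_ins:
  "\<lbrakk>i < length xs; in_range l\<rbrakk> \<Longrightarrow> canonical C xs (WTen (WVar i) (nested l)) (nested (insort i l)) (ins i l)"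
proof (induction l)
  case Nil
  show ?case using can_id[of C xs "nested [i]"] by simp
next
  case (Cons j l)
  have 1: "canonical C xs (WTen (WVar j) (WTen (WVar i) (nested l))) (WTen (WVar j) (nested (insort i l)))
      (idn C (xs ! j) \<boxplus> ins i l)"
    using can_ten[OF can_id[of C xs "WVar j"] Cons.IH] Cons.prems by simp
  have 2: "canonical C xs (WTen (WVar i) (WTen (WVar j) (nested l))) (WTen (WVar j) (WTen (WVar i) (nested l)))
      (swap (xs ! i) (xs ! j) (nob l))"
    using canonical_swap[of "WVar i" "WVar j" "nested l"] Cons.prems by simp
  show ?case using can_comp[OF 2 1] can_id[of C xs "nested (i # j # l)"] by auto
qed

lemma canonical_absorb:
  "\<lbrakk>in_range (wvars w); in_range l\<rbrakk> \<Longrightarrow> canonical C xs (WTen w (nested l)) (nested (merge w l)) (absorb w l)"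
proof (induction w arbitrary: l)
  case WE
  show ?case using can_comp[OF can_sym[of C xs WE "nested l"] can_runit[of C xs "nested l"]]
    by (simp add: lunit_def)
next
  case (WVar i)
  then show ?case using canonical_ins by simp
next
  case (WTen u v)
  show ?case using WTen.prems
    by (auto intro!: can_comp[OF can_comp[OF can_assc can_ten[OF can_id]]] WTen.IH)
qed

text \<open>As long as the head \<open>k\<close> of the list is smaller than both variables, both insertions exchange their
  variable with \<open>k\<close> first, and the Yang-Baxter equation passes from the list to its tail.  Otherwise \<open>i\<close>
  stays in front and the two exchanges of \<open>i\<close> and \<open>j\<close> cancel.\<close>

lemma ins_commute:
  "\<lbrakk>i < j; i < length xs; j < length xs; in_range l\<rbrakk> \<Longrightarrow>
    ins i (insort j l) \<cdot> (idn C (xs ! i) \<boxplus> ins j l) =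
    ins j (insort i l) \<cdot> ((idn C (xs ! j) \<boxplus> ins i l) \<cdot> swap (xs ! i) (xs ! j) (nob l))"
proof (induction l)
  case Nil
  then show ?case by (simp add: swap_swap)
next
  case (Cons k m)
  show ?case
  proof (cases "i \<le> k")
    case True
    then show ?thesis using Cons.prems by (simp add: swap_swap)
  next
    case False
    let ?i = "xs ! i" and ?j = "xs ! j" and ?k = "xs ! k"
    have IH: "ins i (insort j m) \<cdot> (idn C ?i \<boxplus> ins j m) =
        ins j (insort i m) \<cdot> ((idn C ?j \<boxplus> ins i m) \<cdot> swap ?i ?j (nob m))"
      using Cons by simp
    have r: "i < length xs" "j < length xs" "k < length xs" "in_range m" "in_range (insort j m)" "in_range (insort i m)"
      using Cons.prems by (auto simp: set_insort_key)
    have "ins i (insort j (k # m)) \<cdot> (idn C ?i \<boxplus> ins j (k # m)) =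
       (idn C ?k \<boxplus> ins i (insort j m)) \<cdot> (swap ?i ?k (nob (insort j m)) \<cdot>
          ((idn C ?i \<boxplus> (idn C ?k \<boxplus> ins j m)) \<cdot> (idn C ?i \<boxplus> swap ?j ?k (nob m))))"
      using False Cons.prems r by (simp add: whisker_left)
    also have "\<dots> = (idn C ?k \<boxplus> ins i (insort j m)) \<cdot> ((idn C ?k \<boxplus> (idn C ?i \<boxplus> ins j m)) \<cdot>
        (swap ?i ?k (?j \<oplus> nob m) \<cdot> (idn C ?i \<boxplus> swap ?j ?k (nob m))))"
      using r cmp_extend[OF swap_natural[of "idn C ?i" "idn C ?k" "ins j m"], of "idn C ?i \<boxplus> swap ?j ?k (nob m)"]
      by simp
    also have "\<dots> = (idn C ?k \<boxplus> ins j (insort i m)) \<cdot> ((idn C ?k \<boxplus> (idn C ?j \<boxplus> ins i m)) \<cdot>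
        ((idn C ?k \<boxplus> swap ?i ?j (nob m)) \<cdot>
        (swap ?i ?k (?j \<oplus> nob m) \<cdot> (idn C ?i \<boxplus> swap ?j ?k (nob m)))))"
      using r by (simp add: ten_cmp' IH)
    \<comment> \<open>The Yang-Baxter equation exchanges \<open>i\<close>, \<open>j\<close> and \<open>k\<close> in the opposite order.\<close>
    also have "\<dots> = (idn C ?k \<boxplus> ins j (insort i m)) \<cdot> (((idn C ?k \<boxplus> (idn C ?j \<boxplus> ins i m)) \<cdot>
        swap ?j ?k (?i \<oplus> nob m)) \<cdot> ((idn C ?j \<boxplus> swap ?i ?k (nob m)) \<cdot> swap ?i ?j (?k \<oplus> nob m)))"
      using r by (subst yang_baxter) simp_all
    also have "\<dots> = (idn C ?k \<boxplus> ins j (insort i m)) \<cdot> ((swap ?j ?k (nob (insort i m)) \<cdot>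
        (idn C ?j \<boxplus> (idn C ?k \<boxplus> ins i m))) \<cdot> ((idn C ?j \<boxplus> swap ?i ?k (nob m)) \<cdot> swap ?i ?j (?k \<oplus> nob m)))"
      using r swap_natural[of "idn C ?j" "idn C ?k" "ins i m"] by simp
    also have "\<dots> = ins j (insort i (k # m)) \<cdot> ((idn C ?j \<boxplus> ins i (k # m)) \<cdot> swap ?i ?j (nob (k # m)))"
      using False Cons.prems r by (simp add: whisker_left)
    finally show ?thesis .
  qed
qed

text \<open>The actions of \<open>u\<close> and \<open>v\<close> on \<open>l\<close> commute, up to the exchange of \<open>u\<close> and \<open>v\<close>.\<close>

definition commute :: "word \<Rightarrow> word \<Rightarrow> nat list \<Rightarrow> bool" where
  "commute u v l \<longleftrightarrow>
     absorb u (merge v l) \<cdot> (idn C (ob u) \<boxplus> absorb v l) =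
     absorb v (merge u l) \<cdot> ((idn C (ob v) \<boxplus> absorb u l) \<cdot> swap (ob u) (ob v) (nob l))"

lemma commute_sym:
  assumes "commute u v l" "in_range (wvars u)" "in_range (wvars v)" "in_range l"
  shows "commute v u l"
proof -
  have "absorb u (merge v l) \<cdot> ((idn C (ob u) \<boxplus> absorb v l) \<cdot> swap (ob v) (ob u) (nob l)) =
    (absorb v (merge u l) \<cdot> ((idn C (ob v) \<boxplus> absorb u l) \<cdot> swap (ob u) (ob v) (nob l))) \<cdot> swap (ob v) (ob u) (nob l)"
    by (rule cmp_extend[OF assms(1)[unfolded commute_def]]) (use assms in auto)
  also have "\<dots> = absorb v (merge u l) \<cdot> (idn C (ob v) \<boxplus> absorb u l)"
    using assms by (simp add: swap_swap)
  finally show ?thesis unfolding commute_def by simp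
qed

text \<open>Commutation with \<open>v\<close> passes from the variables of \<open>u\<close> to \<open>u\<close>: the unit is \<open>swap_unit\<close>, and a product
  can be exchanged with \<open>v\<close> factor by factor by \<open>swap_ten_left\<close>.\<close>

lemma commute_word:
  assumes "\<And>i l. \<lbrakk>i \<in> set (wvars u); in_range l\<rbrakk> \<Longrightarrow> commute (WVar i) v l"
    and "in_range (wvars u)" "in_range (wvars v)" "in_range l"
  shows "commute u v l"
  using assms
proof (induction u arbitrary: l)
  case WE
  have "lunit (nob (merge v l)) \<cdot> (idn C (munit C) \<boxplus> absorb v l) = absorb v l \<cdot> lunit (ob v \<oplus> nob l)"
    using lunit_natural[of "absorb v l"] WE by simp
  also have "\<dots> = absorb v l \<cdot> ((idn C (ob v) \<boxplus> lunit (nob l)) \<cdot> swap (munit C) (ob v) (nob l))"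
    using WE by (subst swap_unit) auto
  finally show ?case by (simp add: commute_def)
next
  case (WVar i)
  then show ?case by simp
next
  case (WTen u u')
  let ?u = "ob u" and ?u' = "ob u'" and ?v = "ob v" and ?l = "nob l"
  have r: "in_range (wvars u)" "in_range (wvars u')" "in_range (wvars v)" "in_range l" using WTen.prems by auto
  have 1: "absorb u (merge v (merge u' l)) \<cdot> (idn C ?u \<boxplus> absorb v (merge u' l)) =
     absorb v (merge u (merge u' l)) \<cdot> ((idn C ?v \<boxplus> absorb u (merge u' l)) \<cdot> swap ?u ?v (nob (merge u' l)))"
    using WTen.IH(1)[of "merge u' l"] WTen.prems by (auto simp: commute_def)
  have 2: "absorb u' (merge v l) \<cdot> (idn C ?u' \<boxplus> absorb v l) =
     absorb v (merge u' l) \<cdot> ((idn C ?v \<boxplus> absorb u' l) \<cdot> swap ?u' ?v ?l)"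
    using WTen.IH(2)[of l] WTen.prems by (auto simp: commute_def)
  have "absorb (WTen u u') (merge v l) \<cdot> (idn C (ob (WTen u u')) \<boxplus> absorb v l) =
    absorb u (merge u' (merge v l)) \<cdot> ((idn C ?u \<boxplus> absorb u' (merge v l)) \<cdot>
      (assc C ?u ?u' (nob (merge v l)) \<cdot> ((idn C ?u \<boxplus> idn C ?u') \<boxplus> absorb v l)))"
    using r by simp
  also have "\<dots> = absorb u (merge u' (merge v l)) \<cdot> ((idn C ?u \<boxplus> absorb u' (merge v l)) \<cdot>
      ((idn C ?u \<boxplus> (idn C ?u' \<boxplus> absorb v l)) \<cdot> assc C ?u ?u' (?v \<oplus> ?l)))"
    using r assc_natural[of "idn C ?u" "idn C ?u'" "absorb v l"] by simp
  also have "\<dots> = absorb u (merge v (merge u' l)) \<cdot>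
      ((idn C ?u \<boxplus> (absorb u' (merge v l) \<cdot> (idn C ?u' \<boxplus> absorb v l))) \<cdot> assc C ?u ?u' (?v \<oplus> ?l))"
    using r by (simp add: whisker_left merge_merge)
  also have "\<dots> = absorb u (merge v (merge u' l)) \<cdot> ((idn C ?u \<boxplus> absorb v (merge u' l)) \<cdot>
     ((idn C ?u \<boxplus> (idn C ?v \<boxplus> absorb u' l)) \<cdot> ((idn C ?u \<boxplus> swap ?u' ?v ?l) \<cdot> assc C ?u ?u' (?v \<oplus> ?l))))"
    using r by (simp add: 2 whisker_left)
  also have "\<dots> = absorb v (merge u (merge u' l)) \<cdot> ((idn C ?v \<boxplus> absorb u (merge u' l)) \<cdot>
     ((swap ?u ?v (nob (merge u' l)) \<cdot> (idn C ?u \<boxplus> (idn C ?v \<boxplus> absorb u' l))) \<cdot>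
       ((idn C ?u \<boxplus> swap ?u' ?v ?l) \<cdot> assc C ?u ?u' (?v \<oplus> ?l))))"
    using r by (subst cmp_extend[OF 1]) (simp_all add: merge_merge)
  also have "\<dots> = absorb v (merge u (merge u' l)) \<cdot> ((idn C ?v \<boxplus> absorb u (merge u' l)) \<cdot>
     (((idn C ?v \<boxplus> (idn C ?u \<boxplus> absorb u' l)) \<cdot> swap ?u ?v (?u' \<oplus> ?l)) \<cdot>
       ((idn C ?u \<boxplus> swap ?u' ?v ?l) \<cdot> assc C ?u ?u' (?v \<oplus> ?l))))"
    using r swap_natural[of "idn C ?u" "idn C ?v" "absorb u' l"] by simp
  also have "\<dots> = absorb v (merge u (merge u' l)) \<cdot> ((idn C ?v \<boxplus> absorb u (merge u' l)) \<cdot>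
     ((idn C ?v \<boxplus> (idn C ?u \<boxplus> absorb u' l)) \<cdot>
      (swap ?u ?v (?u' \<oplus> ?l) \<cdot> ((idn C ?u \<boxplus> swap ?u' ?v ?l) \<cdot> assc C ?u ?u' (?v \<oplus> ?l)))))"
    using r by simp
  also have "\<dots> = absorb v (merge u (merge u' l)) \<cdot> ((idn C ?v \<boxplus> absorb u (merge u' l)) \<cdot>
     ((idn C ?v \<boxplus> (idn C ?u \<boxplus> absorb u' l)) \<cdot>
      ((idn C ?v \<boxplus> assc C ?u ?u' ?l) \<cdot> swap (?u \<oplus> ?u') ?v ?l)))"
    using r by (subst swap_ten_left[symmetric]) simp_all
  also have "\<dots> = absorb v (merge (WTen u u') l) \<cdot> ((idn C ?v \<boxplus> absorb (WTen u u') l) \<cdot> swap (?u \<oplus> ?u') ?v ?l)"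
    using r by (simp add: whisker_left)
  finally show ?case by (simp add: commute_def)
qed

text \<open>\<open>commute\<close> is symmetric in its two words, so \<open>commute_word\<close> can be applied on both sides, which leaves
  two different variables.\<close>

lemma commute_disjoint:
  assumes "set (wvars u) \<inter> set (wvars v) = {}" "in_range (wvars u)" "in_range (wvars v)" "in_range l"
  shows "commute u v l"
proof (rule commute_word[OF _ assms(2-4)])
  fix i l assume i: "i \<in> set (wvars u)" and l: "in_range l"
  have iv: "i < length xs" "i \<notin> set (wvars v)" using i assms by auto
  have "commute v (WVar i) l"
  proof (rule commute_word)
    fix j m assume j: "j \<in> set (wvars v)" and m: "in_range m"
    have j': "j < length xs" "j \<noteq> i" using j assms iv by auto
    show "commute (WVar j) (WVar i) m"
    proof (cases "i < j")
      case True
      hence "commute (WVar i) (WVar j) m"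
        using ins_commute[of i j m] iv j' m by (simp add: commute_def)
      thus ?thesis by (rule commute_sym) (use iv j' m in auto)
    next
      case False
      thus ?thesis using ins_commute[of j i m] iv j' m by (simp add: commute_def)
    qed
  qed (use iv assms l in auto)
  thus "commute (WVar i) v l" by (rule commute_sym) (use iv assms l in auto)
qed

lemma canonical_arr:
  "\<lbrakk>canonical C xs u v f; in_range (wvars u)\<rbrakk> \<Longrightarrow> f \<in> Arr C \<and> Dom C f = ob u \<and> Cod C f = ob v"
proof (induction rule: canonical.induct)
  case (can_comp u v f w g)
  then show ?case using mset_set_distinct(1)[OF canonical_mset[OF can_comp.hyps(1)]] by auto
next
  case (can_inv u v f g)
  then show ?case using mset_set_distinct(1)[OF canonical_mset[OF can_inv.hyps(1)]]
    by (auto simp: inverses_def hom_def)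
qed auto

text \<open>The invariant behind coherence: a canonical arrow does not change the action of a word.  The identity
  is stable under composition, inversion and tensor products, so it need only be checked for the
  generators; distinctness of the variables is what makes the two actions in the symmetry case
  commute.\<close>

lemma canonical_absorb_merge:
  "\<lbrakk>canonical C xs u v f; in_range (wvars u); distinct (wvars u); in_range l\<rbrakk> \<Longrightarrow>
    merge u l = merge v l \<and> absorb v l \<cdot> (f \<boxplus> idn C (nob l)) = absorb u l"
proof (induction arbitrary: l rule: canonical.induct)
  case (can_id w)
  then show ?case by simp
next
  case (can_comp u v f w g)
  note m = mset_set_distinct[OF canonical_mset[OF can_comp.hyps(1)]]
  have 1: "merge u l = merge v l" "absorb v l \<cdot> (f \<boxplus> idn C (nob l)) = absorb u l"
    "merge v l = merge w l" "absorb w l \<cdot> (g \<boxplus> idn C (nob l)) = absorb v l"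
    using can_comp m by auto
  have r: "in_range (wvars v)" "in_range (wvars w)"
    using m mset_set_distinct[OF canonical_mset[OF can_comp.hyps(2)]] can_comp.prems by auto
  have a: "f \<in> Arr C" "Dom C f = ob u" "Cod C f = ob v" "g \<in> Arr C" "Dom C g = ob v" "Cod C g = ob w"
    using canonical_arr[OF can_comp.hyps(1)] canonical_arr[OF can_comp.hyps(2)] r can_comp.prems by auto
  have "absorb w l \<cdot> ((g \<cdot> f) \<boxplus> idn C (nob l)) = absorb w l \<cdot> ((g \<boxplus> idn C (nob l)) \<cdot> (f \<boxplus> idn C (nob l)))"
    using r a can_comp.prems by (simp add: whisker_right)
  also have "\<dots> = absorb v l \<cdot> (f \<boxplus> idn C (nob l))"
    by (rule cmp_extend[OF 1(4)]) (use r a can_comp.prems in auto)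
  finally show ?case using 1 by simp
next
  case (can_inv u v f g)
  note m = mset_set_distinct[OF canonical_mset[OF can_inv.hyps(1)]]
  have r: "in_range (wvars u)" "in_range (wvars v)" "in_range l" "distinct (wvars u)" using m can_inv.prems by auto
  have 1: "merge u l = merge v l" "absorb v l \<cdot> (f \<boxplus> idn C (nob l)) = absorb u l"
    using can_inv r by auto
  have a: "f \<in> Arr C" "Dom C f = ob u" "Cod C f = ob v" "g \<in> Arr C" "Dom C g = ob v" "Cod C g = ob u"
      "f \<cdot> g = idn C (ob v)"
    using canonical_arr[OF can_inv.hyps(1)] can_inv.hyps(2) r by (auto simp: inverses_def hom_def)
  have "absorb u l \<cdot> (g \<boxplus> idn C (nob l)) = absorb v l \<cdot> ((f \<boxplus> idn C (nob l)) \<cdot> (g \<boxplus> idn C (nob l)))"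
    by (rule cmp_extend[OF 1(2), symmetric]) (use r a in auto)
  also have "\<dots> = absorb v l" using r a by (simp add: ten_cmp)
  finally show ?case using 1 by simp
next
  case (can_ten u u' f v v' g)
  note m = mset_set_distinct[OF canonical_mset[OF can_ten.hyps(1)]]
    mset_set_distinct[OF canonical_mset[OF can_ten.hyps(2)]]
  have r: "in_range (wvars u)" "in_range (wvars v)" "in_range (wvars u')" "in_range (wvars v')" "in_range l"
      "distinct (wvars u)" "distinct (wvars v)"
    using m can_ten.prems by auto
  have a: "f \<in> Arr C" "Dom C f = ob u" "Cod C f = ob u'" "g \<in> Arr C" "Dom C g = ob v" "Cod C g = ob v'"
    using canonical_arr[OF can_ten.hyps(1)] canonical_arr[OF can_ten.hyps(2)] r by auto
  have 1: "merge v l = merge v' l" "absorb v' l \<cdot> (g \<boxplus> idn C (nob l)) = absorb v l"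
    using can_ten.IH(2)[of l] r by auto
  have 2: "merge u (merge v l) = merge u' (merge v l)"
     "absorb u' (merge v l) \<cdot> (f \<boxplus> idn C (nob (merge v l))) = absorb u (merge v l)"
    using can_ten.IH(1)[of "merge v l"] r by auto
  have "absorb (WTen u' v') l \<cdot> ((f \<boxplus> g) \<boxplus> idn C (nob l)) =
    absorb u' (merge v l) \<cdot> ((idn C (ob u') \<boxplus> absorb v' l) \<cdot> (assc C (ob u') (ob v') (nob l) \<cdot> ((f \<boxplus> g) \<boxplus> idn C (nob l))))"
    using r a 1 by simp
  also have "\<dots> = absorb u' (merge v l) \<cdot> ((idn C (ob u') \<boxplus> absorb v' l) \<cdot>
      ((f \<boxplus> (g \<boxplus> idn C (nob l))) \<cdot> assc C (ob u) (ob v) (nob l)))"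
    using r a assc_natural[of f g "idn C (nob l)"] by simp
  also have "\<dots> = absorb u' (merge v l) \<cdot> ((f \<boxplus> idn C (nob (merge v l))) \<cdot>
      ((idn C (ob u) \<boxplus> absorb v l) \<cdot> assc C (ob u) (ob v) (nob l)))"
    using r a 1(1) by (simp add: ten_cmp' 1(2))
  also have "\<dots> = absorb (WTen u v) l"
    using r a by (subst cmp_extend[OF 2(2)]) simp_all
  finally show ?case using 1(1) 2(1) by simp
next
  case (can_assc u v w)
  have r: "in_range (wvars u)" "in_range (wvars v)" "in_range (wvars w)" "in_range l" using can_assc by auto
  let ?u = "ob u" and ?v = "ob v" and ?w = "ob w" and ?l = "nob l"
  let ?vw = "idn C ?u \<boxplus> (idn C ?v \<boxplus> absorb w l)"
  have "absorb (WTen u (WTen v w)) l \<cdot> (assc C ?u ?v ?w \<boxplus> idn C ?l) =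
    absorb u (merge v (merge w l)) \<cdot> ((idn C ?u \<boxplus> absorb v (merge w l)) \<cdot> (?vw \<cdot>
     ((idn C ?u \<boxplus> assc C ?v ?w ?l) \<cdot> assc C ?u (?v \<oplus> ?w) ?l \<cdot> (assc C ?u ?v ?w \<boxplus> idn C ?l))))"
    using r by (simp add: whisker_left)
  also have "\<dots> = absorb u (merge v (merge w l)) \<cdot> ((idn C ?u \<boxplus> absorb v (merge w l)) \<cdot> (?vw \<cdot>
     (assc C ?u ?v (?w \<oplus> ?l) \<cdot> assc C (?u \<oplus> ?v) ?w ?l)))"
    using r by (subst pentagon) simp_all
  also have "\<dots> = absorb u (merge v (merge w l)) \<cdot> ((idn C ?u \<boxplus> absorb v (merge w l)) \<cdot>
     ((assc C ?u ?v (nob (merge w l)) \<cdot> ((idn C ?u \<boxplus> idn C ?v) \<boxplus> absorb w l)) \<cdot> assc C (?u \<oplus> ?v) ?w ?l))"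
    using r assc_natural[of "idn C ?u" "idn C ?v" "absorb w l"]
      cmp_assoc'[of "assc C (?u \<oplus> ?v) ?w ?l" "assc C ?u ?v (?w \<oplus> ?l)" ?vw] by simp
  also have "\<dots> = absorb (WTen (WTen u v) w) l" using r by simp
  finally show ?case by simp
next
  case (can_runit u)
  then show ?case using triangle'[of "ob u" "nob l"] by simp
next
  case (can_sym u v)
  have r: "in_range (wvars u)" "in_range (wvars v)" "in_range l" "set (wvars v) \<inter> set (wvars u) = {}"
    using can_sym by auto
  let ?u = "ob u" and ?v = "ob v" and ?l = "nob l"
  have c: "absorb u (merge v l) \<cdot> (idn C ?u \<boxplus> absorb v l) =
     absorb v (merge u l) \<cdot> ((idn C ?v \<boxplus> absorb u l) \<cdot> swap ?u ?v ?l)"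
    using commute_disjoint[of u v l] r by (auto simp: commute_def)
  have "absorb (WTen u v) l = (absorb v (merge u l) \<cdot> ((idn C ?v \<boxplus> absorb u l) \<cdot> swap ?u ?v ?l)) \<cdot> assc C ?u ?v ?l"
    using r cmp_extend[OF c, of "assc C ?u ?v ?l"] by simp
  also have "\<dots> = absorb (WTen v u) l \<cdot> (sym C ?u ?v \<boxplus> idn C ?l)"
    using r by (simp add: swap_assc)
  finally show ?case by (simp add: merge_merge)
qed

theorem coherence:
  assumes "canonical C xs u v f" "canonical C xs u v g" "in_range (wvars u)" "distinct (wvars u)"
  shows "f = g"
proof -
  have r: "in_range (wvars v)" using mset_set_distinct[OF canonical_mset[OF assms(1)]] assms(3) by simp
  have a: "f \<in> Arr C" "Dom C f = ob u" "Cod C f = ob v" "g \<in> Arr C" "Dom C g = ob u" "Cod C g = ob v"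
    using canonical_arr[OF assms(1)] canonical_arr[OF assms(2)] assms(3) by auto
  have "absorb v [] \<cdot> (f \<boxplus> idn C (munit C)) = absorb v [] \<cdot> (g \<boxplus> idn C (munit C))"
    using canonical_absorb_merge[OF assms(1,3,4), of "[]"] canonical_absorb_merge[OF assms(2,3,4), of "[]"] by simp
  hence "f \<boxplus> idn C (munit C) = g \<boxplus> idn C (munit C)"
    by (rule iso_mono[OF is_iso_absorb[OF r, of "[]"], rotated]) (use r a in auto)
  hence "f \<cdot> runit C (ob u) = g \<cdot> runit C (ob u)"
    using runit_nat[of f "ob u" "ob v"] runit_nat[of g "ob u" "ob v"] a by (simp add: hom_def)
  thus ?thesis
    by (rule iso_epi[OF runit_iso, rotated]) (use assms(3) a in auto)
qed

lemma is_iso_canonical: "\<lbrakk>canonical C xs u v f; in_range (wvars u)\<rbrakk> \<Longrightarrow> is_iso C f"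
proof (induction rule: canonical.induct)
  case (can_comp u v f w g)
  have r: "in_range (wvars v)"
    using mset_set_distinct(1)[OF canonical_mset[OF can_comp.hyps(1)]] can_comp.prems by simp
  show ?case
  proof (rule is_iso_cmp)
    show "Cod C f = Dom C g"
      using canonical_arr[OF can_comp.hyps(1)] canonical_arr[OF can_comp.hyps(2)] r can_comp.prems by simp
  qed (use can_comp r in auto)
next
  case (can_inv u v f g)
  show ?case by (rule is_iso_inverses[OF can_inv.hyps(2)])
qed (simp_all add: is_iso_idn is_iso_ten assc_iso runit_iso is_iso_sym)

text \<open>Both words are canonically isomorphic to the nested word on \<open>0, \<dots>, n - 1\<close>.\<close>

lemma canonical_exists:
  assumes "u \<in> Y (length xs)" "v \<in> Y (length xs)"
  shows "\<exists>f. canonical C xs u v f"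
proof -
  have *: "\<exists>f. canonical C xs w (nested [0..<length xs]) f \<and> in_range (wvars w)" if "w \<in> Y (length xs)" for w
  proof -
    have r: "in_range (wvars w)" "distinct (wvars w)" using that by (auto simp: Y_def)
    have "is_iso C (runit C (ob w))" by (rule runit_iso) (use r in auto)
    then obtain h where h: "inverses C (runit C (ob w)) h" unfolding is_iso_def by blast
    have "distinct (merge w [])"
      using mset_set_distinct(2)[of "merge w []" "wvars w"] r(2) by (simp add: mset_merge)
    moreover have "sorted (merge w [])" by (rule sorted_merge) simp
    moreover have "set (merge w []) = {..<length xs}" using that by (simp add: Y_def)
    ultimately have "merge w [] = [0..<length xs]"
      by (intro sorted_distinct_set_unique) (simp_all add: lessThan_atLeast0)
    hence "canonical C xs w (nested [0..<length xs]) (absorb w [] \<cdot> h)"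
      using canonical_absorb[OF r(1), of "[]"] can_comp[OF can_inv[OF can_runit h]] by simp
    thus ?thesis using r(1) by (intro exI conjI)
  qed
  obtain f g where fg: "canonical C xs u (nested [0..<length xs]) f" "in_range (wvars u)"
      "canonical C xs v (nested [0..<length xs]) g" "in_range (wvars v)"
    using *[OF assms(1)] *[OF assms(2)] by (elim exE conjE)
  have "is_iso C g" by (rule is_iso_canonical[OF fg(3,4)])
  then obtain h where "inverses C g h" unfolding is_iso_def by blast
  hence "canonical C xs u v (h \<cdot> f)" by (rule can_comp[OF fg(1) can_inv[OF fg(3)]])
  thus ?thesis ..
qed

end

section \<open>The operad of words\<close>

text \<open>The value of a word in an arbitrary set with a constant and a binary operation.  Both \<open>evO\<close> and \<open>evA\<close> are
  instances, so their compatibility with substitution is proved once.\<close>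

primrec fold_word :: "'b \<Rightarrow> ('b \<Rightarrow> 'b \<Rightarrow> 'b) \<Rightarrow> word \<Rightarrow> 'b list \<Rightarrow> 'b" where
  "fold_word e t WE xs = e"
| "fold_word e t (WVar i) xs = xs ! i"
| "fold_word e t (WTen u v) xs = t (fold_word e t u xs) (fold_word e t v xs)"

abbreviation shift :: "nat \<Rightarrow> word \<Rightarrow> word" where
  "shift m \<equiv> wsubst (\<lambda>i. WVar (m + i))"

abbreviation offset :: "word list \<Rightarrow> nat \<Rightarrow> nat" where
  "offset ws s \<equiv> sum_list (map arity (take s ws))"

lemma evO_fold_word: "evO C w xs = fold_word (munit C) (tenO C) w xs"
  by (induction w) auto

lemma evA_fold_word: "evA C w fs = fold_word (idn C (munit C)) (tenA C) w fs"
  by (induction w) auto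

lemma fold_word_wsubst:
  "\<forall>i\<in>set (wvars w). ys ! i = fold_word e t (\<rho> i) xs \<Longrightarrow>
    fold_word e t (wsubst \<rho> w) xs = fold_word e t w ys"
  by (induction w) auto

lemma Y_iff: "w \<in> Y n \<longleftrightarrow> mset (wvars w) = mset [0..<n]"
proof
  assume "w \<in> Y n"
  hence "distinct (wvars w)" "set (wvars w) = set [0..<n]"
    by (simp_all add: Y_def lessThan_atLeast0)
  thus "mset (wvars w) = mset [0..<n]"
    using set_eq_iff_mset_eq_distinct[of "wvars w" "[0..<n]"] distinct_upt by blast
next
  assume *: "mset (wvars w) = mset [0..<n]"
  show "w \<in> Y n"
    using mset_set_distinct[OF *] by (simp add: Y_def lessThan_atLeast0)
qed

lemma Y_arity: "w \<in> Y n \<Longrightarrow> arity w = n"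
  unfolding arity_def Y_iff using mset_eq_length[of "wvars w" "[0..<n]"] by simp

lemma Y_range: "w \<in> Y n \<Longrightarrow> set (wvars w) = {..<n}"
  by (simp add: Y_def)

lemma Y_var: "WVar 0 \<in> Y 1" "WVar 0 \<in> Y (Suc 0)"
  by (auto simp: Y_def)

lemma Y_canonical: "\<lbrakk>canonical C xs u v f; u \<in> Y n\<rbrakk> \<Longrightarrow> v \<in> Y n"
  using canonical_mset[of C xs u v f] by (simp add: Y_iff)

text \<open>The entry \<open>ws ! s\<close> is an operation that can be evaluated at the tuple \<open>xss ! s\<close>.\<close>

definition fits :: "word list \<Rightarrow> 'b list list \<Rightarrow> bool" where
  "fits ws xss \<longleftrightarrow> length ws = length xss \<and> (\<forall>s<length xss. ws ! s \<in> Y (length (xss ! s)))"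

lemma fits_arity: "fits ws xss \<Longrightarrow> map arity ws = map length xss"
  by (rule nth_equalityI) (auto simp: fits_def Y_arity)

lemma nth_concat_offset:
  "\<lbrakk>s < length xss; i < length (xss ! s)\<rbrakk> \<Longrightarrow>
    concat xss ! (sum_list (map length (take s xss)) + i) = xss ! s ! i"
proof (induction xss arbitrary: s)
  case (Cons xs xss)
  then show ?case by (cases s) (auto simp: nth_append)
qed simp

lemma take_concat_offset:
  "\<lbrakk>s < length xss; i < length (xss ! s)\<rbrakk> \<Longrightarrow>
    take (sum_list (map length (take s xss)) + i) (concat xss) = concat (take s xss) @ take i (xss ! s)"
proof (induction xss arbitrary: s)
  case (Cons xs xss)
  then show ?case by (cases s) auto
qed simp

lemma offset_less:
  "\<lbrakk>s < length xss; i < length (xss ! s)\<rbrakk> \<Longrightarrow>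
    sum_list (map length (take s xss)) + i < length (concat xss)"
proof (induction xss arbitrary: s)
  case (Cons xs xss)
  then show ?case by (cases s) auto
qed simp

lemma sum_list_concat_map: "sum_list (concat (map (map f) xss)) = (\<Sum>xs\<leftarrow>xss. sum_list (map f xs))"
  for f :: "'a \<Rightarrow> nat"
  by (induction xss) auto

lemma fold_word_shift:
  assumes "fits ws xss" "s < length xss"
  shows "fold_word e t (shift (offset ws s) (ws ! s)) (concat xss)
    = fold_word e t (ws ! s) (xss ! s)"
proof (rule fold_word_wsubst, intro ballI)
  fix i assume i: "i \<in> set (wvars (ws ! s))"
  have "map arity (take s ws) = map length (take s xss)"
    using fits_arity[OF assms(1)] by (metis take_map)
  moreover have "i < length (xss ! s)" using i assms by (auto simp: fits_def Y_range)
  ultimately show "xss ! s ! i = fold_word e t (WVar (sum_list (map arity (take s ws)) + i)) (concat xss)"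
    using nth_concat_offset[OF assms(2)] by simp
qed

text \<open>The value of a substitution instance is the value of the outer word at the values of the inner words;
  the shift by \<open>offset ws s\<close> finds the entries of \<open>xss ! s\<close> inside the concatenation.\<close>

lemma fold_word_wgamma:
  assumes "set (wvars w) \<subseteq> {..<length xss}" "fits ws xss"
  shows "fold_word e t (wgamma w ws) (concat xss) = fold_word e t w (map2 (fold_word e t) ws xss)"
  unfolding wgamma_def
proof (rule fold_word_wsubst, intro ballI)
  fix s assume "s \<in> set (wvars w)"
  hence s: "s < length xss" using assms by auto
  thus "map2 (fold_word e t) ws xss ! s =
      fold_word e t (shift (offset ws s) (ws ! s)) (concat xss)"
    using assms(2) fold_word_shift[OF assms(2) s] by (simp add: fits_def)
qed

lemma wvars_rename: "wvars (wsubst (\<lambda>i. WVar (f i)) w) = map f (wvars w)"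
  by (induction w) auto

lemma mset_wsubst: "mset (wvars (wsubst \<rho> w)) = (\<Sum>s\<in>#mset (wvars w). mset (wvars (\<rho> s)))"
  by (induction w) auto

text \<open>The variables are counted as a multiset: each variable \<open>s\<close> of \<open>w\<close> is replaced by the interval of length
  \<open>arity (ws ! s)\<close> that starts at \<open>offset ws s\<close>, and consecutive intervals add up.\<close>

lemma Y_wgamma:
  assumes "w \<in> Y (length xss)" "fits ws xss"
  shows "wgamma w ws \<in> Y (length (concat xss))"
proof -
  have *: "(\<Sum>s\<leftarrow>[0..<length us]. mset (map (\<lambda>i. sum_list (map arity (take s us)) + i) (wvars (us ! s)))) =
      mset [0..<sum_list (map arity us)]" if "\<forall>u\<in>set us. u \<in> Y (arity u)" for us
    using that
  proof (induction us rule: rev_induct)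
    case (snoc u us)
    let ?f = "\<lambda>us s. mset (map (\<lambda>i. sum_list (map arity (take s us)) + i) (wvars (us ! s)))"
    have "(\<Sum>s\<leftarrow>[0..<length us]. ?f (us @ [u]) s) = (\<Sum>s\<leftarrow>[0..<length us]. ?f us s)"
      by (intro arg_cong[of _ _ sum_list] map_cong) (auto simp: nth_append)
    moreover have "mset (map (\<lambda>i. m + i) (wvars u)) = mset [m..<m + arity u]" for m
    proof -
      have "mset (map (\<lambda>i. m + i) (wvars u)) = mset (map (\<lambda>i. m + i) [0..<arity u])"
        using snoc.prems by (simp add: Y_iff)
      also have "map (\<lambda>i. m + i) [0..<arity u] = [m..<m + arity u]"
        by (rule nth_equalityI) simp_all
      finally show ?thesis .
    qed
    ultimately have "(\<Sum>s\<leftarrow>[0..<length (us @ [u])]. ?f (us @ [u]) s) =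
        (\<Sum>s\<leftarrow>[0..<length us]. ?f us s) + mset [sum_list (map arity us)..<sum_list (map arity us) + arity u]"
      by (simp add: nth_append del: mset_map)
    also have "\<dots> = mset ([0..<sum_list (map arity us)] @ [sum_list (map arity us)..<sum_list (map arity us) + arity u])"
      using snoc.IH snoc.prems by (simp del: mset_upt)
    finally show ?case by (simp add: upt_add_eq_append[symmetric] del: mset_upt)
  qed simp
  have ar: "\<forall>u\<in>set ws. u \<in> Y (arity u)"
    using assms(2) Y_arity by (fastforce simp: fits_def in_set_conv_nth)
  have "length ws = length xss" using assms(2) by (simp add: fits_def)
  hence "mset (wvars w) = mset [0..<length ws]" using assms(1) by (simp only: Y_iff)
  hence "mset (wvars (wgamma w ws)) =
    (\<Sum>s\<leftarrow>[0..<length ws]. mset (map (\<lambda>i. sum_list (map arity (take s ws)) + i) (wvars (ws ! s))))"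
    unfolding wgamma_def mset_wsubst wvars_rename
    by (simp only: mset_map[symmetric] sum_mset_sum_list)
  thus ?thesis
    unfolding Y_iff using *[OF ar] fits_arity[OF assms(2)] by (simp add: length_concat)
qed

lemma Y_wact: "\<lbrakk>w \<in> Y n; \<sigma> permutes {..<n}\<rbrakk> \<Longrightarrow> wact w \<sigma> \<in> Y n"
  using permutes_inv[of \<sigma> "{..<n}"]
  by (auto simp: Y_def wact_def wvars_rename distinct_map permutes_image intro: permutes_inj_on)

lemma fold_word_wact:
  assumes "set (wvars w) \<subseteq> {..<length xs}" "\<sigma> permutes {..<length xs}"
  shows "fold_word e t (wact w \<sigma>) (permute_list \<sigma> xs) = fold_word e t w xs"
  unfolding wact_def
proof (rule fold_word_wsubst, intro ballI)
  fix i assume "i \<in> set (wvars w)"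
  hence "i < length xs" using assms by auto
  hence "inv \<sigma> i < length xs" using permutes_in_image[OF permutes_inv[OF assms(2)]] by simp
  thus "xs ! i = fold_word e t (WVar (inv \<sigma> i)) (permute_list \<sigma> xs)"
    using assms by (simp add: permute_list_nth permutes_inverses)
qed

lemma fits_concat:
  assumes "list_all2 fits wss xsss"
  shows "fits (concat wss) (concat xsss)"
  using assms
proof (induction rule: list_all2_induct)
  case (Cons ws wss xss xsss)
  then show ?case by (auto simp: fits_def nth_append)
qed (simp add: fits_def)

lemma concat_map_concat: "concat (map concat xsss) = concat (concat xsss)"
  by (induction xsss) auto

lemma fits_map2_wgamma:
  assumes "fits ws xsss" "list_all2 fits wss xsss"
  shows "fits (map2 wgamma ws wss) (map concat xsss)"
  unfolding fits_def
proof (intro conjI allI impI)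
  show "length (map2 wgamma ws wss) = length (map concat xsss)"
    using assms by (simp add: fits_def list_all2_lengthD)
  fix s assume "s < length (map concat xsss)"
  hence s: "s < length xsss" by simp
  have "ws ! s \<in> Y (length (xsss ! s))" "fits (wss ! s) (xsss ! s)"
    using s assms by (simp_all add: fits_def list_all2_conv_all_nth)
  hence "wgamma (ws ! s) (wss ! s) \<in> Y (length (concat (xsss ! s)))" by (rule Y_wgamma)
  thus "map2 wgamma ws wss ! s \<in> Y (length (map concat xsss ! s))"
    using s assms by (simp add: fits_def list_all2_lengthD)
qed

lemma wsubst_wsubst: "wsubst \<rho> (wsubst \<tau> w) = wsubst (\<lambda>i. wsubst \<rho> (\<tau> i)) w"
  by (induction w) auto

lemma wsubst_cong: "(\<And>i. i \<in> set (wvars w) \<Longrightarrow> \<rho> i = \<tau> i) \<Longrightarrow> wsubst \<rho> w = wsubst \<tau> w"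
  by (induction w) auto

text \<open>Both sides are iterated substitutions into \<open>w\<close>, so only the renamings of the innermost words have to
  be compared.  Both shift \<open>wss ! s ! i\<close> by the total arity of the words that precede it.\<close>

lemma wgamma_assoc:
  assumes w: "w \<in> Y (length ws)" and ws: "fits ws xsss" and wss: "list_all2 fits wss xsss"
  shows "wgamma (wgamma w ws) (concat wss) = wgamma w (map2 wgamma ws wss)"
proof -
  have l: "length ws = length xsss" "length wss = length xsss"
    using ws wss by (simp_all add: fits_def list_all2_lengthD)
  have Y: "ws ! s \<in> Y (length (wss ! s))" "fits (wss ! s) (xsss ! s)" if "s < length xsss" for s
    using ws wss that by (simp_all add: fits_def list_all2_conv_all_nth)
  have ar: "map arity ws = map length wss"
    by (rule nth_equalityI) (use l Y(1) Y_arity in simp_all)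
  have "arity (wgamma (ws ! s) (wss ! s)) = sum_list (map arity (wss ! s))" if "s < length xsss" for s
    using Y_arity[OF Y_wgamma] Y[OF that] fits_arity[OF Y(2)[OF that]]
    by (simp add: fits_def length_concat)
  hence ar2: "map arity (map2 wgamma ws wss) = map (\<lambda>vs. sum_list (map arity vs)) wss"
    by (intro nth_equalityI) (use l in simp_all)
  show ?thesis
    unfolding wgamma_def[of w] wgamma_def[of "wsubst _ w"] wsubst_wsubst
  proof (rule wsubst_cong)
    fix s assume "s \<in> set (wvars w)"
    hence s: "s < length wss" using w l by (simp add: Y_range)
    have o: "offset ws s = sum_list (map length (take s wss))"
      using ar by (metis take_map)
    have o2: "offset (map2 wgamma ws wss) s = sum_list (map (\<lambda>vs. sum_list (map arity vs)) (take s wss))"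
      using ar2 by (metis take_map)
    show "wsubst (\<lambda>i. wsubst (\<lambda>k. shift (offset (concat wss) k) (concat wss ! k)) (WVar (offset ws s + i))) (ws ! s) =
        shift (offset (map2 wgamma ws wss) s) (map2 wgamma ws wss ! s)"
    proof -
      have "offset (concat wss) (offset ws s + i) = offset (map2 wgamma ws wss) s + offset (wss ! s) i \<and>
          concat wss ! (offset ws s + i) = wss ! s ! i" if "i \<in> set (wvars (ws ! s))" for i
      proof -
        have i: "i < length (wss ! s)" using Y(1)[of s] s l that by (simp add: Y_range)
        show ?thesis
          using take_concat_offset[OF s i] nth_concat_offset[OF s i]
          by (simp add: o o2 map_concat sum_list_concat_map)
      qed
      hence "wsubst (\<lambda>i. shift (offset (concat wss) (offset ws s + i)) (concat wss ! (offset ws s + i))) (ws ! s) =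
          wsubst (\<lambda>i. shift (offset (map2 wgamma ws wss) s + offset (wss ! s) i) (wss ! s ! i)) (ws ! s)"
        by (intro wsubst_cong) simp
      also have "\<dots> = shift (offset (map2 wgamma ws wss) s) (wgamma (ws ! s) (wss ! s))"
        by (simp add: wgamma_def[of "ws ! s"] wsubst_wsubst add.assoc)
      finally show ?thesis using s l by simp
    qed
  qed
qed

lemma wgamma_var: "wgamma (WVar 0) [w] = w"
proof -
  have "wsubst WVar w = w" by (induction w) auto
  thus ?thesis by (simp add: wgamma_def)
qed

lemma wgamma_vars:
  assumes "w \<in> Y (length xs)"
  shows "wgamma w (map (\<lambda>_. WVar 0) xs) = w"
proof -
  have "wsubst (\<lambda>s. wsubst (\<lambda>i. WVar (sum_list (map arity (take s (map (\<lambda>_. WVar 0) xs))) + i)) (map (\<lambda>_. WVar 0) xs ! s)) w = w"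
    if "set (wvars w) \<subseteq> {..<length xs}" for w
    using that by (induction w) (auto simp: take_map o_def arity_def sum_list_triv)
  thus ?thesis using assms by (simp add: wgamma_def Y_range)
qed

lemma wact_id: "wact w id = w"
  by (induction w) (auto simp: wact_def)

lemma wact_wact:
  assumes "\<sigma> permutes A" "\<tau> permutes A"
  shows "wact (wact w \<sigma>) \<tau> = wact w (\<sigma> \<circ> \<tau>)"
proof -
  have "inv (\<sigma> \<circ> \<tau>) = inv \<tau> \<circ> inv \<sigma>"
    using assms permutes_bij o_inv_distrib by blast
  thus ?thesis by (induction w) (auto simp: wact_def)
qed

section \<open>Canonical isomorphisms\<close>

context symmetric_monoidal_category begin

lemma smc_tuple: "set xs \<subseteq> Ob C \<Longrightarrow> smc_tuple C xs"
  by unfold_locales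

lemma evO_Ob:
  assumes "set xs \<subseteq> Ob C" "set (wvars w) \<subseteq> {..<length xs}"
  shows "evO C w xs \<in> Ob C"
  using smc_tuple.ob_Ob[OF smc_tuple[OF assms(1)] assms(2)] .

lemma evO_Y [simp]: "\<lbrakk>set xs \<subseteq> Ob C; w \<in> Y (length xs)\<rbrakk> \<Longrightarrow> evO C w xs \<in> Ob C"
  by (rule evO_Ob) (simp_all add: Y_range)

text \<open>This is where coherence enters: the definite description in \<open>can\<close> denotes.  From here on, equations
  between canonical isomorphisms follow from \<open>can_eqI\<close>.\<close>

lemma can_canonical:
  assumes "set xs \<subseteq> Ob C" "u \<in> Y (length xs)" "v \<in> Y (length xs)"
  shows "canonical C xs u v (can C u v xs)"
  unfolding can_def
proof (rule theI')
  interpret smc_tuple C xs by (rule smc_tuple[OF assms(1)])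
  obtain f where "canonical C xs u v f" using canonical_exists[OF assms(2,3)] ..
  thus "\<exists>!f. canonical C xs u v f"
  proof (rule ex1I)
    fix g assume "canonical C xs u v g"
    thus "g = f"
      by (rule coherence[OF _ \<open>canonical C xs u v f\<close>]) (use assms(2) in \<open>simp_all add: Y_def\<close>)
  qed
qed

lemma can_eqI:
  assumes "canonical C xs u v f" "set xs \<subseteq> Ob C" "u \<in> Y (length xs)"
  shows "can C u v xs = f"
proof -
  interpret smc_tuple C xs by (rule smc_tuple[OF assms(2)])
  have "canonical C xs u v (can C u v xs)"
    by (rule can_canonical) (use assms Y_canonical in auto)
  thus ?thesis by (rule coherence[OF _ assms(1)]) (use assms(3) in \<open>simp_all add: Y_def\<close>)
qed

lemma can_simps [simp]:
  assumes "set xs \<subseteq> Ob C" "u \<in> Y (length xs)" "v \<in> Y (length xs)"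
  shows "can C u v xs \<in> Arr C" "Dom C (can C u v xs) = evO C u xs" "Cod C (can C u v xs) = evO C v xs"
proof -
  interpret smc_tuple C xs by (rule smc_tuple[OF assms(1)])
  show "can C u v xs \<in> Arr C" "Dom C (can C u v xs) = evO C u xs" "Cod C (can C u v xs) = evO C v xs"
    using canonical_arr[OF can_canonical[OF assms]] assms(2) by (simp_all add: Y_range)
qed

lemma can_self [simp]:
  "\<lbrakk>set xs \<subseteq> Ob C; u \<in> Y (length xs)\<rbrakk> \<Longrightarrow> can C u u xs = idn C (evO C u xs)"
  by (rule can_eqI[OF can_id])

lemma can_can [simp]:
  "\<lbrakk>set xs \<subseteq> Ob C; u \<in> Y (length xs); v \<in> Y (length xs); w \<in> Y (length xs)\<rbrakk>
    \<Longrightarrow> can C v w xs \<cdot> can C u v xs = can C u w xs"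
  by (rule can_eqI[OF can_comp[OF can_canonical can_canonical], symmetric])

lemma evA_hom:
  "\<lbrakk>set gs \<subseteq> Arr C; set (wvars w) \<subseteq> {..<length gs}\<rbrakk> \<Longrightarrow>
    evA C w gs \<in> Arr C \<and> Dom C (evA C w gs) = evO C w (map (Dom C) gs) \<and>
    Cod C (evA C w gs) = evO C w (map (Cod C) gs)"
  by (induction w) auto

lemma evA_simps [simp]:
  assumes "set gs \<subseteq> Arr C" "w \<in> Y (length gs)"
  shows "evA C w gs \<in> Arr C" "Dom C (evA C w gs) = evO C w (map (Dom C) gs)"
    "Cod C (evA C w gs) = evO C w (map (Cod C) gs)"
  using evA_hom[OF assms(1), of w] assms(2) by (simp_all add: Y_range)

lemma evA_cmp_range:
  "\<lbrakk>set fs \<subseteq> Arr C; set gs \<subseteq> Arr C; map (Cod C) fs = map (Dom C) gs; set (wvars w) \<subseteq> {..<length gs}\<rbrakk>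
    \<Longrightarrow> evA C w gs \<cdot> evA C w fs = evA C w (map2 (cmp C) gs fs)"
proof (induction w)
  case (WVar i)
  moreover have "length fs = length gs" using WVar(3) by (metis length_map)
  ultimately show ?case by simp
next
  case (WTen u v)
  have "length fs = length gs" using WTen.prems(3) by (metis length_map)
  thus ?case using WTen evA_hom[of fs u] evA_hom[of gs u] evA_hom[of fs v] evA_hom[of gs v]
    by (simp add: ten_cmp)
qed simp

lemma evA_cmp:
  "\<lbrakk>set fs \<subseteq> Arr C; set gs \<subseteq> Arr C; map (Cod C) fs = map (Dom C) gs; w \<in> Y (length gs)\<rbrakk>
    \<Longrightarrow> evA C w gs \<cdot> evA C w fs = evA C w (map2 (cmp C) gs fs)"
  by (rule evA_cmp_range) (simp_all add: Y_range)

lemma evA_idn: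
  assumes "set xs \<subseteq> Ob C" "w \<in> Y (length xs)"
  shows "evA C w (map (idn C) xs) = idn C (evO C w xs)"
proof -
  have "set (wvars w) \<subseteq> {..<length xs} \<Longrightarrow> ?thesis" if "set xs \<subseteq> Ob C"
  proof (induction w)
    case (WTen u v)
    then show ?case using that evO_Ob[of xs u] evO_Ob[of xs v] by simp
  qed simp_all
  thus ?thesis using assms by (simp add: Y_range)
qed

text \<open>The derivation of \<open>f\<close> is repeated over the codomains of \<open>gs\<close>; each generator is natural.\<close>

lemma canonical_natural:
  assumes "canonical C (map (Dom C) gs) u v f" "set gs \<subseteq> Arr C" "set (wvars u) \<subseteq> {..<length gs}"
  shows "\<exists>f'. canonical C (map (Cod C) gs) u v f' \<and> f' \<cdot> evA C u gs = evA C v gs \<cdot> f"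
  using assms
proof (induction rule: canonical.induct)
  case (can_id w)
  show ?case by (rule exI, rule conjI, rule canonical.can_id) (use can_id evA_hom[of gs w] in simp)
next
  case (can_comp u v f w g)
  interpret d: smc_tuple C "map (Dom C) gs" by (rule smc_tuple) (use can_comp.prems in auto)
  interpret c: smc_tuple C "map (Cod C) gs" by (rule smc_tuple) (use can_comp.prems in auto)
  have r: "set (wvars v) = set (wvars u)" "set (wvars w) = set (wvars u)"
    using mset_set_distinct(1)[OF canonical_mset] can_comp.hyps by metis+
  obtain f' g' where f': "canonical C (map (Cod C) gs) u v f'" "f' \<cdot> evA C u gs = evA C v gs \<cdot> f"
    and g': "canonical C (map (Cod C) gs) v w g'" "g' \<cdot> evA C v gs = evA C w gs \<cdot> g"
    using can_comp r by auto
  note a = d.canonical_arr[OF can_comp.hyps(1)] d.canonical_arr[OF can_comp.hyps(2)]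
    c.canonical_arr[OF f'(1)] c.canonical_arr[OF g'(1)] can_comp.prems r
    evA_hom[of gs u] evA_hom[of gs v] evA_hom[of gs w]
  have "(g' \<cdot> f') \<cdot> evA C u gs = g' \<cdot> (evA C v gs \<cdot> f)" using a by (simp add: f'(2))
  also have "\<dots> = evA C w gs \<cdot> (g \<cdot> f)" using a by (simp add: cmp_extend[OF g'(2)])
  finally show ?case using canonical.can_comp[OF f'(1) g'(1)] by blast
next
  case (can_inv u v f g)
  interpret d: smc_tuple C "map (Dom C) gs" by (rule smc_tuple) (use can_inv.prems in auto)
  interpret c: smc_tuple C "map (Cod C) gs" by (rule smc_tuple) (use can_inv.prems in auto)
  have r: "set (wvars v) = set (wvars u)" "set (wvars u) \<subseteq> {..<length gs}"
    using mset_set_distinct(1)[OF canonical_mset[OF can_inv.hyps(1)]] can_inv.prems by auto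
  obtain f' where f': "canonical C (map (Cod C) gs) u v f'" "f' \<cdot> evA C u gs = evA C v gs \<cdot> f"
    using can_inv r by auto
  have "is_iso C f'" by (rule c.is_iso_canonical[OF f'(1)]) (use r in simp)
  then obtain g' where g': "inverses C f' g'" unfolding is_iso_def by blast
  have a: "f \<in> Arr C" "Dom C f = evO C u (map (Dom C) gs)" "Cod C f = evO C v (map (Dom C) gs)"
    "f' \<in> Arr C" "Dom C f' = evO C u (map (Cod C) gs)" "Cod C f' = evO C v (map (Cod C) gs)"
    using d.canonical_arr[OF can_inv.hyps(1)] c.canonical_arr[OF f'(1)] r by auto
  have i: "g \<in> Arr C" "Dom C g = Cod C f" "Cod C g = Dom C f" "f \<cdot> g = idn C (Cod C f)"
    "g' \<in> Arr C" "Dom C g' = Cod C f'" "Cod C g' = Dom C f'" "g' \<cdot> f' = idn C (Dom C f')"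
    using can_inv.hyps(2) g' by (auto simp: inverses_def hom_def)
  have e: "evA C u gs \<in> Arr C" "Dom C (evA C u gs) = Dom C f" "Cod C (evA C u gs) = Dom C f'"
    "evA C v gs \<in> Arr C" "Dom C (evA C v gs) = Cod C f" "Cod C (evA C v gs) = Cod C f'"
    using evA_hom[of gs u] evA_hom[of gs v] can_inv.prems r a by auto
  have "g' \<cdot> evA C v gs = g' \<cdot> (evA C v gs \<cdot> (f \<cdot> g))"
    unfolding i(4) using e by simp
  also have "\<dots> = g' \<cdot> ((f' \<cdot> evA C u gs) \<cdot> g)"
    unfolding f'(2) using e i a(1,4) by simp
  also have "\<dots> = (g' \<cdot> f') \<cdot> (evA C u gs \<cdot> g)"
    using e i(1-3) i(5-7) a(1,4) by simp
  also have "\<dots> = evA C u gs \<cdot> g" unfolding i(8) using e i(1-3) a by simp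
  finally show ?case using canonical.can_inv[OF f'(1) g'] by blast
next
  case (can_ten u u' f v v' g)
  interpret d: smc_tuple C "map (Dom C) gs" by (rule smc_tuple) (use can_ten.prems in auto)
  interpret c: smc_tuple C "map (Cod C) gs" by (rule smc_tuple) (use can_ten.prems in auto)
  have r: "set (wvars u') = set (wvars u)" "set (wvars v') = set (wvars v)"
    using mset_set_distinct(1)[OF canonical_mset] can_ten.hyps by metis+
  obtain f' g' where f': "canonical C (map (Cod C) gs) u u' f'" "f' \<cdot> evA C u gs = evA C u' gs \<cdot> f"
    and g': "canonical C (map (Cod C) gs) v v' g'" "g' \<cdot> evA C v gs = evA C v' gs \<cdot> g"
    using can_ten r by auto
  note a = d.canonical_arr[OF can_ten.hyps(1)] d.canonical_arr[OF can_ten.hyps(2)]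
    c.canonical_arr[OF f'(1)] c.canonical_arr[OF g'(1)] can_ten.prems r
    evA_hom[of gs u] evA_hom[of gs v] evA_hom[of gs u'] evA_hom[of gs v']
  have "(f' \<boxplus> g') \<cdot> evA C (WTen u v) gs = evA C (WTen u' v') gs \<cdot> (f \<boxplus> g)"
    using a by (simp add: ten_cmp f'(2) g'(2))
  thus ?case using canonical.can_ten[OF f'(1) g'(1)] by blast
next
  case (can_assc u v w)
  show ?case by (rule exI, rule conjI, rule canonical.can_assc)
    (use can_assc evA_hom[of gs u] evA_hom[of gs v] evA_hom[of gs w]
      assc_natural[of "evA C u gs" "evA C v gs" "evA C w gs"] in simp)
next
  case (can_runit u)
  show ?case by (rule exI, rule conjI, rule canonical.can_runit)
    (use can_runit evA_hom[of gs u] runit_nat[of "evA C u gs"] in \<open>simp add: hom_def\<close>)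
next
  case (can_sym u v)
  show ?case by (rule exI, rule conjI, rule canonical.can_sym)
    (use can_sym evA_hom[of gs u] evA_hom[of gs v] sym_natural[of "evA C u gs" "evA C v gs"] in simp)
qed

lemma can_natural:
  assumes "set gs \<subseteq> Arr C" "u \<in> Y (length gs)" "v \<in> Y (length gs)"
  shows "can C u v (map (Cod C) gs) \<cdot> evA C u gs = evA C v gs \<cdot> can C u v (map (Dom C) gs)"
proof -
  have "canonical C (map (Dom C) gs) u v (can C u v (map (Dom C) gs))"
    by (rule can_canonical) (use assms in auto)
  then obtain f' where f': "canonical C (map (Cod C) gs) u v f'"
    "f' \<cdot> evA C u gs = evA C v gs \<cdot> can C u v (map (Dom C) gs)"
    using canonical_natural[of gs u v] assms by (auto simp: Y_range)
  have "can C u v (map (Cod C) gs) = f'"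
    by (rule can_eqI[OF f'(1)]) (use assms in auto)
  thus ?thesis using f'(2) by simp
qed

lemma evO_wsubst:
  "\<forall>i\<in>set (wvars w). ys ! i = evO C (\<rho> i) xs \<Longrightarrow> evO C (wsubst \<rho> w) xs = evO C w ys"
  unfolding evO_fold_word by (rule fold_word_wsubst)

text \<open>A derivation of a canonical isomorphism can be replayed after substituting words for its variables.\<close>

lemma canonical_wsubst:
  assumes "canonical C ys u v f" "\<forall>i\<in>set (wvars u). ys ! i = evO C (\<rho> i) xs"
  shows "canonical C xs (wsubst \<rho> u) (wsubst \<rho> v) f"
  using assms
proof (induction rule: canonical.induct)
  case (can_id w)
  thus ?case using canonical.can_id[of C xs "wsubst \<rho> w"] by (simp add: evO_wsubst)
next
  case (can_comp u v f w g)
  thus ?case using mset_set_distinct(1)[OF canonical_mset[OF can_comp.hyps(1)]]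
    by (auto intro: canonical.can_comp)
next
  case (can_inv u v f g)
  thus ?case using mset_set_distinct(1)[OF canonical_mset[OF can_inv.hyps(1)]]
    by (auto intro: canonical.can_inv)
next
  case (can_ten u u' f v v' g)
  thus ?case by (auto intro: canonical.can_ten)
next
  case (can_assc u v w)
  have "evO C (wsubst \<rho> u) xs = evO C u ys" "evO C (wsubst \<rho> v) xs = evO C v ys" "evO C (wsubst \<rho> w) xs = evO C w ys"
    using can_assc by (auto intro!: evO_wsubst)
  thus ?case using canonical.can_assc[of C xs "wsubst \<rho> u" "wsubst \<rho> v" "wsubst \<rho> w"] by simp
next
  case (can_runit u)
  thus ?case using canonical.can_runit[of C xs "wsubst \<rho> u"] by (simp add: evO_wsubst)
next
  case (can_sym u v)
  have "evO C (wsubst \<rho> u) xs = evO C u ys" "evO C (wsubst \<rho> v) xs = evO C v ys"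
    using can_sym by (auto intro!: evO_wsubst)
  thus ?case using canonical.can_sym[of C xs "wsubst \<rho> u" "wsubst \<rho> v"] by simp
qed

text \<open>Substitution into the outer words, used to move a canonical isomorphism between tuples of values to
  the concatenated tuple.  The companion \<open>can_wgamma_inner\<close> treats canonical isomorphisms of the
  substituted words.\<close>

lemma can_wgamma_outer:
  assumes "set (concat xss) \<subseteq> Ob C" "fits ws xss" "u \<in> Y (length xss)" "v \<in> Y (length xss)"
  shows "can C u v (map2 (evO C) ws xss) = can C (wgamma u ws) (wgamma v ws) (concat xss)"
proof (rule can_eqI[symmetric])
  have l: "length ws = length xss" using assms(2) by (simp add: fits_def)
  have "set (map2 (evO C) ws xss) \<subseteq> Ob C"
    using assms(1,2) by (fastforce simp: fits_def in_set_conv_nth intro!: evO_Y)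
  hence "canonical C (map2 (evO C) ws xss) u v (can C u v (map2 (evO C) ws xss))"
    by (rule can_canonical) (use assms l in simp_all)
  thus "canonical C (concat xss) (wgamma u ws) (wgamma v ws) (can C u v (map2 (evO C) ws xss))"
    unfolding wgamma_def
  proof (rule canonical_wsubst, intro ballI)
    fix s assume "s \<in> set (wvars u)"
    hence s: "s < length xss" using assms(3) by (simp add: Y_range)
    thus "map2 (evO C) ws xss ! s =
      evO C (shift (offset ws s) (ws ! s)) (concat xss)"
      using l fold_word_shift[OF assms(2) s] by (simp add: evO_fold_word)
  qed
qed (use assms Y_wgamma in auto)

lemma evO_wgamma:
  "\<lbrakk>fits ws xss; w \<in> Y (length xss)\<rbrakk> \<Longrightarrow> evO C (wgamma w ws) (concat xss) = evO C w (map2 (evO C) ws xss)"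
  using fold_word_wgamma[of w xss ws "munit C" "tenO C"] by (simp add: Y_range evO_fold_word[abs_def])

lemma evA_wgamma:
  "\<lbrakk>fits ws fss; w \<in> Y (length fss)\<rbrakk> \<Longrightarrow> evA C (wgamma w ws) (concat fss) = evA C w (map2 (evA C) ws fss)"
  using fold_word_wgamma[of w fss ws "idn C (munit C)" "tenA C"] by (simp add: Y_range evA_fold_word[abs_def])

lemma evO_wact:
  "\<lbrakk>w \<in> Y (length xs); \<sigma> permutes {..<length xs}\<rbrakk> \<Longrightarrow> evO C (wact w \<sigma>) (permute_list \<sigma> xs) = evO C w xs"
  using fold_word_wact[of w xs \<sigma>] by (simp add: Y_range evO_fold_word[abs_def])

lemma evA_wact:
  "\<lbrakk>w \<in> Y (length fs); \<sigma> permutes {..<length fs}\<rbrakk> \<Longrightarrow> evA C (wact w \<sigma>) (permute_list \<sigma> fs) = evA C w fs"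
  using fold_word_wact[of w fs \<sigma>] by (simp add: Y_range evA_fold_word[abs_def])

lemma can_wact:
  assumes "set xs \<subseteq> Ob C" "u \<in> Y (length xs)" "v \<in> Y (length xs)" "\<sigma> permutes {..<length xs}"
  shows "can C u v xs = can C (wact u \<sigma>) (wact v \<sigma>) (permute_list \<sigma> xs)"
proof (rule can_eqI[symmetric])
  have "canonical C xs u v (can C u v xs)" by (rule can_canonical) (use assms in auto)
  thus "canonical C (permute_list \<sigma> xs) (wact u \<sigma>) (wact v \<sigma>) (can C u v xs)"
    unfolding wact_def
  proof (rule canonical_wsubst, intro ballI)
    fix i assume "i \<in> set (wvars u)"
    hence "i < length xs" using assms(2) by (simp add: Y_range)
    moreover from this have "inv \<sigma> i < length xs" using permutes_in_image[OF permutes_inv[OF assms(4)]] by simp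
    ultimately show "xs ! i = evO C (WVar (inv \<sigma> i)) (permute_list \<sigma> xs)"
      using assms by (simp add: permute_list_nth permutes_inverses)
  qed
qed (use assms Y_wact in auto)

lemma canonical_evA:
  assumes "\<forall>s\<in>set (wvars w). canonical C xs (\<rho> s) (\<rho>' s) (fs ! s)"
  shows "canonical C xs (wsubst \<rho> w) (wsubst \<rho>' w) (evA C w fs)"
  using assms
proof (induction w)
  case WE
  show ?case using can_id[of C xs WE] by simp
next
  case (WTen u v)
  thus ?case by (auto intro: can_ten)
qed simp

lemma can_wgamma_inner:
  assumes "set (concat xss) \<subseteq> Ob C" "fits us xss" "fits vs xss" "w \<in> Y (length xss)"
  shows "evA C w (map2 (\<lambda>(u, v). can C u v) (zip us vs) xss) = can C (wgamma w us) (wgamma w vs) (concat xss)"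
    (is "evA C w ?fs = _")
proof (rule can_eqI[symmetric])
  have l: "length us = length xss" "length vs = length xss" using assms(2,3) by (auto simp: fits_def)
  have a: "map arity us = map arity vs" using assms(2,3) by (simp add: fits_arity)
  show "canonical C (concat xss) (wgamma w us) (wgamma w vs) (evA C w ?fs)"
    unfolding wgamma_def
  proof (rule canonical_evA, intro ballI)
    fix s assume "s \<in> set (wvars w)"
    hence s: "s < length xss" using assms(4) by (simp add: Y_range)
    have Y: "us ! s \<in> Y (length (xss ! s))" "vs ! s \<in> Y (length (xss ! s))"
      using s assms(2,3) by (auto simp: fits_def)
    have "set (xss ! s) \<subseteq> Ob C" using s assms(1) by fastforce
    hence "canonical C (xss ! s) (us ! s) (vs ! s) (can C (us ! s) (vs ! s) (xss ! s))"
      by (rule can_canonical[OF _ Y])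
    hence "canonical C (xss ! s) (us ! s) (vs ! s) (?fs ! s)" using s l by simp
    moreover have m: "map arity (take s us) = map length (take s xss)"
      using fits_arity[OF assms(2)] by (metis take_map)
    moreover have "map arity (take s vs) = map arity (take s us)"
      using a by (metis take_map)
    ultimately show "canonical C (concat xss)
        (shift (offset us s) (us ! s))
        (shift (offset vs s) (vs ! s)) (?fs ! s)"
      using nth_concat_offset[OF s] Y by (auto intro!: canonical_wsubst simp: Y_range)
  qed
qed (use assms Y_wgamma in auto)

end

section \<open>Block permutations\<close>

text \<open>Block permutations are given by their lists of values, so everything about them is read off from lists
  that enumerate \<open>0, \<dots>, n - 1\<close>.\<close>

lemma list_perm_permutes:
  assumes "mset ps = mset [0..<n]"
  shows "list_perm ps permutes {..<n}"
proof (rule bij_imp_permutes)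
  have d: "distinct ps" "set ps = {..<n}"
    using mset_set_distinct[OF assms] by (simp_all add: lessThan_atLeast0)
  have l: "length ps = n" using mset_eq_length[OF assms] by simp
  have "bij_betw ((!) ps) {..<n} {..<n}"
    by (rule bij_betw_nth[OF d(1)]) (simp_all add: l d(2))
  moreover have "bij_betw ((!) ps) {..<n} {..<n} = bij_betw (list_perm ps) {..<n} {..<n}"
    by (rule bij_betw_cong) (simp add: list_perm_def l)
  ultimately show "bij_betw (list_perm ps) {..<n} {..<n}" by simp
  show "list_perm ps x = x" if "x \<notin> {..<n}" for x
    using that by (simp add: list_perm_def l)
qed

lemma permute_list_list_perm: "length ps = length xs \<Longrightarrow> permute_list (list_perm ps) xs = map (nth xs) ps"
  by (rule nth_equalityI) (simp_all add: permute_list_def list_perm_def)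

lemma length_blocks [simp]: "length (blocks js) = length js"
  by (simp add: blocks_def)

lemma blocks_snoc: "blocks (js @ [j]) = blocks js @ [[sum_list js..<sum_list js + j]]"
  by (rule nth_equalityI) (auto simp: blocks_def nth_append)

lemma concat_blocks: "concat (blocks js) = [0..<sum_list js]"
proof (induction js rule: rev_induct)
  case Nil
  show ?case by (simp add: blocks_def)
next
  case (snoc j js)
  thus ?case by (simp add: blocks_snoc upt_add_eq_append[symmetric])
qed

lemma map_nth_blocks: "map (map (nth (concat xss))) (blocks (map length xss)) = xss"
proof (rule nth_equalityI)
  fix s assume "s < length (map (map (nth (concat xss))) (blocks (map length xss)))"
  hence s: "s < length xss" by simp
  have "sum_list (map length (take (Suc s) xss)) = sum_list (map length (take s xss)) + length (xss ! s)"
    using s by (simp add: take_Suc_conv_app_nth)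
  thus "map (map (nth (concat xss))) (blocks (map length xss)) ! s = xss ! s"
    using s by (intro nth_equalityI) (auto simp: blocks_def take_map nth_concat_offset)
qed simp

lemma length_block: "s < length js \<Longrightarrow> length (blocks js ! s) = js ! s"
  by (simp add: blocks_def take_Suc_conv_app_nth)

lemma mset_concat: "mset (concat xss) = (\<Sum>xs\<in>#mset xss. mset xs)"
  by (induction xss) auto

lemma mset_block_perm:
  "\<sigma> permutes {..<length js} \<Longrightarrow> mset (concat (permute_list \<sigma> (blocks js))) = mset [0..<sum_list js]"
  using concat_blocks[of js] mset_concat[of "blocks js"] by (simp add: mset_concat)

lemma block_perm_permutes:
  "\<sigma> permutes {..<length js} \<Longrightarrow> block_perm \<sigma> js permutes {..<sum_list js}"
  unfolding block_perm_def by (rule list_perm_permutes) (rule mset_block_perm)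

lemma permute_list_block_perm:
  assumes "\<sigma> permutes {..<length xss}"
  shows "permute_list (block_perm \<sigma> (map length xss)) (concat xss) = concat (permute_list \<sigma> xss)"
proof -
  have m: "mset (concat (permute_list \<sigma> (blocks (map length xss)))) = mset [0..<sum_list (map length xss)]"
    by (rule mset_block_perm) (use assms in simp)
  have "permute_list (block_perm \<sigma> (map length xss)) (concat xss) =
      concat (map (map (nth (concat xss))) (permute_list \<sigma> (blocks (map length xss))))"
    unfolding block_perm_def
    by (subst permute_list_list_perm) (use mset_eq_length[OF m] in \<open>simp_all add: length_concat map_concat\<close>)
  also have "map (map (nth (concat xss))) (permute_list \<sigma> (blocks (map length xss))) =
      permute_list \<sigma> (map (map (nth (concat xss))) (blocks (map length xss)))"
    by (rule permute_list_map[symmetric]) (use assms in simp)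
  finally show ?thesis by (simp add: map_nth_blocks)
qed

lemma mset_sum_perm:
  assumes "length \<sigma>s = length js" "\<And>s. s < length js \<Longrightarrow> \<sigma>s ! s permutes {..<js ! s}"
  shows "mset (concat (map2 permute_list \<sigma>s (blocks js))) = mset [0..<sum_list js]"
proof -
  have "map mset (map2 permute_list \<sigma>s (blocks js)) = map mset (blocks js)"
    by (rule nth_equalityI) (use assms in \<open>auto simp: length_block\<close>)
  hence "mset (concat (map2 permute_list \<sigma>s (blocks js))) = mset (concat (blocks js))"
    by (metis mset_concat mset_map)
  thus ?thesis by (simp add: concat_blocks)
qed

lemma sum_perm_permutes:
  assumes "length \<sigma>s = length js" "\<And>s. s < length js \<Longrightarrow> \<sigma>s ! s permutes {..<js ! s}"
  shows "sum_perm \<sigma>s js permutes {..<sum_list js}"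
  unfolding sum_perm_def by (rule list_perm_permutes) (rule mset_sum_perm[OF assms])

lemma permute_list_sum_perm:
  assumes "length \<sigma>s = length xss" "\<And>s. s < length xss \<Longrightarrow> \<sigma>s ! s permutes {..<length (xss ! s)}"
  shows "permute_list (sum_perm \<sigma>s (map length xss)) (concat xss) = concat (map2 permute_list \<sigma>s xss)"
proof -
  have m: "mset (concat (map2 permute_list \<sigma>s (blocks (map length xss)))) = mset [0..<sum_list (map length xss)]"
    by (rule mset_sum_perm) (use assms in simp_all)
  have "permute_list (sum_perm \<sigma>s (map length xss)) (concat xss) =
      concat (map (map (nth (concat xss))) (map2 permute_list \<sigma>s (blocks (map length xss))))"
    unfolding sum_perm_def
    by (subst permute_list_list_perm) (use mset_eq_length[OF m] in \<open>simp_all add: length_concat map_concat\<close>)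
  also have "map (map (nth (concat xss))) (map2 permute_list \<sigma>s (blocks (map length xss))) =
      map2 permute_list \<sigma>s (map (map (nth (concat xss))) (blocks (map length xss)))"
    by (rule nth_equalityI) (use assms in \<open>auto simp: length_block permute_list_map\<close>)
  finally show ?thesis by (simp add: map_nth_blocks)
qed

lemma fits_permute_list:
  assumes "fits ws xss" "\<sigma> permutes {..<length xss}"
  shows "fits (permute_list \<sigma> ws) (permute_list \<sigma> xss)"
  using assms permutes_in_image[OF assms(2)] by (auto simp: fits_def permute_list_nth)

lemma nth_blocks: "\<lbrakk>s < length js; i < js ! s\<rbrakk> \<Longrightarrow> blocks js ! s ! i = sum_list (take s js) + i"
  by (simp add: blocks_def take_Suc_conv_app_nth)

lemma list_perm_concat:
  "\<lbrakk>t < length ps; i < length (ps ! t)\<rbrakk> \<Longrightarrow>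
    list_perm (concat ps) (sum_list (map length (take t ps)) + i) = ps ! t ! i"
  by (simp add: list_perm_def offset_less nth_concat_offset)

text \<open>Both sides put a renamed copy of \<open>ws ! s\<close> in place of variable \<open>s\<close> of \<open>w\<close>.  On the left the renaming is
  a shift to the position of the block after permuting, on the right a shift followed by the inverse of
  the block permutation; the values of the block permutation identify the two.\<close>

lemma wgamma_wact_outer:
  assumes w: "w \<in> Y (length xss)" and ws: "fits ws xss" and \<sigma>: "\<sigma> permutes {..<length xss}"
  shows "wgamma (wact w \<sigma>) (permute_list \<sigma> ws) = wact (wgamma w ws) (block_perm \<sigma> (map length xss))"
proof -
  let ?js = "map length xss"
  let ?\<beta> = "block_perm \<sigma> ?js" and ?bs = "permute_list \<sigma> (blocks ?js)" and ?us = "permute_list \<sigma> ws"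
  have l: "length ws = length xss" using ws by (simp add: fits_def)
  have \<beta>: "?\<beta> permutes {..<sum_list ?js}"
    by (rule block_perm_permutes) (use \<sigma> in simp)
  have \<sigma>_less: "\<sigma> t < length xss" if "t < length xss" for t
    using that permutes_in_image[OF \<sigma>] by simp
  have "map arity ?us = map length ?bs"
    by (rule nth_equalityI)
      (use fits_arity[OF ws] \<sigma> \<sigma>_less l in
        \<open>simp_all add: permute_list_nth length_block list_eq_iff_nth_eq\<close>)
  hence o': "offset ?us t = sum_list (map length (take t ?bs))" for t by (metis take_map)
  have o: "offset ws s = sum_list (take s ?js)" for s
    using fits_arity[OF ws] by (metis take_map)
  \<comment> \<open>Position \<open>i\<close> of block \<open>s\<close> comes from position \<open>i\<close> of the block with number \<open>inv \<sigma> s\<close> after permuting.\<close>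
  have *: "inv ?\<beta> (offset ws s + i) = offset ?us (inv \<sigma> s) + i"
    if "s < length xss" "i < length (xss ! s)" for s i
  proof -
    let ?t = "inv \<sigma> s"
    have t: "?t < length xss" "\<sigma> ?t = s"
      using that(1) permutes_in_image[OF permutes_inv[OF \<sigma>]] permutes_inverses[OF \<sigma>] by simp_all
    have "?bs ! ?t = blocks ?js ! s" using t \<sigma> by (simp add: permute_list_nth)
    hence "?\<beta> (offset ?us ?t + i) = offset ws s + i"
      unfolding block_perm_def o o' using t that
      by (subst list_perm_concat) (simp_all add: length_block nth_blocks)
    thus ?thesis using permutes_inverses(2)[OF \<beta>] by metis
  qed
  show ?thesis
    unfolding wact_def wgamma_def wsubst_wsubst
  proof (rule wsubst_cong)
    fix s assume "s \<in> set (wvars w)"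
    hence s: "s < length xss" using w by (simp add: Y_range)
    have "?us ! inv \<sigma> s = ws ! s"
      using s l \<sigma> permutes_in_image[OF permutes_inv[OF \<sigma>]] permutes_inverses[OF \<sigma>]
      by (simp add: permute_list_nth)
    moreover have "shift (offset ?us (inv \<sigma> s)) (ws ! s) = wsubst (\<lambda>i. WVar (inv ?\<beta> (offset ws s + i))) (ws ! s)"
      by (rule wsubst_cong) (use * s ws in \<open>auto simp: fits_def Y_range\<close>)
    ultimately show "wsubst (\<lambda>s. shift (offset ?us s) (?us ! s)) (WVar (inv \<sigma> s)) =
        wsubst (\<lambda>i. wsubst (\<lambda>i. WVar (inv ?\<beta> i)) (WVar (offset ws s + i))) (ws ! s)"
      by simp
  qed
qed

text \<open>As in \<open>wgamma_wact_outer\<close>, but now the blocks stay in place and each is permuted in itself.\<close>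

lemma wgamma_wact_inner:
  assumes w: "w \<in> Y (length xss)" and ws: "fits ws xss"
    and \<sigma>s: "length \<sigma>s = length xss" "\<And>s. s < length xss \<Longrightarrow> \<sigma>s ! s permutes {..<length (xss ! s)}"
  shows "wgamma w (map2 wact ws \<sigma>s) = wact (wgamma w ws) (sum_perm \<sigma>s (map length xss))"
proof -
  let ?js = "map length xss"
  let ?\<beta> = "sum_perm \<sigma>s ?js" and ?bs = "map2 permute_list \<sigma>s (blocks (map length xss))" and ?us = "map2 wact ws \<sigma>s"
  have l: "length ws = length xss" using ws by (simp add: fits_def)
  have \<beta>: "?\<beta> permutes {..<sum_list ?js}"
    by (rule sum_perm_permutes) (use \<sigma>s in simp_all)
  have "fits ?us xss" using ws \<sigma>s by (auto simp: fits_def intro!: Y_wact)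
  hence "map arity ?us = map arity ws" using fits_arity ws by metis
  hence o': "offset ?us s = offset ws s" for s by (metis take_map)
  have "map arity ws = map length ?bs"
    unfolding fits_arity[OF ws] by (rule nth_equalityI) (use \<sigma>s in \<open>simp_all add: length_block\<close>)
  hence o: "offset ws s = sum_list (map length (take s ?bs))" for s by (metis take_map)
  have o2: "offset ws s = sum_list (take s ?js)" for s
    using fits_arity[OF ws] by (metis take_map)
  have *: "inv ?\<beta> (offset ws s + i) = offset ws s + inv (\<sigma>s ! s) i"
    if "s < length xss" "i < length (xss ! s)" for s i
  proof -
    let ?i = "inv (\<sigma>s ! s) i"
    note p = \<sigma>s(2)[OF that(1)]
    have i: "?i < length (xss ! s)" "(\<sigma>s ! s) ?i = i"
      using that(2) permutes_in_image[OF permutes_inv[OF p]] permutes_inverses[OF p] by simp_all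
    have "?bs ! s ! ?i = blocks ?js ! s ! i"
      using that i p \<sigma>s(1) by (simp add: length_block permute_list_nth)
    hence "?\<beta> (offset ws s + ?i) = offset ws s + i"
      unfolding sum_perm_def using list_perm_concat[of s ?bs ?i] that i \<sigma>s(1) 
      by (simp add: o[symmetric] o2 length_block nth_blocks)
    thus ?thesis using permutes_inverses(2)[OF \<beta>] by metis
  qed
  show ?thesis
    unfolding wgamma_def wact_def[of "wsubst _ w"] wsubst_wsubst
  proof (rule wsubst_cong)
    fix s assume "s \<in> set (wvars w)"
    hence s: "s < length xss" using w by (simp add: Y_range)
    have "shift (offset ws s) (wact (ws ! s) (\<sigma>s ! s)) = wsubst (\<lambda>i. WVar (inv ?\<beta> (offset ws s + i))) (ws ! s)"
      unfolding wact_def wsubst_wsubst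
      by (rule wsubst_cong) (use * s ws in \<open>auto simp: fits_def Y_range\<close>)
    thus "shift (offset ?us s) (?us ! s) =
        wsubst (\<lambda>i. wsubst (\<lambda>i. WVar (inv ?\<beta> i)) (WVar (offset ws s + i))) (ws ! s)"
      using s l \<sigma>s(1) by (simp add: o')
  qed
qed

section \<open>The underlying multicategory\<close>

locale smc_choice = symmetric_monoidal_category +
  fixes \<kappa> :: "'a list \<Rightarrow> word"
  assumes choice: "word_choice C \<kappa>"
begin

abbreviation M :: "('a, 'a list \<times> 'b) multicat" where
  "M \<equiv> Umult C \<kappa>"

text \<open>The multimorphism presented by an arrow out of the value of \<open>w\<close> at \<open>xs\<close>; at \<open>w = \<kappa> xs\<close> it is the
  arrow itself, tagged with its source.\<close>

definition mor :: "word \<Rightarrow> 'a list \<Rightarrow> 'b \<Rightarrow> 'a list \<times> 'b" where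
  "mor w xs f = (xs, f \<cdot> can C (\<kappa> xs) w xs)"

lemma choice_Y [simp]: "set xs \<subseteq> Ob C \<Longrightarrow> \<kappa> xs \<in> Y (length xs)"
  using choice by (simp add: word_choice_def)

lemma MOb_M [simp]: "MOb M = Ob C"
  and MSrc_M [simp]: "MSrc M = fst"
  and MTgt_M [simp]: "MTgt M f = Cod C (snd f)"
  by (simp_all add: Umult_def case_prod_beta)

lemma MArr_iff:
  "f \<in> MArr M \<longleftrightarrow> set (fst f) \<subseteq> Ob C \<and> snd f \<in> Arr C \<and> Dom C (snd f) = evO C (\<kappa> (fst f)) (fst f)"
  by (cases f) (simp add: Umult_def)

lemma mor_self: "f \<in> MArr M \<Longrightarrow> mor (\<kappa> (fst f)) (fst f) (snd f) = f"
  by (cases f) (simp add: mor_def MArr_iff)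

lemma fst_mor [simp]: "fst (mor w xs f) = xs"
  by (simp add: mor_def)

lemma mor_in:
  "\<lbrakk>set xs \<subseteq> Ob C; w \<in> Y (length xs); f \<in> Arr C; Dom C f = evO C w xs\<rbrakk> \<Longrightarrow> mor w xs f \<in> MArr M"
  by (simp add: mor_def MArr_iff)

lemma Cod_mor [simp]:
  "\<lbrakk>set xs \<subseteq> Ob C; w \<in> Y (length xs); f \<in> Arr C; Dom C f = evO C w xs\<rbrakk> \<Longrightarrow>
    Cod C (snd (mor w xs f)) = Cod C f"
  by (simp add: mor_def)

lemma mor_change:
  "\<lbrakk>set xs \<subseteq> Ob C; u \<in> Y (length xs); v \<in> Y (length xs); f \<in> Arr C; Dom C f = evO C v xs\<rbrakk> \<Longrightarrow>
    mor u xs (f \<cdot> can C u v xs) = mor v xs f"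
  by (simp add: mor_def)

lemma MId_mor: "a \<in> Ob C \<Longrightarrow> MId M a = mor (WVar 0) [a] (idn C a)"
proof -
  assume a: "a \<in> Ob C"
  have "WVar 0 \<in> Y 1" by (auto simp: Y_def)
  thus ?thesis using a choice_Y[of "[a]"] by (simp add: Umult_def mor_def)
qed

text \<open>Naturality moves the canonical isomorphism between \<open>\<kappa> ys\<close> and \<open>w\<close> past the arrows \<open>hs\<close>.  After that all
  canonical isomorphisms stand next to each other over the concatenated tuple, and coherence composes
  them.\<close>

lemma mor_MComp:
  assumes w: "w \<in> Y (length xss)" and g: "g \<in> Arr C" "Dom C g = evO C w (map (Cod C) hs)"
    and ws: "fits ws xss" and xss: "set (concat xss) \<subseteq> Ob C"
    and hs: "length hs = length xss" "\<And>s. s < length xss \<Longrightarrow> hs ! s \<in> Arr C"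
      "\<And>s. s < length xss \<Longrightarrow> Dom C (hs ! s) = evO C (ws ! s) (xss ! s)"
    and fs: "length fs = length xss" "\<And>s. s < length xss \<Longrightarrow> fs ! s = mor (ws ! s) (xss ! s) (hs ! s)"
  shows "MComp M (mor w (map (Cod C) hs) g) fs = mor (wgamma w ws) (concat xss) (g \<cdot> evA C w hs)"
proof -
  let ?ys = "map (Cod C) hs" and ?X = "concat xss" and ?ks = "map \<kappa> xss"
  let ?K = "\<kappa> ?ys"
  let ?cs = "map2 (\<lambda>(u, v). can C u v) (zip ?ks ws) xss"
  have l: "length ws = length xss" using ws by (simp add: fits_def)
  have hsA: "set hs \<subseteq> Arr C" using hs by (auto simp: in_set_conv_nth)
  hence ys: "set ?ys \<subseteq> Ob C" by auto
  have K: "?K \<in> Y (length xss)" using choice_Y[OF ys] hs(1) by simp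
  have xs: "set (xss ! s) \<subseteq> Ob C" if "s < length xss" for s using xss that by fastforce
  have ks: "fits ?ks xss" using xs by (simp add: fits_def)
  have wsY: "ws ! s \<in> Y (length (xss ! s))" if "s < length xss" for s using ws that by (simp add: fits_def)
  have fst: "map fst fs = xss" by (rule nth_equalityI) (use fs in simp_all)
  have snd: "map snd fs = map2 (cmp C) hs ?cs"
    by (rule nth_equalityI) (use fs hs l in \<open>simp_all add: mor_def\<close>)
  have csA: "set ?cs \<subseteq> Arr C"
    using xs wsY l by (auto simp: in_set_conv_nth)
  have dom: "map (Dom C) hs = map2 (evO C) ws xss"
    by (rule nth_equalityI) (use hs l in simp_all)
  have cod: "map (Cod C) ?cs = map (Dom C) hs"
    by (rule nth_equalityI) (use hs l xs wsY in simp_all)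
  have domc: "map (Dom C) ?cs = map2 (evO C) ?ks xss"
    by (rule nth_equalityI) (use hs l xs wsY in simp_all)
  have X: "\<kappa> ?X \<in> Y (length ?X)" using xss by simp
  have G: "wgamma ?K ?ks \<in> Y (length ?X)" "wgamma ?K ws \<in> Y (length ?X)" "wgamma w ws \<in> Y (length ?X)"
    using Y_wgamma K ks ws w by auto
  \<comment> \<open>The canonical isomorphisms inside the arguments are collected over the concatenated tuple.\<close>
  have inner: "evA C ?K (map snd fs) = evA C ?K hs \<cdot> can C (wgamma ?K ?ks) (wgamma ?K ws) ?X"
    unfolding snd using evA_cmp[OF csA hsA cod, of ?K] can_wgamma_inner[OF xss ks ws K] K hs(1) by simp
  \<comment> \<open>The canonical isomorphism of the outer word moves past \<open>hs\<close> and over to the concatenated tuple.\<close>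
  have outer: "can C ?K w ?ys \<cdot> evA C ?K hs = evA C w hs \<cdot> can C (wgamma ?K ws) (wgamma w ws) ?X"
    using can_natural[OF hsA, of ?K w] can_wgamma_outer[OF xss ws K w] K w hs(1) by (simp add: dom)
  have e: "evO C (wgamma ?K ws) ?X = evO C ?K (map (Dom C) hs)" "evO C (wgamma w ws) ?X = evO C w (map (Dom C) hs)"
    "evO C (wgamma ?K ?ks) ?X = evO C ?K (map (Dom C) ?cs)"
    using evO_wgamma[OF ws K] evO_wgamma[OF ws w] evO_wgamma[OF ks K] by (simp_all only: dom domc)
  have A: "evA C ?K hs \<in> Arr C" "Dom C (evA C ?K hs) = evO C ?K (map (Dom C) hs)" "Cod C (evA C ?K hs) = evO C ?K ?ys"
    "evA C w hs \<in> Arr C" "Dom C (evA C w hs) = evO C w (map (Dom C) hs)" "Cod C (evA C w hs) = evO C w ?ys"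
    using hsA K w hs(1) by simp_all
  have c: "can C ?K w ?ys \<in> Arr C" "Dom C (can C ?K w ?ys) = evO C ?K ?ys" "Cod C (can C ?K w ?ys) = evO C w ?ys"
    using can_simps[OF ys, of ?K w] K w hs(1) by simp_all
  let ?c1 = "can C (wgamma ?K ?ks) (wgamma ?K ws) ?X" and ?c2 = "can C (\<kappa> ?X) (wgamma ?K ?ks) ?X"
  have "snd (MComp M (mor w ?ys g) fs) =
     g \<cdot> can C ?K w ?ys \<cdot> evA C ?K (map snd fs) \<cdot> ?c2"
    by (simp add: Umult_def mor_def Let_def fst del: map_map)
  also have "\<dots> = g \<cdot> ((can C ?K w ?ys \<cdot> evA C ?K hs) \<cdot> (?c1 \<cdot> ?c2))"
    unfolding inner using A c g xss X G e by simp
  also have "\<dots> = (g \<cdot> evA C w hs) \<cdot> can C (\<kappa> ?X) (wgamma w ws) ?X"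
    unfolding outer using A c g xss X G e by simp
  also have "\<dots> = snd (mor (wgamma w ws) ?X (g \<cdot> evA C w hs))" by (simp add: mor_def)
  finally have 2: "snd (MComp M (mor w ?ys g) fs) = snd (mor (wgamma w ws) ?X (g \<cdot> evA C w hs))" .
  have 1: "fst (MComp M (mor w ?ys g) fs) = fst (mor (wgamma w ws) ?X (g \<cdot> evA C w hs))"
    by (simp add: Umult_def mor_def Let_def fst)
  show ?thesis using 1 2 by (rule prod_eqI)
qed

lemma mor_MAct:
  assumes xs: "set xs \<subseteq> Ob C" and w: "w \<in> Y (length xs)" and f: "f \<in> Arr C" "Dom C f = evO C w xs"
    and \<sigma>: "\<sigma> permutes {..<length xs}"
  shows "MAct M \<sigma> (mor w xs f) = mor (wact w \<sigma>) (permute_list \<sigma> xs) f"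
proof -
  let ?xs = "permute_list \<sigma> xs"
  have xs': "set ?xs \<subseteq> Ob C" using xs \<sigma> by simp
  have Y: "\<kappa> xs \<in> Y (length xs)" "\<kappa> ?xs \<in> Y (length ?xs)" "wact w \<sigma> \<in> Y (length ?xs)" "wact (\<kappa> xs) \<sigma> \<in> Y (length ?xs)"
    using choice_Y[OF xs] choice_Y[OF xs'] Y_wact w \<sigma> by auto
  have e: "evO C (wact w \<sigma>) ?xs = evO C w xs" "evO C (wact (\<kappa> xs) \<sigma>) ?xs = evO C (\<kappa> xs) xs"
    using evO_wact w \<sigma> Y(1) by auto
  have "can C (\<kappa> xs) w xs = can C (wact (\<kappa> xs) \<sigma>) (wact w \<sigma>) ?xs"
    by (rule can_wact[OF xs Y(1) w \<sigma>])
  thus ?thesis using f xs' Y e by (simp add: Umult_def mor_def Let_def)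
qed

lemma composableD:
  assumes "composable M g fs"
  shows "g \<in> MArr M" "set fs \<subseteq> MArr M" "fst g = map (Cod C) (map snd fs)" "length (fst g) = length fs"
    "\<And>s. s < length fs \<Longrightarrow> fs ! s \<in> MArr M" "set (concat (map fst fs)) \<subseteq> Ob C"
    "fits (map \<kappa> (map fst fs)) (map fst fs)" "\<kappa> (fst g) \<in> Y (length fs)" "set (map snd fs) \<subseteq> Arr C"
proof -
  show *: "g \<in> MArr M" "set fs \<subseteq> MArr M" "fst g = map (Cod C) (map snd fs)"
    using assms by (auto simp: composable_def)
  show l: "length (fst g) = length fs" using *(3) by simp
  show **: "\<And>s. s < length fs \<Longrightarrow> fs ! s \<in> MArr M" using *(2) by auto
  have fs: "\<forall>f\<in>set fs. set (fst f) \<subseteq> Ob C \<and> snd f \<in> Arr C" using *(2) MArr_iff by blast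
  thus "set (concat (map fst fs)) \<subseteq> Ob C" by auto
  show "fits (map \<kappa> (map fst fs)) (map fst fs)" using ** by (auto simp: fits_def MArr_iff)
  show "\<kappa> (fst g) \<in> Y (length fs)" using choice_Y[of "fst g"] *(1) l by (auto simp: MArr_iff)
  show "set (map snd fs) \<subseteq> Arr C" using fs by auto
qed

lemma MComp_eq:
  "MComp M g fs = mor (wgamma (\<kappa> (fst g)) (map \<kappa> (map fst fs))) (concat (map fst fs))
     (snd g \<cdot> evA C (\<kappa> (fst g)) (map snd fs))"
  by (simp add: Umult_def case_prod_beta mor_def Let_def)

lemma MComp_arr:
  assumes "composable M g fs"
  shows "snd g \<cdot> evA C (\<kappa> (fst g)) (map snd fs) \<in> Arr C"
    "Dom C (snd g \<cdot> evA C (\<kappa> (fst g)) (map snd fs)) =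
      evO C (wgamma (\<kappa> (fst g)) (map \<kappa> (map fst fs))) (concat (map fst fs))"
    "Cod C (snd g \<cdot> evA C (\<kappa> (fst g)) (map snd fs)) = Cod C (snd g)"
    "wgamma (\<kappa> (fst g)) (map \<kappa> (map fst fs)) \<in> Y (length (concat (map fst fs)))"
proof -
  note c = composableD[OF assms]
  have g: "snd g \<in> Arr C" "Dom C (snd g) = evO C (\<kappa> (fst g)) (map (Cod C) (map snd fs))"
    using c(1,3) by (simp_all add: MArr_iff)
  have "map (Dom C) (map snd fs) = map2 (evO C) (map \<kappa> (map fst fs)) (map fst fs)"
    by (rule nth_equalityI) (use c(5) in \<open>simp_all add: MArr_iff\<close>)
  hence e: "evO C (\<kappa> (fst g)) (map (Dom C) (map snd fs)) =
      evO C (wgamma (\<kappa> (fst g)) (map \<kappa> (map fst fs))) (concat (map fst fs))"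
    using evO_wgamma[OF c(7), of "\<kappa> (fst g)"] c(8) by simp
  have a: "evA C (\<kappa> (fst g)) (map snd fs) \<in> Arr C"
    "Dom C (evA C (\<kappa> (fst g)) (map snd fs)) = evO C (\<kappa> (fst g)) (map (Dom C) (map snd fs))"
    "Cod C (evA C (\<kappa> (fst g)) (map snd fs)) = evO C (\<kappa> (fst g)) (map (Cod C) (map snd fs))"
    using evA_simps[OF c(9), of "\<kappa> (fst g)"] c(8) by simp_all
  show "snd g \<cdot> evA C (\<kappa> (fst g)) (map snd fs) \<in> Arr C"
    "Dom C (snd g \<cdot> evA C (\<kappa> (fst g)) (map snd fs)) =
      evO C (wgamma (\<kappa> (fst g)) (map \<kappa> (map fst fs))) (concat (map fst fs))"
    "Cod C (snd g \<cdot> evA C (\<kappa> (fst g)) (map snd fs)) = Cod C (snd g)"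
    using a g e by simp_all
  show "wgamma (\<kappa> (fst g)) (map \<kappa> (map fst fs)) \<in> Y (length (concat (map fst fs)))"
    by (rule Y_wgamma[OF _ c(7)]) (use c(8) in simp)
qed

lemma MComp_in:
  assumes "composable M g fs"
  shows "MComp M g fs \<in> MArr M" "fst (MComp M g fs) = concat (map fst fs)"
    "Cod C (snd (MComp M g fs)) = Cod C (snd g)"
  unfolding MComp_eq[of g fs]
  using MComp_arr[OF assms] composableD(6)[OF assms] by (simp_all add: mor_in)

lemma MAct_eq:
  assumes "f \<in> MArr M" "\<sigma> permutes {..<length (fst f)}"
  shows "MAct M \<sigma> f = mor (wact (\<kappa> (fst f)) \<sigma>) (permute_list \<sigma> (fst f)) (snd f)"
  using mor_MAct[of "fst f" "\<kappa> (fst f)" "snd f" \<sigma>] assms mor_self[OF assms(1)] by (simp add: MArr_iff)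

lemma MAct_in:
  assumes "f \<in> MArr M" "\<sigma> permutes {..<length (fst f)}"
  shows "MAct M \<sigma> f \<in> MArr M" "fst (MAct M \<sigma> f) = permute_list \<sigma> (fst f)"
    "Cod C (snd (MAct M \<sigma> f)) = Cod C (snd f)"
proof -
  have f: "set (fst f) \<subseteq> Ob C" "\<kappa> (fst f) \<in> Y (length (fst f))" "snd f \<in> Arr C"
    "Dom C (snd f) = evO C (\<kappa> (fst f)) (fst f)"
    using assms(1) by (simp_all add: MArr_iff)
  have p: "set (permute_list \<sigma> (fst f)) \<subseteq> Ob C"
    "wact (\<kappa> (fst f)) \<sigma> \<in> Y (length (permute_list \<sigma> (fst f)))"
    "Dom C (snd f) = evO C (wact (\<kappa> (fst f)) \<sigma>) (permute_list \<sigma> (fst f))"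
    using f assms(2) by (simp_all add: Y_wact evO_wact)
  show "MAct M \<sigma> f \<in> MArr M" "fst (MAct M \<sigma> f) = permute_list \<sigma> (fst f)"
    "Cod C (snd (MAct M \<sigma> f)) = Cod C (snd f)"
    unfolding MAct_eq[OF assms] using mor_in[OF p(1,2) f(3) p(3)] Cod_mor[OF p(1,2) f(3) p(3)] by simp_all
qed

text \<open>Both sides are presented by the same arrow, at the two iterated substitutions that
  \<open>wgamma_assoc\<close> identifies.\<close>

lemma MComp_assoc:
  assumes h: "composable M h gs" and gs: "list_all2 (composable M) gs fss"
  shows "MComp M (MComp M h gs) (concat fss) = MComp M h (map2 (MComp M) gs fss)"
proof -
  note H = composableD[OF h] and Ha = MComp_arr[OF h]
  have lf: "length gs = length fss" using gs by (rule list_all2_lengthD)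
  have G: "composable M (gs ! s) (fss ! s)" if "s < length gs" for s
    using gs that by (simp add: list_all2_conv_all_nth)
  let ?K = "\<kappa> (fst h)" and ?yss = "map fst gs" and ?xsss = "map (map fst) fss"
  let ?ks = "map \<kappa> ?yss" and ?kss = "map (map \<kappa>) ?xsss"
  let ?g0s = "map snd gs" and ?f0ss = "map (map snd) fss"
  let ?W = "wgamma ?K ?ks"
  have lfs: "length (fss ! s) = length (fst (gs ! s))" if "s < length gs" for s
    using composableD(4)[OF G[OF that]] by simp
  have fits_f: "fits ?ks ?f0ss" "fits ?ks ?xsss"
    using H(7) lf lfs by (simp_all add: fits_def)
  have fits_x: "list_all2 fits ?kss ?xsss"
    using composableD(7)[OF G] lf by (simp add: list_all2_conv_all_nth)
  have lW: "length (concat ?yss) = length (concat fss)"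
    using lf lfs by (simp add: length_concat) (intro arg_cong[of _ _ sum_list] nth_equalityI, simp_all)
  have src: "concat ?yss = map (Cod C) (concat ?f0ss)"
  proof -
    have "?yss = map (map (Cod C)) ?f0ss"
      by (rule nth_equalityI) (use lf composableD(3)[OF G] in simp_all)
    thus ?thesis by (simp add: map_concat)
  qed
  have fmem: "f \<in> MArr M" if fin: "f \<in> set (concat fss)" for f
  proof -
    obtain fs where "fs \<in> set fss" "f \<in> set fs" using fin by auto
    then obtain s where "s < length fss" "f \<in> set (fss ! s)" by (metis in_set_conv_nth)
    thus ?thesis using composableD(2)[OF G, of s] lf by auto
  qed
  have fnth: "concat fss ! s \<in> MArr M" if "s < length (concat fss)" for s
    using fmem nth_mem[OF that] by blast
  have xin: "set (concat (concat ?xsss)) \<subseteq> Ob C"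
    using fmem by (auto simp: MArr_iff)
  have "MComp M h gs = mor ?W (map (Cod C) (concat ?f0ss)) (snd h \<cdot> evA C ?K ?g0s)"
    unfolding MComp_eq[of h gs] src ..
  also have "MComp M \<dots> (concat fss) = mor (wgamma ?W (concat ?kss)) (concat (concat ?xsss))
     ((snd h \<cdot> evA C ?K ?g0s) \<cdot> evA C ?W (concat ?f0ss))"
  proof (rule mor_MComp)
    show "?W \<in> Y (length (concat ?xsss))" using Ha(4) lW by (simp add: map_concat[symmetric])
    show "fits (concat ?kss) (concat ?xsss)" by (rule fits_concat[OF fits_x])
    show "snd h \<cdot> evA C ?K ?g0s \<in> Arr C"
      "Dom C (snd h \<cdot> evA C ?K ?g0s) = evO C ?W (map (Cod C) (concat ?f0ss))"
      using Ha(1,2) by (simp_all only: src)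
    show "set (concat (concat ?xsss)) \<subseteq> Ob C" by (rule xin)
    show "length (concat ?f0ss) = length (concat ?xsss)" by (simp add: map_concat[symmetric])
    show "length (concat fss) = length (concat ?xsss)" by (simp add: map_concat[symmetric])
    fix s assume "s < length (concat ?xsss)"
    hence s: "s < length (concat fss)" by (simp add: map_concat[symmetric])
    show "concat ?f0ss ! s \<in> Arr C" "Dom C (concat ?f0ss ! s) = evO C (concat ?kss ! s) (concat ?xsss ! s)"
      "concat fss ! s = mor (concat ?kss ! s) (concat ?xsss ! s) (concat ?f0ss ! s)"
      using fnth[OF s] s by (simp_all add: map_concat[symmetric] MArr_iff mor_self)
  qed
  finally have L: "MComp M (MComp M h gs) (concat fss) =
    mor (wgamma ?W (concat ?kss)) (concat (concat ?xsss))
     ((snd h \<cdot> evA C ?K ?g0s) \<cdot> evA C ?W (concat ?f0ss))" .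
  let ?es = "map2 (evA C) ?ks ?f0ss"
  let ?hs = "map2 (cmp C) ?g0s ?es"
  have hs_nth: "?hs ! s = snd (gs ! s) \<cdot> evA C (\<kappa> (fst (gs ! s))) (map snd (fss ! s))" if "s < length gs" for s
    using that lf by simp
  have lhs: "length ?hs = length gs" using lf by simp
  have codhs: "map (Cod C) ?hs = fst h"
    unfolding H(3) by (rule nth_equalityI) (use MComp_arr(3)[OF G] lhs hs_nth in simp_all)
  have "MComp M (mor ?K (map (Cod C) ?hs) (snd h)) (map2 (MComp M) gs fss) =
    mor (wgamma ?K (map2 wgamma ?ks ?kss)) (concat (map concat ?xsss)) (snd h \<cdot> evA C ?K ?hs)"
  proof (rule mor_MComp)
    show "?K \<in> Y (length (map concat ?xsss))" using H(8) lf by simp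
    show "snd h \<in> Arr C" "Dom C (snd h) = evO C ?K (map (Cod C) ?hs)"
      using H(1) unfolding codhs by (simp_all add: MArr_iff)
    show "fits (map2 wgamma ?ks ?kss) (map concat ?xsss)"
      by (rule fits_map2_wgamma[OF fits_f(2) fits_x])
    show "set (concat (map concat ?xsss)) \<subseteq> Ob C"
      unfolding concat_map_concat by (rule xin)
    show "length ?hs = length (map concat ?xsss)" "length (map2 (MComp M) gs fss) = length (map concat ?xsss)"
      using lf by simp_all
    fix s assume "s < length (map concat ?xsss)"
    hence s: "s < length gs" using lf by simp
    show "?hs ! s \<in> Arr C" "Dom C (?hs ! s) = evO C (map2 wgamma ?ks ?kss ! s) (map concat ?xsss ! s)"
      "map2 (MComp M) gs fss ! s = mor (map2 wgamma ?ks ?kss ! s) (map concat ?xsss ! s) (?hs ! s)"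
      using MComp_arr[OF G[OF s]] MComp_eq[of "gs ! s" "fss ! s"] s lf by simp_all
  qed
  hence R: "MComp M h (map2 (MComp M) gs fss) =
    mor (wgamma ?K (map2 wgamma ?ks ?kss)) (concat (map concat ?xsss)) (snd h \<cdot> evA C ?K ?hs)"
    unfolding codhs mor_self[OF H(1)] .
  have W: "wgamma ?W (concat ?kss) = wgamma ?K (map2 wgamma ?ks ?kss)"
    by (rule wgamma_assoc[OF _ fits_f(2) fits_x]) (use H(8) in simp)
  have e: "evA C ?W (concat ?f0ss) = evA C ?K ?es"
    by (rule evA_wgamma[OF fits_f(1)]) (use H(8) lf in simp)
  have es: "evA C (\<kappa> (fst (gs ! s))) (map snd (fss ! s)) \<in> Arr C"
    "Cod C (evA C (\<kappa> (fst (gs ! s))) (map snd (fss ! s))) = Dom C (snd (gs ! s))" if "s < length gs" for s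
    using composableD[OF G[OF that]] H(5)[OF that] by (simp_all add: MArr_iff)
  have esA: "set ?es \<subseteq> Arr C" "map (Cod C) ?es = map (Dom C) ?g0s"
    using es lf by (auto simp: in_set_conv_nth intro!: nth_equalityI)
  have c: "evA C ?K ?g0s \<cdot> evA C ?K ?es = evA C ?K ?hs"
    by (rule evA_cmp[OF esA(1) H(9) esA(2)]) (use H(8) in simp)
  have "(snd h \<cdot> evA C ?K ?g0s) \<cdot> evA C ?W (concat ?f0ss) = snd h \<cdot> evA C ?K ?hs"
    unfolding e c[symmetric] using esA H(1,3,8,9) lf by (intro cmp_assoc') (simp_all add: MArr_iff)
  thus ?thesis unfolding L R W concat_map_concat by simp
qed

lemma MComp_equivariant_outer:
  assumes gf: "composable M g fs" and \<sigma>: "\<sigma> permutes {..<length fs}"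
  shows "MComp M (MAct M \<sigma> g) (permute_list \<sigma> fs) =
    MAct M (block_perm \<sigma> (map (\<lambda>f. length (MSrc M f)) fs)) (MComp M g fs)"
proof -
  note c = composableD[OF gf] and a = MComp_arr[OF gf]
  let ?K = "\<kappa> (fst g)" and ?xss = "map fst fs" and ?hs = "map snd fs"
  let ?ks = "map \<kappa> ?xss" and ?\<beta> = "block_perm \<sigma> (map length (map fst fs))"
  have \<sigma>': "\<sigma> permutes {..<length ?xss}" "\<sigma> permutes {..<length ?hs}" "\<sigma> permutes {..<length ?ks}" using \<sigma> by simp_all
  have \<beta>: "?\<beta> permutes {..<length (concat ?xss)}"
    using block_perm_permutes[of \<sigma> "map length ?xss"] \<sigma> by (simp add: length_concat)
  have "MAct M \<sigma> g = mor (wact ?K \<sigma>) (map (Cod C) (permute_list \<sigma> ?hs)) (snd g)"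
    using MAct_eq[OF c(1), of \<sigma>] \<sigma> c(4)
    by (simp add: c(3) permute_list_map[OF \<sigma>'(2)] del: map_map)
  also have "MComp M \<dots> (permute_list \<sigma> fs) =
     mor (wgamma (wact ?K \<sigma>) (permute_list \<sigma> ?ks)) (concat (permute_list \<sigma> ?xss))
       (snd g \<cdot> evA C (wact ?K \<sigma>) (permute_list \<sigma> ?hs))"
  proof (rule mor_MComp)
    show "wact ?K \<sigma> \<in> Y (length (permute_list \<sigma> ?xss))" using Y_wact[OF c(8) \<sigma>] by simp
    show "fits (permute_list \<sigma> ?ks) (permute_list \<sigma> ?xss)" by (rule fits_permute_list[OF c(7) \<sigma>'(1)])
    have "evO C (wact ?K \<sigma>) (permute_list \<sigma> (map (Cod C) ?hs)) = evO C ?K (map (Cod C) ?hs)"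
      by (rule evO_wact) (use c(8) \<sigma> in simp_all)
    thus "snd g \<in> Arr C" "Dom C (snd g) = evO C (wact ?K \<sigma>) (map (Cod C) (permute_list \<sigma> ?hs))"
      using c(1,3) permute_list_map[OF \<sigma>'(2), of "Cod C"] by (simp_all add: MArr_iff)
    show "set (concat (permute_list \<sigma> ?xss)) \<subseteq> Ob C" using c(6) \<sigma> by simp
    fix s assume "s < length (permute_list \<sigma> ?xss)"
    hence s: "s < length fs" "\<sigma> s < length fs" using permutes_in_image[OF \<sigma>] by simp_all
    show "permute_list \<sigma> ?hs ! s \<in> Arr C"
      "Dom C (permute_list \<sigma> ?hs ! s) = evO C (permute_list \<sigma> ?ks ! s) (permute_list \<sigma> ?xss ! s)"
      "permute_list \<sigma> fs ! s = mor (permute_list \<sigma> ?ks ! s) (permute_list \<sigma> ?xss ! s) (permute_list \<sigma> ?hs ! s)"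
      using c(5)[OF s(2)] s \<sigma> by (simp_all add: permute_list_nth MArr_iff mor_self)
  qed simp_all
  also have "evA C (wact ?K \<sigma>) (permute_list \<sigma> ?hs) = evA C ?K ?hs"
    by (rule evA_wact) (use c(8) \<sigma> in simp_all)
  also have "wgamma (wact ?K \<sigma>) (permute_list \<sigma> ?ks) = wact (wgamma ?K ?ks) ?\<beta>"
    by (rule wgamma_wact_outer[OF _ c(7) \<sigma>'(1)]) (use c(8) in simp)
  also have "concat (permute_list \<sigma> ?xss) = permute_list ?\<beta> (concat ?xss)"
    by (rule permute_list_block_perm[OF \<sigma>'(1), symmetric])
  also have "mor (wact (wgamma ?K ?ks) ?\<beta>) (permute_list ?\<beta> (concat ?xss)) (snd g \<cdot> evA C ?K ?hs) =
      MAct M ?\<beta> (MComp M g fs)"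
    unfolding MComp_eq[of g fs] by (rule mor_MAct[symmetric]) (use c(6) a \<beta> in simp_all)
  finally show ?thesis by (simp add: o_def)
qed

lemma MComp_equivariant_inner:
  assumes gf: "composable M g fs" and \<sigma>s: "list_all2 (\<lambda>\<sigma> f. \<sigma> permutes {..<length (MSrc M f)}) \<sigma>s fs"
  shows "MComp M g (map2 (MAct M) \<sigma>s fs) =
    MAct M (sum_perm \<sigma>s (map (\<lambda>f. length (MSrc M f)) fs)) (MComp M g fs)"
proof -
  note c = composableD[OF gf] and a = MComp_arr[OF gf]
  let ?K = "\<kappa> (fst g)" and ?xss = "map fst fs" and ?hs = "map snd fs"
  let ?ks = "map \<kappa> ?xss" and ?\<beta> = "sum_perm \<sigma>s (map length (map fst fs))"
  have l: "length \<sigma>s = length fs" using \<sigma>s by (rule list_all2_lengthD)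
  have \<sigma>: "\<sigma>s ! s permutes {..<length (fst (fs ! s))}" if "s < length fs" for s
    using \<sigma>s that l by (simp add: list_all2_conv_all_nth)
  have \<beta>: "?\<beta> permutes {..<length (concat ?xss)}"
    using sum_perm_permutes[of \<sigma>s "map length ?xss"] \<sigma> l by (simp add: length_concat)
  have k: "\<kappa> (fst (fs ! s)) \<in> Y (length (fst (fs ! s)))" if "s < length fs" for s
    using c(5)[OF that] by (simp add: MArr_iff)
  have "MComp M (mor ?K (map (Cod C) ?hs) (snd g)) (map2 (MAct M) \<sigma>s fs) =
     mor (wgamma ?K (map2 wact ?ks \<sigma>s)) (concat (map2 permute_list \<sigma>s ?xss)) (snd g \<cdot> evA C ?K ?hs)"
  proof (rule mor_MComp)
    show "?K \<in> Y (length (map2 permute_list \<sigma>s ?xss))" using c(8) l by simp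
    show "snd g \<in> Arr C" "Dom C (snd g) = evO C ?K (map (Cod C) ?hs)"
      using c(1,3) by (simp_all add: MArr_iff)
    show "fits (map2 wact ?ks \<sigma>s) (map2 permute_list \<sigma>s ?xss)"
      using l k \<sigma> by (simp add: fits_def Y_wact)
    show "set (concat (map2 permute_list \<sigma>s ?xss)) \<subseteq> Ob C"
      using c(6) unfolding permute_list_sum_perm[of \<sigma>s ?xss, symmetric] 
      using permute_list_sum_perm[of \<sigma>s ?xss] \<sigma> l \<beta>
      by (metis length_map nth_map set_permute_list)
    show "length ?hs = length (map2 permute_list \<sigma>s ?xss)"
      "length (map2 (MAct M) \<sigma>s fs) = length (map2 permute_list \<sigma>s ?xss)" using l by simp_all
    fix s assume "s < length (map2 permute_list \<sigma>s ?xss)"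
    hence s: "s < length fs" using l by simp
    show "?hs ! s \<in> Arr C"
      "Dom C (?hs ! s) = evO C (map2 wact ?ks \<sigma>s ! s) (map2 permute_list \<sigma>s ?xss ! s)"
      "map2 (MAct M) \<sigma>s fs ! s = mor (map2 wact ?ks \<sigma>s ! s) (map2 permute_list \<sigma>s ?xss ! s) (?hs ! s)"
      using c(5)[OF s] s l k[OF s] \<sigma>[OF s] by (simp_all add: MArr_iff evO_wact MAct_eq)
  qed
  also have "mor ?K (map (Cod C) ?hs) (snd g) = g"
    using mor_self[OF c(1)] by (simp add: c(3))
  also have "wgamma ?K (map2 wact ?ks \<sigma>s) = wact (wgamma ?K ?ks) ?\<beta>"
    by (rule wgamma_wact_inner[OF _ c(7)]) (use c(8) l \<sigma> in simp_all)
  also have "concat (map2 permute_list \<sigma>s ?xss) = permute_list ?\<beta> (concat ?xss)"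
    by (rule permute_list_sum_perm[symmetric]) (use l \<sigma> in simp_all)
  also have "mor (wact (wgamma ?K ?ks) ?\<beta>) (permute_list ?\<beta> (concat ?xss)) (snd g \<cdot> evA C ?K ?hs) =
      MAct M ?\<beta> (MComp M g fs)"
    unfolding MComp_eq[of g fs] by (rule mor_MAct[symmetric]) (use c(6) a \<beta> in simp_all)
  finally show ?thesis by (simp add: o_def)
qed

lemma MComp_unit_left:
  assumes "f \<in> MArr M"
  shows "MComp M (MId M (MTgt M f)) [f] = f"
proof -
  have f: "set (fst f) \<subseteq> Ob C" "snd f \<in> Arr C" "Dom C (snd f) = evO C (\<kappa> (fst f)) (fst f)"
    using assms by (simp_all add: MArr_iff)
  have "MComp M (mor (WVar 0) (map (Cod C) [snd f]) (idn C (Cod C (snd f)))) [f] =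
    mor (wgamma (WVar 0) [\<kappa> (fst f)]) (concat [fst f]) (idn C (Cod C (snd f)) \<cdot> evA C (WVar 0) [snd f])"
    by (rule mor_MComp) (use f mor_self[OF assms] in \<open>simp_all add: Y_var fits_def\<close>)
  thus ?thesis using f by (simp add: MId_mor wgamma_var mor_self[OF assms])
qed

lemma MComp_unit_right:
  assumes "f \<in> MArr M"
  shows "MComp M f (map (MId M) (MSrc M f)) = f"
proof -
  have f: "set (fst f) \<subseteq> Ob C" "snd f \<in> Arr C" "Dom C (snd f) = evO C (\<kappa> (fst f)) (fst f)"
    using assms by (simp_all add: MArr_iff)
  let ?xs = "fst f"
  have n: "?xs ! s \<in> Ob C" if "s < length ?xs" for s using f(1) that by auto
  have m: "map (Cod C) (map (idn C) ?xs) = ?xs"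
    by (rule nth_equalityI) (use n in simp_all)
  have "MComp M (mor (\<kappa> ?xs) (map (Cod C) (map (idn C) ?xs)) (snd f)) (map (MId M) ?xs) =
    mor (wgamma (\<kappa> ?xs) (map (\<lambda>_. WVar 0) ?xs)) (concat (map (\<lambda>x. [x]) ?xs))
      (snd f \<cdot> evA C (\<kappa> ?xs) (map (idn C) ?xs))"
  proof (rule mor_MComp)
    show "Dom C (snd f) = evO C (\<kappa> ?xs) (map (Cod C) (map (idn C) ?xs))" using f(3) by (simp only: m)
  qed (use f n in \<open>simp_all add: Y_var fits_def MId_mor\<close>)
  thus ?thesis
    unfolding m using f by (simp add: wgamma_vars evA_idn mor_self[OF assms])
qed

lemma multicategory_Umult: "multicategory M"
proof
  show "set (MSrc M f) \<subseteq> MOb M" if "f \<in> MArr M" for f using that by (simp add: MArr_iff)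
  show "MTgt M f \<in> MOb M" if "f \<in> MArr M" for f using that by (simp add: MArr_iff)
  show "MId M a \<in> MArr M \<and> MSrc M (MId M a) = [a] \<and> MTgt M (MId M a) = a" if "a \<in> MOb M" for a
    using that by (simp add: MId_mor Y_var mor_in)
  show "MComp M g fs \<in> MArr M \<and> MSrc M (MComp M g fs) = concat (map (MSrc M) fs) \<and>
      MTgt M (MComp M g fs) = MTgt M g" if "composable M g fs" for g fs
    using MComp_in[OF that] by simp
  show "MAct M \<sigma> f \<in> MArr M \<and> MSrc M (MAct M \<sigma> f) = permute_list \<sigma> (MSrc M f) \<and>
      MTgt M (MAct M \<sigma> f) = MTgt M f" if "f \<in> MArr M" "\<sigma> permutes {..<length (MSrc M f)}" for f \<sigma>
    using MAct_in[of f \<sigma>] that by simp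
  show "MAct M id f = f" if "f \<in> MArr M" for f
    using MAct_eq[OF that, of id] mor_self[OF that] by (simp add: wact_id permutes_id)
  show "MAct M \<tau> (MAct M \<sigma> f) = MAct M (\<sigma> \<circ> \<tau>) f"
    if f: "f \<in> MArr M" and "\<sigma> permutes {..<length (MSrc M f)}" "\<tau> permutes {..<length (MSrc M f)}" for f \<sigma> \<tau>
  proof -
    have p: "\<sigma> permutes {..<length (fst f)}" "\<tau> permutes {..<length (fst f)}" using that by simp_all
    have "MAct M \<tau> (MAct M \<sigma> f) =
      mor (wact (wact (\<kappa> (fst f)) \<sigma>) \<tau>) (permute_list \<tau> (permute_list \<sigma> (fst f))) (snd f)"
      unfolding MAct_eq[OF f p(1)]
      by (rule mor_MAct) (use f p in \<open>simp_all add: MArr_iff Y_wact evO_wact\<close>)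
    also have "\<dots> = MAct M (\<sigma> \<circ> \<tau>) f"
      using p MAct_eq[OF f permutes_compose[OF p(2,1)]]
      by (simp add: wact_wact[OF p] permute_list_compose)
    finally show ?thesis .
  qed
qed (fact MComp_unit_left MComp_unit_right MComp_assoc MComp_equivariant_outer MComp_equivariant_inner)+

end

section \<open>Lax symmetric monoidal functors on words\<close>

text \<open>In this and the following locales the operations without a subscript are those of \<open>D\<close>.\<close>

locale lax_functor = C: symmetric_monoidal_category C + D: symmetric_monoidal_category D
  for C :: "('o1, 'a1) smc" and D :: "('o2, 'a2) smc" (structure) +
  fixes F :: "('o1, 'a1, 'o2, 'a2) lax"
  assumes lax: "lax_smf C D F"
begin

abbreviation Fo :: "'o1 \<Rightarrow> 'o2" where "Fo \<equiv> FOb F"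
abbreviation Fa :: "'a1 \<Rightarrow> 'a2" where "Fa \<equiv> FArr F"

lemma Fo_Ob [simp]: "a \<in> Ob C \<Longrightarrow> Fo a \<in> Ob D"
  using lax by (simp add: lax_smf_def is_functor_def)

lemma Fa_arr [simp]: "f \<in> Arr C \<Longrightarrow> Fa f \<in> Arr D"
  and Fa_dom [simp]: "f \<in> Arr C \<Longrightarrow> Dom D (Fa f) = Fo (Dom C f)"
  and Fa_cod [simp]: "f \<in> Arr C \<Longrightarrow> Cod D (Fa f) = Fo (Cod C f)"
  using lax by (simp_all add: lax_smf_def is_functor_def hom_def)

lemma Fa_idn [simp]: "a \<in> Ob C \<Longrightarrow> Fa (idn C a) = idn D (Fo a)"
  using lax by (simp add: lax_smf_def is_functor_def)

lemma Fa_cmp [simp]: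
  "\<lbrakk>f \<in> Arr C; g \<in> Arr C; Cod C f = Dom C g\<rbrakk> \<Longrightarrow> Fa (g \<cdot>\<^bsub>C\<^esub> f) = Fa g \<cdot> Fa f"
  using lax by (simp add: lax_smf_def is_functor_def)

lemma eta_simps [simp]:
  "Feta F \<in> Arr D" "Dom D (Feta F) = munit D" "Cod D (Feta F) = Fo (munit C)"
  using lax by (simp_all add: lax_smf_def hom_def)

lemma xi_simps [simp]:
  assumes "a \<in> Ob C" "b \<in> Ob C"
  shows "Fxi F a b \<in> Arr D" "Dom D (Fxi F a b) = Fo a \<oplus> Fo b" "Cod D (Fxi F a b) = Fo (a \<oplus>\<^bsub>C\<^esub> b)"
proof -
  have "Fxi F a b \<in> hom D (Fo a \<oplus> Fo b) (Fo (a \<oplus>\<^bsub>C\<^esub> b))"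
    using lax assms by (simp add: lax_smf_def)
  thus "Fxi F a b \<in> Arr D" "Dom D (Fxi F a b) = Fo a \<oplus> Fo b" "Cod D (Fxi F a b) = Fo (a \<oplus>\<^bsub>C\<^esub> b)"
    by (simp_all add: hom_def)
qed

lemma xi_natural:
  "\<lbrakk>f \<in> Arr C; g \<in> Arr C\<rbrakk> \<Longrightarrow>
    Fa (f \<boxplus>\<^bsub>C\<^esub> g) \<cdot> Fxi F (Dom C f) (Dom C g) = Fxi F (Cod C f) (Cod C g) \<cdot> (Fa f \<boxplus> Fa g)"
  using lax by (simp add: lax_smf_def)

lemma xi_runit:
  "a \<in> Ob C \<Longrightarrow> Fa (runit C a) \<cdot> (Fxi F a (munit C) \<cdot> (idn D (Fo a) \<boxplus> Feta F)) = runit D (Fo a)"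
proof -
  assume a: "a \<in> Ob C"
  have "Fa (runit C a) \<cdot> Fxi F a (munit C) \<cdot> (idn D (Fo a) \<boxplus> Feta F) = runit D (Fo a)"
    using lax a by (simp add: lax_smf_def)
  thus ?thesis using a by simp
qed

lemma xi_assc:
  assumes "a \<in> Ob C" "b \<in> Ob C" "c \<in> Ob C"
  shows "Fa (assc C a b c) \<cdot> (Fxi F (a \<oplus>\<^bsub>C\<^esub> b) c \<cdot> (Fxi F a b \<boxplus> idn D (Fo c))) =
    Fxi F a (b \<oplus>\<^bsub>C\<^esub> c) \<cdot> ((idn D (Fo a) \<boxplus> Fxi F b c) \<cdot> assc D (Fo a) (Fo b) (Fo c))"
proof -
  have "Fa (assc C a b c) \<cdot> Fxi F (a \<oplus>\<^bsub>C\<^esub> b) c \<cdot> (Fxi F a b \<boxplus> idn D (Fo c)) =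
    Fxi F a (b \<oplus>\<^bsub>C\<^esub> c) \<cdot> (idn D (Fo a) \<boxplus> Fxi F b c) \<cdot> assc D (Fo a) (Fo b) (Fo c)"
    using lax assms by (simp add: lax_smf_def)
  thus ?thesis using assms by simp
qed

lemma xi_sym:
  "\<lbrakk>a \<in> Ob C; b \<in> Ob C\<rbrakk> \<Longrightarrow>
    Fa (sym C a b) \<cdot> Fxi F a b = Fxi F b a \<cdot> sym D (Fo a) (Fo b)"
  using lax by (simp add: lax_smf_def)

text \<open>The structure maps \<open>\<xi>\<^sub>n\<close> are those of the left-parenthesized words; the same recursion makes sense for
  every word.\<close>

primrec xi_word :: "word \<Rightarrow> 'o1 list \<Rightarrow> 'a2" where
  "xi_word WE xs = Feta F"
| "xi_word (WVar i) xs = idn D (Fo (xs ! i))"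
| "xi_word (WTen u v) xs = Fxi F (evO C u xs) (evO C v xs) \<cdot> (xi_word u xs \<boxplus> xi_word v xs)"

lemma xi_word_hom:
  assumes "set xs \<subseteq> Ob C" "set (wvars w) \<subseteq> {..<length xs}"
  shows "xi_word w xs \<in> Arr D \<and> Dom D (xi_word w xs) = evO D w (map Fo xs) \<and> Cod D (xi_word w xs) = Fo (evO C w xs)"
  using assms(2)
proof (induction w)
  case (WVar i)
  hence "xs ! i \<in> Ob C" using assms(1) by auto
  thus ?case using WVar by simp
next
  case (WTen u v)
  thus ?case using C.evO_Ob[OF assms(1), of u] C.evO_Ob[OF assms(1), of v] by simp
qed simp

lemma xi_word_simps [simp]:
  assumes "set xs \<subseteq> Ob C" "w \<in> Y (length xs)"
  shows "xi_word w xs \<in> Arr D" "Dom D (xi_word w xs) = evO D w (map Fo xs)" "Cod D (xi_word w xs) = Fo (evO C w xs)"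
  using xi_word_hom[OF assms(1), of w] assms(2) by (simp_all add: Y_range)

lemma inverses_Fa: "inverses C f g \<Longrightarrow> inverses D (Fa f) (Fa g)"
proof -
  assume i: "inverses C f g"
  hence a: "f \<in> Arr C" "g \<in> Arr C" "Dom C g = Cod C f" "Cod C g = Dom C f"
    and "g \<cdot>\<^bsub>C\<^esub> f = idn C (Dom C f)" "f \<cdot>\<^bsub>C\<^esub> g = idn C (Cod C f)"
    by (auto simp: inverses_def hom_def)
  hence "Fa g \<cdot> Fa f = idn D (Fo (Dom C f))" "Fa f \<cdot> Fa g = idn D (Fo (Cod C f))"
    by (simp_all flip: Fa_cmp)
  thus ?thesis using a by (simp add: inverses_def hom_def)
qed

text \<open>For the generators these are naturality of the structure maps and the unit, associativity and symmetry
  axioms of a lax functor.  The arrow \<open>f'\<close> is produced by the same derivation as \<open>f\<close>.\<close>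

lemma xi_word_canonical:
  assumes "canonical C xs u v f" "set xs \<subseteq> Ob C" "set (wvars u) \<subseteq> {..<length xs}"
  shows "\<exists>f'. canonical D (map Fo xs) u v f' \<and> Fa f \<cdot> xi_word u xs = xi_word v xs \<cdot> f'"
  using assms
proof (induction rule: canonical.induct)
  case (can_id w)
  show ?case by (rule exI, rule conjI, rule canonical.can_id)
    (use can_id xi_word_hom[of xs w] C.evO_Ob[of xs w] in simp)
next
  case (can_comp u v f w g)
  interpret c: smc_tuple C xs by (rule C.smc_tuple) (use can_comp.prems in auto)
  interpret d: smc_tuple D "map Fo xs" by (rule D.smc_tuple) (use can_comp.prems in auto)
  have r: "set (wvars v) = set (wvars u)" "set (wvars w) = set (wvars u)"
    using mset_set_distinct(1)[OF canonical_mset[OF can_comp.hyps(1)]]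
      mset_set_distinct(1)[OF canonical_mset[OF can_comp.hyps(2)]] by auto
  obtain f' g' where f': "canonical D (map Fo xs) u v f'" "Fa f \<cdot> xi_word u xs = xi_word v xs \<cdot> f'"
    and g': "canonical D (map Fo xs) v w g'" "Fa g \<cdot> xi_word v xs = xi_word w xs \<cdot> g'"
    using can_comp r by auto
  note a = c.canonical_arr[OF can_comp.hyps(1)] c.canonical_arr[OF can_comp.hyps(2)]
    d.canonical_arr[OF f'(1)] d.canonical_arr[OF g'(1)] can_comp.prems r
    xi_word_hom[of xs u] xi_word_hom[of xs v] xi_word_hom[of xs w]
  have "Fa (g \<cdot>\<^bsub>C\<^esub> f) \<cdot> xi_word u xs = Fa g \<cdot> (xi_word v xs \<cdot> f')" using a by (simp add: f'(2))
  also have "\<dots> = xi_word w xs \<cdot> (g' \<cdot> f')" using a by (simp add: D.cmp_extend[OF g'(2)])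
  finally show ?case using canonical.can_comp[OF f'(1) g'(1)] by blast
next
  case (can_inv u v f g)
  interpret c: smc_tuple C xs by (rule C.smc_tuple) (use can_inv.prems in auto)
  interpret d: smc_tuple D "map Fo xs" by (rule D.smc_tuple) (use can_inv.prems in auto)
  have r: "set (wvars v) = set (wvars u)" "set (wvars u) \<subseteq> {..<length xs}"
    using mset_set_distinct(1)[OF canonical_mset[OF can_inv.hyps(1)]] can_inv.prems by auto
  obtain f' where f': "canonical D (map Fo xs) u v f'" "Fa f \<cdot> xi_word u xs = xi_word v xs \<cdot> f'"
    using can_inv r by auto
  have "is_iso D f'" by (rule d.is_iso_canonical[OF f'(1)]) (use r in simp)
  then obtain g' where g': "inverses D f' g'" unfolding is_iso_def by blast
  have a: "f \<in> Arr C" "Dom C f = evO C u xs" "Cod C f = evO C v xs"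
    "f' \<in> Arr D" "Dom D f' = evO D u (map Fo xs)" "Cod D f' = evO D v (map Fo xs)"
    using c.canonical_arr[OF can_inv.hyps(1)] d.canonical_arr[OF f'(1)] r by auto
  have i: "Fa g \<in> Arr D" "Dom D (Fa g) = Cod D (Fa f)" "Cod D (Fa g) = Dom D (Fa f)"
    "Fa g \<cdot> Fa f = idn D (Dom D (Fa f))"
    "g' \<in> Arr D" "Dom D g' = Cod D f'" "Cod D g' = Dom D f'" "f' \<cdot> g' = idn D (Cod D f')"
    using inverses_Fa[OF can_inv.hyps(2)] g' by (auto simp: inverses_def hom_def)
  have e: "xi_word u xs \<in> Arr D" "Dom D (xi_word u xs) = Dom D f'" "Cod D (xi_word u xs) = Dom D (Fa f)"
    "xi_word v xs \<in> Arr D" "Dom D (xi_word v xs) = Cod D f'" "Cod D (xi_word v xs) = Cod D (Fa f)"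
    using xi_word_hom[of xs u] xi_word_hom[of xs v] can_inv.prems r a by auto
  have fa: "Fa f \<in> Arr D" using a by simp
  have "Fa g \<cdot> xi_word v xs = Fa g \<cdot> (xi_word v xs \<cdot> (f' \<cdot> g'))"
    unfolding i(8) using e by (simp del: Fa_dom Fa_cod)
  also have "\<dots> = Fa g \<cdot> ((Fa f \<cdot> xi_word u xs) \<cdot> g')"
    unfolding f'(2) using e(4,5) i(5-7) a(4) by (simp del: Fa_dom Fa_cod)
  also have "\<dots> = (Fa g \<cdot> Fa f) \<cdot> (xi_word u xs \<cdot> g')"
    using e(1-3) i(1-3,5-7) a(4) fa by (simp del: Fa_dom Fa_cod)
  also have "\<dots> = xi_word u xs \<cdot> g'"
    unfolding i(4) using e(1-3) i(5-7) a(4) fa by (simp del: Fa_dom Fa_cod)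
  finally show ?case using canonical.can_inv[OF f'(1) g'] by blast
next
  case (can_ten u u' f v v' g)
  interpret c: smc_tuple C xs by (rule C.smc_tuple) (use can_ten.prems in auto)
  interpret d: smc_tuple D "map Fo xs" by (rule D.smc_tuple) (use can_ten.prems in auto)
  have r: "set (wvars u') = set (wvars u)" "set (wvars v') = set (wvars v)"
    using mset_set_distinct(1)[OF canonical_mset[OF can_ten.hyps(1)]]
      mset_set_distinct(1)[OF canonical_mset[OF can_ten.hyps(2)]] by auto
  obtain f' g' where f': "canonical D (map Fo xs) u u' f'" "Fa f \<cdot> xi_word u xs = xi_word u' xs \<cdot> f'"
    and g': "canonical D (map Fo xs) v v' g'" "Fa g \<cdot> xi_word v xs = xi_word v' xs \<cdot> g'"
    using can_ten r by auto
  note a = c.canonical_arr[OF can_ten.hyps(1)] c.canonical_arr[OF can_ten.hyps(2)]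
    d.canonical_arr[OF f'(1)] d.canonical_arr[OF g'(1)] can_ten.prems r
    xi_word_hom[of xs u] xi_word_hom[of xs v] xi_word_hom[of xs u'] xi_word_hom[of xs v']
  have "Fa (f \<boxplus>\<^bsub>C\<^esub> g) \<cdot> xi_word (WTen u v) xs =
    Fxi F (evO C u' xs) (evO C v' xs) \<cdot> ((Fa f \<boxplus> Fa g) \<cdot> (xi_word u xs \<boxplus> xi_word v xs))"
    using a xi_natural[of f g] D.cmp_extend[of "Fa (f \<boxplus>\<^bsub>C\<^esub> g)" "Fxi F (Dom C f) (Dom C g)" _ "xi_word u xs \<boxplus> xi_word v xs"]
    by simp
  also have "\<dots> = xi_word (WTen u' v') xs \<cdot> (f' \<boxplus> g')"
    using a by (simp add: D.ten_cmp f'(2) g'(2))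
  finally show ?case using canonical.can_ten[OF f'(1) g'(1)] by blast
next
  case (can_assc u v w)
  let ?u = "evO C u xs" and ?v = "evO C v xs" and ?w = "evO C w xs"
  have a: "xi_word u xs \<in> Arr D" "Dom D (xi_word u xs) = evO D u (map Fo xs)" "Cod D (xi_word u xs) = Fo ?u"
    "xi_word v xs \<in> Arr D" "Dom D (xi_word v xs) = evO D v (map Fo xs)" "Cod D (xi_word v xs) = Fo ?v"
    "xi_word w xs \<in> Arr D" "Dom D (xi_word w xs) = evO D w (map Fo xs)" "Cod D (xi_word w xs) = Fo ?w"
    "?u \<in> Ob C" "?v \<in> Ob C" "?w \<in> Ob C"
    using can_assc xi_word_hom[of xs u] xi_word_hom[of xs v] xi_word_hom[of xs w]
      C.evO_Ob[of xs u] C.evO_Ob[of xs v] C.evO_Ob[of xs w] by auto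
  have "Fa (assc C ?u ?v ?w) \<cdot> xi_word (WTen (WTen u v) w) xs =
    (Fa (assc C ?u ?v ?w) \<cdot> (Fxi F (?u \<oplus>\<^bsub>C\<^esub> ?v) ?w \<cdot> (Fxi F ?u ?v \<boxplus> idn D (Fo ?w)))) \<cdot>
     ((xi_word u xs \<boxplus> xi_word v xs) \<boxplus> xi_word w xs)"
    using a by (simp add: D.ten_cmp)
  also have "\<dots> = Fxi F ?u (?v \<oplus>\<^bsub>C\<^esub> ?w) \<cdot> ((idn D (Fo ?u) \<boxplus> Fxi F ?v ?w) \<cdot>
      (assc D (Fo ?u) (Fo ?v) (Fo ?w) \<cdot> ((xi_word u xs \<boxplus> xi_word v xs) \<boxplus> xi_word w xs)))"
    unfolding xi_assc[OF a(10-12)] using a by simp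
  also have "\<dots> = xi_word (WTen u (WTen v w)) xs \<cdot>
      assc D (evO D u (map Fo xs)) (evO D v (map Fo xs)) (evO D w (map Fo xs))"
    using a D.assc_natural[of "xi_word u xs" "xi_word v xs" "xi_word w xs"]
      D.Dom_in'[of "xi_word u xs"] D.Dom_in'[of "xi_word v xs"] D.Dom_in'[of "xi_word w xs"]
    by (simp add: D.ten_cmp')
  finally show ?case using canonical.can_assc by blast
next
  case (can_runit u)
  let ?u = "evO C u xs"
  have a: "xi_word u xs \<in> Arr D" "Dom D (xi_word u xs) = evO D u (map Fo xs)" "Cod D (xi_word u xs) = Fo ?u" "?u \<in> Ob C"
    using can_runit xi_word_hom[of xs u] C.evO_Ob[of xs u] by auto
  have "Fa (runit C ?u) \<cdot> xi_word (WTen u WE) xs =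
    (Fa (runit C ?u) \<cdot> (Fxi F ?u (munit C) \<cdot> (idn D (Fo ?u) \<boxplus> Feta F))) \<cdot> (xi_word u xs \<boxplus> idn D (munit D))"
    using a by (simp add: D.ten_cmp)
  also have "\<dots> = xi_word u xs \<cdot> runit D (evO D u (map Fo xs))"
    unfolding xi_runit[OF a(4)] using a D.runit_nat[of "xi_word u xs"] by (simp add: hom_def)
  finally show ?case using canonical.can_runit by blast
next
  case (can_sym u v)
  let ?u = "evO C u xs" and ?v = "evO C v xs"
  have a: "xi_word u xs \<in> Arr D" "Dom D (xi_word u xs) = evO D u (map Fo xs)" "Cod D (xi_word u xs) = Fo ?u"
    "xi_word v xs \<in> Arr D" "Dom D (xi_word v xs) = evO D v (map Fo xs)" "Cod D (xi_word v xs) = Fo ?v"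
    "?u \<in> Ob C" "?v \<in> Ob C"
    using can_sym xi_word_hom[of xs u] xi_word_hom[of xs v] C.evO_Ob[of xs u] C.evO_Ob[of xs v] by auto
  have "Fa (sym C ?u ?v) \<cdot> xi_word (WTen u v) xs = xi_word (WTen v u) xs \<cdot>
      sym D (evO D u (map Fo xs)) (evO D v (map Fo xs))"
    using a D.sym_natural[of "xi_word u xs" "xi_word v xs"] D.Dom_in'[of "xi_word u xs"] D.Dom_in'[of "xi_word v xs"]
    by (simp add: D.cmp_extend[OF xi_sym])
  thus ?case using canonical.can_sym by blast
qed

lemma xi_word_can:
  assumes "set xs \<subseteq> Ob C" "u \<in> Y (length xs)" "v \<in> Y (length xs)"
  shows "Fa (can C u v xs) \<cdot> xi_word u xs = xi_word v xs \<cdot> can D u v (map Fo xs)"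
proof -
  obtain f' where f': "canonical D (map Fo xs) u v f'" "Fa (can C u v xs) \<cdot> xi_word u xs = xi_word v xs \<cdot> f'"
    using xi_word_canonical[OF C.can_canonical[OF assms]] assms by (auto simp: Y_range)
  have "can D u v (map Fo xs) = f'"
    by (rule D.can_eqI[OF f'(1)]) (use assms in auto)
  thus ?thesis using f'(2) by simp
qed

lemma xi_word_natural_range:
  "\<lbrakk>set gs \<subseteq> Arr C; set (wvars w) \<subseteq> {..<length gs}\<rbrakk> \<Longrightarrow>
    Fa (evA C w gs) \<cdot> xi_word w (map (Dom C) gs) = xi_word w (map (Cod C) gs) \<cdot> evA D w (map Fa gs)"
proof (induction w)
  case (WVar i)
  hence "gs ! i \<in> Arr C" by auto
  thus ?case using WVar by simp
next
  case (WTen u v)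
  have s: "set (map Fa gs) \<subseteq> Arr D" "set (map (Dom C) gs) \<subseteq> Ob C" "set (map (Cod C) gs) \<subseteq> Ob C"
    "map (Dom D) (map Fa gs) = map Fo (map (Dom C) gs)" "map (Cod D) (map Fa gs) = map Fo (map (Cod C) gs)"
    using WTen.prems by auto
  note a = C.evA_hom[OF WTen.prems(1), of u] C.evA_hom[OF WTen.prems(1), of v]
    D.evA_hom[OF s(1), of u, unfolded s(4,5)] D.evA_hom[OF s(1), of v, unfolded s(4,5)] WTen.prems
    xi_word_hom[OF s(2), of u] xi_word_hom[OF s(2), of v] xi_word_hom[OF s(3), of u] xi_word_hom[OF s(3), of v]
    C.evO_Ob[OF s(2), of u] C.evO_Ob[OF s(2), of v] C.evO_Ob[OF s(3), of u] C.evO_Ob[OF s(3), of v]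
  have e: "Fa (evA C (WTen u v) gs) \<cdot> Fxi F (evO C u (map (Dom C) gs)) (evO C v (map (Dom C) gs)) =
    Fxi F (evO C u (map (Cod C) gs)) (evO C v (map (Cod C) gs)) \<cdot> (Fa (evA C u gs) \<boxplus> Fa (evA C v gs))"
    using xi_natural[of "evA C u gs" "evA C v gs"] a by simp
  have "Fa (evA C (WTen u v) gs) \<cdot> xi_word (WTen u v) (map (Dom C) gs) =
     Fxi F (evO C u (map (Cod C) gs)) (evO C v (map (Cod C) gs)) \<cdot>
      ((Fa (evA C u gs) \<boxplus> Fa (evA C v gs)) \<cdot> (xi_word u (map (Dom C) gs) \<boxplus> xi_word v (map (Dom C) gs)))"
    using D.cmp_extend[OF e, of "xi_word u (map (Dom C) gs) \<boxplus> xi_word v (map (Dom C) gs)"] a by simp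
  also have "\<dots> = Fxi F (evO C u (map (Cod C) gs)) (evO C v (map (Cod C) gs)) \<cdot>
     ((xi_word u (map (Cod C) gs) \<cdot> evA D u (map Fa gs)) \<boxplus> (xi_word v (map (Cod C) gs) \<cdot> evA D v (map Fa gs)))"
    using a WTen.IH by (simp add: D.ten_cmp)
  also have "\<dots> = xi_word (WTen u v) (map (Cod C) gs) \<cdot> evA D (WTen u v) (map Fa gs)"
    using a by (simp add: D.ten_cmp)
  finally show ?case .
qed simp

lemma xi_word_natural:
  "\<lbrakk>set gs \<subseteq> Arr C; w \<in> Y (length gs)\<rbrakk> \<Longrightarrow>
    Fa (evA C w gs) \<cdot> xi_word w (map (Dom C) gs) = xi_word w (map (Cod C) gs) \<cdot> evA D w (map Fa gs)"
  by (rule xi_word_natural_range) (simp_all add: Y_range)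

text \<open>The structure map of a substitution instance factors through the structure maps \<open>hs\<close> of the substituted
  words.\<close>

lemma xi_word_wsubst:
  assumes "set ys \<subseteq> Ob C" "set hs \<subseteq> Arr D" "map (Cod D) hs = map Fo ys"
  shows "\<lbrakk>set (wvars w) \<subseteq> {..<length ys};
      \<forall>i\<in>set (wvars w). xi_word (\<rho> i) xs = hs ! i \<and> evO C (\<rho> i) xs = ys ! i\<rbrakk> \<Longrightarrow>
    xi_word (wsubst \<rho> w) xs = xi_word w ys \<cdot> evA D w hs"
proof (induction w)
  case WE
  show ?case by simp
next
  case (WVar i)
  have "length hs = length ys" using assms(3) by (metis length_map)
  hence "i < length hs" using WVar by simp
  hence "hs ! i \<in> Arr D" "Cod D (hs ! i) = Fo (ys ! i)"
    using assms(2,3) WVar(1) by (auto dest: arg_cong[of _ _ "\<lambda>l. l ! i"])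
  thus ?case using WVar by simp
next
  case (WTen u v)
  have l: "length hs = length ys" using assms(3) by (metis length_map)
  have e: "evO C (wsubst \<rho> u) xs = evO C u ys" "evO C (wsubst \<rho> v) xs = evO C v ys"
    using WTen.prems(2) by (auto intro!: C.evO_wsubst)
  note a = D.evA_hom[OF assms(2), of u] D.evA_hom[OF assms(2), of v] WTen.prems l
    xi_word_hom[OF assms(1), of u] xi_word_hom[OF assms(1), of v] C.evO_Ob[OF assms(1), of u] C.evO_Ob[OF assms(1), of v]
  show ?case using a WTen.IH e assms(3) by (simp add: D.ten_cmp)
qed

lemma xi_word_wgamma:
  assumes "set (concat xss) \<subseteq> Ob C" "fits ws xss" "w \<in> Y (length xss)"
  shows "xi_word (wgamma w ws) (concat xss) = xi_word w (map2 (evO C) ws xss) \<cdot> evA D w (map2 xi_word ws xss)"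
  unfolding wgamma_def
proof (rule xi_word_wsubst)
  have l: "length ws = length xss" using assms(2) by (simp add: fits_def)
  have x: "set (xss ! s) \<subseteq> Ob C" "ws ! s \<in> Y (length (xss ! s))" if "s < length xss" for s
    using that assms(1,2) by (fastforce simp: fits_def)+
  show "set (map2 (evO C) ws xss) \<subseteq> Ob C"
    using x l by (auto simp: in_set_conv_nth)
  show "set (map2 xi_word ws xss) \<subseteq> Arr D"
    using x l by (auto simp: in_set_conv_nth)
  show "map (Cod D) (map2 xi_word ws xss) = map Fo (map2 (evO C) ws xss)"
    by (rule nth_equalityI) (use x l in simp_all)
  show "set (wvars w) \<subseteq> {..<length (map2 (evO C) ws xss)}"
    using assms(3) l by (simp add: Y_range)
  have c: "xi_word (shift m u) (concat xss) = xi_word u xs"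
    "evO C (shift m u) (concat xss) = evO C u xs"
    if "\<And>i. i < length xs \<Longrightarrow> concat xss ! (m + i) = xs ! i" "set (wvars u) \<subseteq> {..<length xs}" for m u xs
    using that(2) by (induction u) (use that(1) in auto)
  show "\<forall>s\<in>set (wvars w).
       xi_word (shift (offset ws s) (ws ! s)) (concat xss) = map2 xi_word ws xss ! s \<and>
       evO C (shift (offset ws s) (ws ! s)) (concat xss) = map2 (evO C) ws xss ! s"
  proof (intro ballI)
    fix s assume "s \<in> set (wvars w)"
    hence s: "s < length xss" using assms(3) by (simp add: Y_range)
    have "map arity (take s ws) = map length (take s xss)"
      using fits_arity[OF assms(2)] by (metis take_map)
    thus "xi_word (shift (offset ws s) (ws ! s)) (concat xss) = map2 xi_word ws xss ! s \<and>
       evO C (shift (offset ws s) (ws ! s)) (concat xss) = map2 (evO C) ws xss ! s"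
      using c[of "xss ! s" "offset ws s" "ws ! s"] nth_concat_offset[OF s] x(2)[OF s] s l
      by (simp add: Y_range)
  qed
qed

lemma xi_word_wact:
  assumes "set xs \<subseteq> Ob C" "w \<in> Y (length xs)" "\<sigma> permutes {..<length xs}"
  shows "xi_word (wact w \<sigma>) (permute_list \<sigma> xs) = xi_word w xs"
proof -
  have *: "permute_list \<sigma> xs ! inv \<sigma> i = xs ! i" if "i < length xs" for i
  proof -
    have "inv \<sigma> i < length xs" using that permutes_in_image[OF permutes_inv[OF assms(3)]] by simp
    thus ?thesis using assms(3) by (simp add: permute_list_nth permutes_inverses)
  qed
  have "set (wvars w) \<subseteq> {..<length xs} \<Longrightarrow> xi_word (wact w \<sigma>) (permute_list \<sigma> xs) = xi_word w xs \<and>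
    evO C (wact w \<sigma>) (permute_list \<sigma> xs) = evO C w xs"
    by (induction w) (auto simp: * wact_def)
  thus ?thesis using assms(2) by (simp add: Y_range)
qed

end

section \<open>The multifunctor of a lax functor\<close>

lemma set_subset_nthI: "(\<And>s. s < length xs \<Longrightarrow> xs ! s \<in> A) \<Longrightarrow> set xs \<subseteq> A"
  by (auto simp: in_set_conv_nth)

lemma kword_Y: "kword n \<in> Y n"
proof (induction n rule: kword.induct)
  case (3 n)
  \<comment> \<open>Only the lengths of the tuples enter, so tuples of units serve as arguments of the required arities.\<close>
  have "wgamma (WTen (WVar 0) (WVar 1)) [kword (Suc n), WVar 0] \<in>
      Y (length (concat [replicate (Suc n) (), [()]]))"
  proof (rule Y_wgamma)
    show "WTen (WVar 0) (WVar 1) \<in> Y (length [replicate (Suc n) (), [()]])"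
      by (auto simp: Y_def)
    show "fits [kword (Suc n), WVar 0] [replicate (Suc n) (), [()]]"
      using 3 Y_var by (auto simp: fits_def less_Suc_eq)
  qed
  thus ?case by simp
qed (auto simp: Y_def)

text \<open>The recursion in the definition of \<open>kword\<close> is an operadic composite; this is the word it denotes.\<close>

lemma kword_Suc: "kword (Suc (Suc n)) = WTen (kword (Suc n)) (WVar (Suc n))"
proof -
  have "wsubst WVar w = w" for w by (induction w) auto
  thus ?thesis using Y_arity[OF kword_Y[of "Suc n"]] by (simp add: wgamma_def del: kword.simps(2))
qed

lemma evO_take: "\<lbrakk>set (wvars w) \<subseteq> {..<n}; n \<le> length xs\<rbrakk> \<Longrightarrow> evO C w (take n xs) = evO C w xs"
  by (induction w) auto

lemma kchoice: "word_choice C kchoice"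
  by (simp add: word_choice_def kchoice_def kword_Y)

context smc_choice begin

text \<open>Canonical isomorphisms are epimorphisms.\<close>

lemma mor_inject:
  assumes "mor w xs f = mor w xs g" "set xs \<subseteq> Ob C" "w \<in> Y (length xs)"
    "f \<in> Arr C" "Dom C f = evO C w xs" "g \<in> Arr C" "Dom C g = evO C w xs"
  shows "f = g"
proof -
  have "(f \<cdot> can C (\<kappa> xs) w xs) \<cdot> can C w (\<kappa> xs) xs = (g \<cdot> can C (\<kappa> xs) w xs) \<cdot> can C w (\<kappa> xs) xs"
    using assms(1) by (simp add: mor_def)
  thus ?thesis using assms(2-) by simp
qed

end

locale lax_choice = lax_functor C D F + C: smc_choice C \<kappa> + D: smc_choice D \<mu>
  for C :: "('o1, 'a1) smc" and \<kappa> and D :: "('o2, 'a2) smc" (structure) and \<mu> and F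
begin

lemma xin_eq_xi_word: "n \<le> length xs \<Longrightarrow> xin C D F n xs = xi_word (kword n) xs"
proof (induction n arbitrary: rule: kword.induct)
  case (3 n)
  have "evO C (kword (Suc n)) (take (Suc n) xs) = evO C (kword (Suc n)) xs"
    by (rule evO_take) (use 3 kword_Y[of "Suc n"] in \<open>simp_all add: Y_range\<close>)
  thus ?case using 3 by (simp add: kword_Suc del: kword.simps)
qed simp_all

lemma fst_UF: "fst (UF C \<kappa> D \<mu> F) = restrict Fo (Ob C)"
  by (rule ext) (simp add: UF_def mfun_comp_def Ucan_def UkF_def compose_def)

lemma snd_UF_extensional: "snd (UF C \<kappa> D \<mu> F) \<in> extensional (MArr C.M)"
  by (simp add: UF_def mfun_comp_def compose_def)

text \<open>Compatibility of the structure maps with the canonical isomorphism from \<open>k\<^sub>n\<close> to \<open>\<kappa> xs\<close> moves the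
  definition of \<open>UF\<close> through \<open>k\<^sub>n\<close> to the chosen word.\<close>

lemma UF_arr:
  assumes "(xs, f) \<in> MArr C.M"
  shows "snd (UF C \<kappa> D \<mu> F) (xs, f) = D.mor (\<kappa> xs) (map Fo xs) (Fa f \<cdot> xi_word (\<kappa> xs) xs)"
proof -
  interpret Ck: smc_choice C kchoice by unfold_locales (rule kchoice)
  interpret Dk: smc_choice D kchoice by unfold_locales (rule kchoice)
  have f: "set xs \<subseteq> Ob C" "f \<in> Arr C" "Dom C f = evO C (\<kappa> xs) xs"
    using assms by (simp_all add: C.MArr_iff)
  let ?k = "kword (length xs)" and ?ys = "map Fo xs"
  have ys: "set ?ys \<subseteq> Ob D" using f(1) by auto
  have Y: "?k \<in> Y (length xs)" "\<kappa> xs \<in> Y (length xs)" "\<mu> ?ys \<in> Y (length xs)"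
    using f(1) D.choice_Y[OF ys] by (simp_all add: kword_Y)
  let ?f1 = "f \<cdot>\<^bsub>C\<^esub> can C ?k (\<kappa> xs) xs"
  have f1: "?f1 \<in> Arr C" "Dom C ?f1 = evO C ?k xs" using f Y by simp_all
  have m1: "(xs, ?f1) \<in> MArr (Umult C kchoice)"
    using f1 f(1) by (simp add: Ck.MArr_iff kchoice_def)
  let ?f2 = "Fa ?f1 \<cdot> xi_word ?k xs"
  have f2: "?f2 \<in> Arr D" "Dom D ?f2 = evO D ?k ?ys"
    using f1 f(1) Y xi_word_simps[OF f(1) Y(1)] by (simp_all del: Fa_cmp)
  have m2: "(?ys, ?f2) \<in> MArr (Umult D kchoice)"
    using f2 ys by (simp add: Dk.MArr_iff kchoice_def)
  have "snd (UF C \<kappa> D \<mu> F) (xs, f) = (?ys, ?f2 \<cdot> can D (\<mu> ?ys) ?k ?ys)"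
    using assms m1 m2
    by (simp add: UF_def mfun_comp_def Ucan_def UkF_def compose_def kchoice_def xin_eq_xi_word del: Fa_cmp)
  also have "?f2 \<cdot> can D (\<mu> ?ys) ?k ?ys =
      Fa f \<cdot> ((Fa (can C ?k (\<kappa> xs) xs) \<cdot> xi_word ?k xs) \<cdot> can D (\<mu> ?ys) ?k ?ys)"
    using f Y ys by simp
  also have "\<dots> = (Fa f \<cdot> xi_word (\<kappa> xs) xs) \<cdot> can D (\<mu> ?ys) (\<kappa> xs) ?ys"
    unfolding xi_word_can[OF f(1) Y(1,2)] using f Y ys by simp
  finally show ?thesis by (simp add: D.mor_def)
qed

text \<open>The same argument for an arbitrary word.  In this form the two choices of words have
  become irrelevant: the same word appears on both sides.\<close>

lemma UF_mor:
  assumes "set xs \<subseteq> Ob C" "w \<in> Y (length xs)" "f \<in> Arr C" "Dom C f = evO C w xs"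
  shows "snd (UF C \<kappa> D \<mu> F) (C.mor w xs f) = D.mor w (map Fo xs) (Fa f \<cdot> xi_word w xs)"
proof -
  have ys: "set (map Fo xs) \<subseteq> Ob D" using assms(1) by auto
  have "C.mor w xs f \<in> MArr C.M" by (rule C.mor_in) (use assms in auto)
  hence "snd (UF C \<kappa> D \<mu> F) (C.mor w xs f) =
    D.mor (\<kappa> xs) (map Fo xs) (Fa (f \<cdot>\<^bsub>C\<^esub> can C (\<kappa> xs) w xs) \<cdot> xi_word (\<kappa> xs) xs)"
    using UF_arr[of xs "f \<cdot>\<^bsub>C\<^esub> can C (\<kappa> xs) w xs"] by (simp add: C.mor_def)
  also have "Fa (f \<cdot>\<^bsub>C\<^esub> can C (\<kappa> xs) w xs) \<cdot> xi_word (\<kappa> xs) xs = (Fa f \<cdot> xi_word w xs) \<cdot> can D (\<kappa> xs) w (map Fo xs)"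
    using assms xi_word_can[of xs "\<kappa> xs" w] ys by simp
  also have "D.mor (\<kappa> xs) (map Fo xs) \<dots> = D.mor w (map Fo xs) (Fa f \<cdot> xi_word w xs)"
    by (rule D.mor_change) (use assms ys in simp_all)
  finally show ?thesis .
qed

text \<open>Identities, composites and the group action are computed at presentations on both sides, so that
  \<open>UF_mor\<close> reduces preservation to the behaviour of \<open>xi_word\<close> under substitution and renaming.\<close>

lemma multifunctor_UF: "multifunctor C.M D.M (UF C \<kappa> D \<mu> F)"
  unfolding multifunctor_def
proof (intro conjI ballI allI impI)
  let ?G = "UF C \<kappa> D \<mu> F"
  show "multicategory C.M" "multicategory D.M"
    by (rule C.multicategory_Umult D.multicategory_Umult)+
  show "fst ?G \<in> extensional (MOb C.M)" by (simp add: fst_UF)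
  show "snd ?G \<in> extensional (MArr C.M)" by (rule snd_UF_extensional)
  show "fst ?G a \<in> MOb D.M" if "a \<in> MOb C.M" for a using that by (simp add: fst_UF)
  have map: "map (fst ?G) xs = map Fo xs" if "set xs \<subseteq> Ob C" for xs
    using that by (auto simp: fst_UF)
  have arr: "snd ?G f = D.mor (\<kappa> (fst f)) (map Fo (fst f)) (Fa (snd f) \<cdot> xi_word (\<kappa> (fst f)) (fst f))"
    if "f \<in> MArr C.M" for f
    using UF_arr[of "fst f" "snd f"] that by simp
  have arr': "set (map Fo (fst f)) \<subseteq> Ob D" "\<kappa> (fst f) \<in> Y (length (map Fo (fst f)))"
    "Fa (snd f) \<cdot> xi_word (\<kappa> (fst f)) (fst f) \<in> Arr D"
    "Dom D (Fa (snd f) \<cdot> xi_word (\<kappa> (fst f)) (fst f)) = evO D (\<kappa> (fst f)) (map Fo (fst f))"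
    "Cod D (Fa (snd f) \<cdot> xi_word (\<kappa> (fst f)) (fst f)) = Fo (Cod C (snd f))"
    if "f \<in> MArr C.M" for f
  proof -
    have f: "set (fst f) \<subseteq> Ob C" "\<kappa> (fst f) \<in> Y (length (fst f))" "snd f \<in> Arr C"
      "Dom C (snd f) = evO C (\<kappa> (fst f)) (fst f)"
      using that by (simp_all add: C.MArr_iff)
    show "set (map Fo (fst f)) \<subseteq> Ob D" using f(1) by auto
    show "\<kappa> (fst f) \<in> Y (length (map Fo (fst f)))" using f by simp
    show "Fa (snd f) \<cdot> xi_word (\<kappa> (fst f)) (fst f) \<in> Arr D"
      "Dom D (Fa (snd f) \<cdot> xi_word (\<kappa> (fst f)) (fst f)) = evO D (\<kappa> (fst f)) (map Fo (fst f))"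
      "Cod D (Fa (snd f) \<cdot> xi_word (\<kappa> (fst f)) (fst f)) = Fo (Cod C (snd f))"
      using f by simp_all
  qed
  fix f assume f: "f \<in> MArr C.M"
  have fO: "set (fst f) \<subseteq> Ob C" "Cod C (snd f) \<in> Ob C" using f by (simp_all add: C.MArr_iff)
  show "snd ?G f \<in> MArr D.M"
    unfolding arr[OF f] by (rule D.mor_in[OF arr'(1-4)[OF f]])
  show "MSrc D.M (snd ?G f) = map (fst ?G) (MSrc C.M f)"
    using map[OF fO(1)] by (simp add: arr[OF f])
  show "MTgt D.M (snd ?G f) = fst ?G (MTgt C.M f)"
    using D.Cod_mor[OF arr'(1-4)[OF f]] arr'(5)[OF f] fO(2) by (simp add: arr[OF f] fst_UF)
next
  let ?G = "UF C \<kappa> D \<mu> F"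
  fix a assume a: "a \<in> MOb C.M"
  show "snd ?G (MId C.M a) = MId D.M (fst ?G a)"
    using a by (simp add: C.MId_mor UF_mor Y_var fst_UF D.MId_mor)
next
  let ?G = "UF C \<kappa> D \<mu> F"
  have arr: "snd ?G f = D.mor (\<kappa> (fst f)) (map Fo (fst f)) (Fa (snd f) \<cdot> xi_word (\<kappa> (fst f)) (fst f))"
    if "f \<in> MArr C.M" for f
    using UF_arr[of "fst f" "snd f"] that by simp
  fix g fs assume gf: "composable C.M g fs"
  note c = C.composableD[OF gf] and a = C.MComp_arr[OF gf]
  let ?K = "\<kappa> (fst g)" and ?xss = "map fst fs" and ?hs = "map snd fs"
  let ?ks = "map \<kappa> ?xss" and ?X = "concat (map fst fs)"
  let ?hs' = "map2 (\<lambda>h x. Fa h \<cdot> x) ?hs (map2 xi_word ?ks ?xss)"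
  have fs: "set (fst (fs ! s)) \<subseteq> Ob C" "\<kappa> (fst (fs ! s)) \<in> Y (length (fst (fs ! s)))" "snd (fs ! s) \<in> Arr C"
      "Dom C (snd (fs ! s)) = evO C (\<kappa> (fst (fs ! s))) (fst (fs ! s))" if "s < length fs" for s
    using c(5)[OF that] by (simp_all add: C.MArr_iff)
  have g: "set (fst g) \<subseteq> Ob C" "snd g \<in> Arr C" "Dom C (snd g) = evO C ?K (fst g)" "?K \<in> Y (length (fst g))"
    using c(1) by (simp_all add: C.MArr_iff)
  have cod: "map (Cod D) ?hs' = map Fo (fst g)"
    unfolding c(3) by (rule nth_equalityI) (use fs in simp_all)
  have dom: "map (Dom C) ?hs = map2 (evO C) ?ks ?xss"
    by (rule nth_equalityI) (use fs in simp_all)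
  have e: "Cod D (xi_word (\<kappa> (fst g)) (fst g)) = Fo (evO C ?K (fst g))" "xi_word ?K (fst g) \<in> Arr D"
    "Dom D (xi_word ?K (fst g)) = evO D ?K (map Fo (fst g))" using g by simp_all
  have "snd ?G (MComp C.M g fs) =
      D.mor (wgamma ?K ?ks) (map Fo ?X) (Fa (snd g \<cdot>\<^bsub>C\<^esub> evA C ?K ?hs) \<cdot> xi_word (wgamma ?K ?ks) ?X)"
    unfolding C.MComp_eq[of g fs] by (rule UF_mor) (use c(6) a in simp_all)
  also have "Fa (snd g \<cdot>\<^bsub>C\<^esub> evA C ?K ?hs) \<cdot> xi_word (wgamma ?K ?ks) ?X =
      (Fa (snd g) \<cdot> xi_word ?K (fst g)) \<cdot> evA D ?K ?hs'"
  proof -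
    let ?x = "map2 xi_word ?ks ?xss"
    have xA1: "set ?x \<subseteq> Arr D"
      by (rule set_subset_nthI) (use fs in simp_all)
    have xA2: "map (Cod D) ?x = map (Dom D) (map Fa ?hs)"
      by (rule nth_equalityI) (use fs in simp_all)
    have xA3: "set (map Fa ?hs) \<subseteq> Arr D"
      by (rule set_subset_nthI) (use fs in simp_all)
    note xA = xA1 xA2 xA3
    have hs'': "map2 (cmp D) (map Fa ?hs) ?x = ?hs'"
      by (rule nth_equalityI) simp_all
    have ev: "evA D ?K (map Fa ?hs) \<cdot> evA D ?K ?x = evA D ?K ?hs'"
      unfolding hs''[symmetric] by (rule D.evA_cmp[OF xA(1,3,2)]) (use c(8) in simp)
    have xA1: "evA D ?K ?x \<in> Arr D" "Dom D (evA D ?K ?x) = evO D ?K (map (Dom D) ?x)"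
      "Cod D (evA D ?K ?x) = evO D ?K (map (Cod D) ?x)"
      using D.evA_simps[OF xA(1), of ?K] c(8) by simp_all
    have hA: "evA D ?K (map Fa ?hs) \<in> Arr D" "Dom D (evA D ?K (map Fa ?hs)) = evO D ?K (map (Cod D) ?x)"
      "Cod D (evA D ?K (map Fa ?hs)) = evO D ?K (map Fo (fst g))"
    proof -
      have "map (Cod D) (map Fa ?hs) = map Fo (fst g)"
        unfolding c(3) by (rule nth_equalityI) (use fs in simp_all)
      thus "evA D ?K (map Fa ?hs) \<in> Arr D" "Dom D (evA D ?K (map Fa ?hs)) = evO D ?K (map (Cod D) ?x)"
      "Cod D (evA D ?K (map Fa ?hs)) = evO D ?K (map Fo (fst g))"
        using D.evA_simps[OF xA(3), of ?K] c(8) by (simp_all only: xA(2) length_map)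
    qed
    have C1: "evA C ?K ?hs \<in> Arr C" "Dom C (evA C ?K ?hs) = evO C ?K (map2 (evO C) ?ks ?xss)" 
      "Cod C (evA C ?K ?hs) = Dom C (snd g)"
      using C.evA_simps[OF c(9), of ?K] c(8) g by (simp_all only: dom c(3)[symmetric] length_map)
    have "set (map (Dom C) ?hs) \<subseteq> Ob C" using c(9) by auto
    hence o: "xi_word ?K (map2 (evO C) ?ks ?xss) \<in> Arr D"
      "Cod D (xi_word ?K (map2 (evO C) ?ks ?xss)) = Fo (evO C ?K (map2 (evO C) ?ks ?xss))"
      "Dom D (xi_word ?K (map2 (evO C) ?ks ?xss)) = evO D ?K (map Fo (map2 (evO C) ?ks ?xss))"
      unfolding dom[symmetric] using xi_word_simps[of "map (Dom C) ?hs" ?K] c(8) by simp_all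
    have d: "map (Cod D) ?x = map Fo (map2 (evO C) ?ks ?xss)"
      by (rule nth_equalityI) (use fs in simp_all)
    have nat: "Fa (evA C ?K ?hs) \<cdot> xi_word ?K (map2 (evO C) ?ks ?xss) = xi_word ?K (fst g) \<cdot> evA D ?K (map Fa ?hs)"
      using xi_word_natural[OF c(9), of ?K] c(8) unfolding dom c(3) by simp
    have "Fa (snd g \<cdot>\<^bsub>C\<^esub> evA C ?K ?hs) \<cdot> xi_word (wgamma ?K ?ks) ?X =
       Fa (snd g) \<cdot> ((Fa (evA C ?K ?hs) \<cdot> xi_word ?K (map2 (evO C) ?ks ?xss)) \<cdot> evA D ?K ?x)"
      using xi_word_wgamma[OF c(6,7), of ?K] c(8) C1 g(2) o xA1 d by (simp del: map_map)
    also have "\<dots> = (Fa (snd g) \<cdot> xi_word ?K (fst g)) \<cdot> evA D ?K ?hs'"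
      unfolding nat ev[symmetric] using e g(2,3) hA xA1 by (simp del: map_map)
    finally show ?thesis .
  qed
  also have "D.mor (wgamma ?K ?ks) (map Fo ?X) \<dots> =
     MComp D.M (D.mor ?K (map (Cod D) ?hs') (Fa (snd g) \<cdot> xi_word ?K (fst g))) (map (snd ?G) fs)"
  proof -
    have X: "map Fo ?X = concat (map (map Fo) ?xss)" by (simp add: map_concat o_def)
    show ?thesis unfolding X
    proof (rule D.mor_MComp[symmetric])
      show "?K \<in> Y (length (map (map Fo) ?xss))" using c(8) by simp
      show "Fa (snd g) \<cdot> xi_word ?K (fst g) \<in> Arr D"
        "Dom D (Fa (snd g) \<cdot> xi_word ?K (fst g)) = evO D ?K (map (Cod D) ?hs')"
        unfolding cod using e g by simp_all
      show "fits ?ks (map (map Fo) ?xss)" using fs by (simp add: fits_def)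
      show "set (concat (map (map Fo) ?xss)) \<subseteq> Ob D" unfolding X[symmetric] using c(6) by auto
      fix s assume "s < length (map (map Fo) ?xss)"
      hence s: "s < length fs" by simp
      show "?hs' ! s \<in> Arr D" "Dom D (?hs' ! s) = evO D (?ks ! s) (map (map Fo) ?xss ! s)"
        "map (snd ?G) fs ! s = D.mor (?ks ! s) (map (map Fo) ?xss ! s) (?hs' ! s)"
        using fs[OF s] s arr[OF c(5)[OF s]] by simp_all
    qed simp_all
  qed
  also have "\<dots> = MComp D.M (snd ?G g) (map (snd ?G) fs)"
    unfolding cod arr[OF c(1)] ..
  finally show "snd ?G (MComp C.M g fs) = MComp D.M (snd ?G g) (map (snd ?G) fs)" .
next
  let ?G = "UF C \<kappa> D \<mu> F"
  fix f \<sigma> assume f: "f \<in> MArr C.M" and "\<sigma> permutes {..<length (MSrc C.M f)}"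
  hence \<sigma>: "\<sigma> permutes {..<length (fst f)}" by simp
  have a: "set (fst f) \<subseteq> Ob C" "\<kappa> (fst f) \<in> Y (length (fst f))" "snd f \<in> Arr C"
      "Dom C (snd f) = evO C (\<kappa> (fst f)) (fst f)"
    using f by (simp_all add: C.MArr_iff)
  have ys: "set (map Fo (fst f)) \<subseteq> Ob D" using a(1) by auto
  have "snd ?G (MAct C.M \<sigma> f) = D.mor (wact (\<kappa> (fst f)) \<sigma>) (map Fo (permute_list \<sigma> (fst f)))
      (Fa (snd f) \<cdot> xi_word (wact (\<kappa> (fst f)) \<sigma>) (permute_list \<sigma> (fst f)))"
    unfolding C.MAct_eq[OF f \<sigma>]
    by (rule UF_mor) (use a \<sigma> in \<open>simp_all add: Y_wact C.evO_wact\<close>)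
  also have "\<dots> = D.mor (wact (\<kappa> (fst f)) \<sigma>) (permute_list \<sigma> (map Fo (fst f))) (Fa (snd f) \<cdot> xi_word (\<kappa> (fst f)) (fst f))"
    by (simp add: xi_word_wact[OF a(1,2) \<sigma>] permute_list_map[OF \<sigma>])
  also have "\<dots> = MAct D.M \<sigma> (D.mor (\<kappa> (fst f)) (map Fo (fst f)) (Fa (snd f) \<cdot> xi_word (\<kappa> (fst f)) (fst f)))"
    by (rule D.mor_MAct[symmetric]) (use a ys \<sigma> in simp_all)
  also have "\<dots> = MAct D.M \<sigma> (snd ?G f)"
    using UF_arr[of "fst f" "snd f"] f by simp
  finally show "snd ?G (MAct C.M \<sigma> f) = MAct D.M \<sigma> (snd ?G f)" .
qed

end

section \<open>The lax functor of a multifunctor\<close>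

text \<open>The word \<open>x\<^sub>1 \<oplus> x\<^sub>2\<close> of the generator \<open>m\<close>.\<close>

abbreviation m_word :: word where
  "m_word \<equiv> WTen (WVar 0) (WVar (Suc 0))"

lemma m_word_Y: "m_word \<in> Y (Suc (Suc 0))" "WTen (WVar (Suc 0)) (WVar 0) \<in> Y (Suc (Suc 0))"
  "WE \<in> Y 0" "WTen (WVar 0) WE \<in> Y (Suc 0)"
  "WTen m_word (WVar (Suc (Suc 0))) \<in> Y (Suc (Suc (Suc 0)))"
  "WTen (WVar 0) (WTen (WVar (Suc 0)) (WVar (Suc (Suc 0)))) \<in> Y (Suc (Suc (Suc 0)))"
  by (auto simp: Y_def)

lemma wgamma_m_word:
  "wgamma m_word [WVar 0, WVar 0] = m_word"
  "wgamma m_word [WVar 0, WE] = WTen (WVar 0) WE"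
  "wgamma m_word [m_word, WVar 0] = WTen m_word (WVar (Suc (Suc 0)))"
  "wgamma m_word [WVar 0, m_word] = WTen (WVar 0) (WTen (WVar (Suc 0)) (WVar (Suc (Suc 0))))"
  by (simp_all add: wgamma_def arity_def)

locale multifunctor_choice = C: smc_choice C \<kappa> + D: smc_choice D \<mu>
  for C :: "('o1, 'a1) smc" and \<kappa> and D :: "('o2, 'a2) smc" (structure) and \<mu> +
  fixes G :: "('o1, 'o1 list \<times> 'a1, 'o2, 'o2 list \<times> 'a2) mfun"
  assumes multifunctor: "multifunctor C.M D.M G"
begin

abbreviation Go :: "'o1 \<Rightarrow> 'o2" where "Go \<equiv> fst G"

text \<open>The arrow that presents, at the word \<open>w\<close>, the image under \<open>G\<close> of the multimorphism presented by \<open>f\<close>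
  at \<open>w\<close>.\<close>

definition G_word :: "word \<Rightarrow> 'o1 list \<Rightarrow> 'a1 \<Rightarrow> 'a2" where
  "G_word w xs f = snd (snd G (C.mor w xs f)) \<cdot> can D w (\<mu> (map Go xs)) (map Go xs)"

definition typed :: "word \<Rightarrow> 'o1 list \<Rightarrow> 'a1 \<Rightarrow> bool" where
  "typed w xs f \<longleftrightarrow> set xs \<subseteq> Ob C \<and> w \<in> Y (length xs) \<and> f \<in> Arr C \<and> Dom C f = evO C w xs"

lemma Go_Ob [simp]: "a \<in> Ob C \<Longrightarrow> Go a \<in> Ob D"
  using multifunctor by (simp add: multifunctor_def)

lemma Go_set: "set xs \<subseteq> Ob C \<Longrightarrow> set (map Go xs) \<subseteq> Ob D"
  by auto

lemma G_arr:
  assumes "f \<in> MArr C.M"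
  shows "snd G f \<in> MArr D.M" "fst (snd G f) = map Go (fst f)" "Cod D (snd (snd G f)) = Go (Cod C (snd f))"
  using multifunctor assms by (simp_all add: multifunctor_def)

lemma G_MComp:
  "composable C.M g fs \<Longrightarrow> snd G (MComp C.M g fs) = MComp D.M (snd G g) (map (snd G) fs)"
  using multifunctor unfolding multifunctor_def by blast

lemma typed_MArr: "typed w xs f \<Longrightarrow> C.mor w xs f \<in> MArr C.M"
  by (simp add: typed_def C.mor_in)

lemma G_word_arr:
  assumes "typed w xs f"
  shows "G_word w xs f \<in> Arr D" "Dom D (G_word w xs f) = evO D w (map Go xs)" "Cod D (G_word w xs f) = Go (Cod C f)"
proof -
  have t: "set xs \<subseteq> Ob C" "w \<in> Y (length xs)" "f \<in> Arr C" "Dom C f = evO C w xs"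
    using assms by (simp_all add: typed_def)
  note g = G_arr[OF typed_MArr[OF assms]]
  have a: "snd (snd G (C.mor w xs f)) \<in> Arr D"
    "Dom D (snd (snd G (C.mor w xs f))) = evO D (\<mu> (map Go xs)) (map Go xs)"
    "Cod D (snd (snd G (C.mor w xs f))) = Go (Cod C f)"
    using g t by (simp_all add: D.MArr_iff)
  show "G_word w xs f \<in> Arr D" "Dom D (G_word w xs f) = evO D w (map Go xs)" "Cod D (G_word w xs f) = Go (Cod C f)"
    unfolding G_word_def using a t Go_set[OF t(1)] D.choice_Y[OF Go_set[OF t(1)]] by simp_all
qed

lemma G_word_mor:
  assumes "typed w xs f"
  shows "snd G (C.mor w xs f) = D.mor w (map Go xs) (G_word w xs f)"
proof -
  have t: "set xs \<subseteq> Ob C" "w \<in> Y (length xs)" "f \<in> Arr C" "Dom C f = evO C w xs"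
    using assms by (simp_all add: typed_def)
  note g = G_arr[OF typed_MArr[OF assms]]
  have a: "snd (snd G (C.mor w xs f)) \<in> Arr D"
    "Dom D (snd (snd G (C.mor w xs f))) = evO D (\<mu> (map Go xs)) (map Go xs)"
    using g t by (simp_all add: D.MArr_iff)
  have "D.mor w (map Go xs) (G_word w xs f) = D.mor (\<mu> (map Go xs)) (map Go xs) (snd (snd G (C.mor w xs f)))"
    unfolding G_word_def by (rule D.mor_change) (use a t Go_set[OF t(1)] D.choice_Y[OF Go_set[OF t(1)]] in simp_all)
  also have "\<dots> = snd G (C.mor w xs f)"
    using D.mor_self[OF g(1)] g(2) by simp
  finally show ?thesis ..
qed

lemma G_word_unique:
  assumes "typed w xs f" "snd G (C.mor w xs f) = D.mor w (map Go xs) h"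
    "h \<in> Arr D" "Dom D h = evO D w (map Go xs)"
  shows "G_word w xs f = h"
proof (rule D.mor_inject)
  show "D.mor w (map Go xs) (G_word w xs f) = D.mor w (map Go xs) h"
    using G_word_mor[OF assms(1)] assms(2) by simp
qed (use assms G_word_arr[OF assms(1)] in \<open>auto simp: typed_def\<close>)

text \<open>Precomposing with a canonical isomorphism changes the presentation and not the multimorphism, in both
  categories.\<close>

lemma G_word_change:
  assumes "typed v xs f" "u \<in> Y (length xs)"
  shows "G_word u xs (f \<cdot>\<^bsub>C\<^esub> can C u v xs) = G_word v xs f \<cdot> can D u v (map Go xs)"
proof (rule G_word_unique)
  have t: "set xs \<subseteq> Ob C" "v \<in> Y (length xs)" "f \<in> Arr C" "Dom C f = evO C v xs"
    using assms by (simp_all add: typed_def)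
  note a = G_word_arr[OF assms(1)] Go_set[OF t(1)]
  show "typed u xs (f \<cdot>\<^bsub>C\<^esub> can C u v xs)" using t assms(2) by (simp add: typed_def)
  have "D.mor u (map Go xs) (G_word v xs f \<cdot> can D u v (map Go xs)) = D.mor v (map Go xs) (G_word v xs f)"
    by (rule D.mor_change) (use a t assms(2) in simp_all)
  thus "snd G (C.mor u xs (f \<cdot>\<^bsub>C\<^esub> can C u v xs)) =
      D.mor u (map Go xs) (G_word v xs f \<cdot> can D u v (map Go xs))"
    using C.mor_change[OF t(1) assms(2) t(2-4)] G_word_mor[OF assms(1)] by simp
  show "G_word v xs f \<cdot> can D u v (map Go xs) \<in> Arr D"
    "Dom D (G_word v xs f \<cdot> can D u v (map Go xs)) = evO D u (map Go xs)"
    using a t assms(2) by simp_all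
qed

lemma G_word_idn:
  assumes "a \<in> Ob C"
  shows "G_word (WVar 0) [a] (idn C a) = idn D (Go a)"
proof (rule G_word_unique)
  show "typed (WVar 0) [a] (idn C a)" using assms by (simp add: typed_def Y_var)
  have "snd G (MId C.M a) = MId D.M (Go a)"
    using multifunctor assms by (simp add: multifunctor_def)
  thus "snd G (C.mor (WVar 0) [a] (idn C a)) = D.mor (WVar 0) (map Go [a]) (idn D (Go a))"
    using assms by (simp add: C.MId_mor D.MId_mor)
qed (use assms in simp_all)

text \<open>Preservation of composites by \<open>G\<close>, read at presentations.\<close>

lemma G_word_gamma:
  assumes w: "w \<in> Y (length xss)" and g: "g \<in> Arr C" "Dom C g = evO C w (map (Cod C) hs)"
    and l: "length ws = length xss" "length hs = length xss"
    and t: "\<And>s. s < length xss \<Longrightarrow> typed (ws ! s) (xss ! s) (hs ! s)"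
  shows "G_word (wgamma w ws) (concat xss) (g \<cdot>\<^bsub>C\<^esub> evA C w hs) =
    G_word w (map (Cod C) hs) g \<cdot> evA D w (map (\<lambda>s. G_word (ws ! s) (xss ! s) (hs ! s)) [0..<length xss])"
proof (rule G_word_unique)
  let ?es = "map (\<lambda>s. G_word (ws ! s) (xss ! s) (hs ! s)) [0..<length xss]" and ?ys = "map (Cod C) hs"
  let ?fs = "map (\<lambda>s. C.mor (ws ! s) (xss ! s) (hs ! s)) [0..<length xss]"
  have t': "set (xss ! s) \<subseteq> Ob C" "ws ! s \<in> Y (length (xss ! s))" "hs ! s \<in> Arr C"
    "Dom C (hs ! s) = evO C (ws ! s) (xss ! s)" if "s < length xss" for s
    using t[OF that] by (simp_all add: typed_def)
  have ws: "fits ws xss" "fits ws (map (map Go) xss)" using t' l by (simp_all add: fits_def)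
  have hsA: "set hs \<subseteq> Arr C" by (rule set_subset_nthI) (use t' l in simp)
  hence ys: "set ?ys \<subseteq> Ob C" by auto
  have X: "set (concat xss) \<subseteq> Ob C"
  proof -
    have "set xss \<subseteq> {xs. set xs \<subseteq> Ob C}" by (rule set_subset_nthI) (use t'(1) in simp)
    thus ?thesis by auto
  qed
  have tg: "typed w ?ys g" using w g l(2) ys by (simp add: typed_def)
  note gA = G_word_arr[OF tg]
  have dom: "map (Dom C) hs = map2 (evO C) ws xss" by (rule nth_equalityI) (use t' l in simp_all)
  have GY: "wgamma w ws \<in> Y (length (concat xss))" by (rule Y_wgamma[OF w ws(1)])
  show tt: "typed (wgamma w ws) (concat xss) (g \<cdot>\<^bsub>C\<^esub> evA C w hs)"
    using g hsA w l GY X C.evO_wgamma[OF ws(1) w] dom by (simp add: typed_def)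
  have comp: "C.mor (wgamma w ws) (concat xss) (g \<cdot>\<^bsub>C\<^esub> evA C w hs) = MComp C.M (C.mor w ?ys g) ?fs"
    by (rule C.mor_MComp[symmetric]) (use w g ws X l t' in simp_all)
  have co: "composable C.M (C.mor w ?ys g) ?fs"
    unfolding composable_def
  proof (intro conjI)
    show "C.mor w ?ys g \<in> MArr C.M" by (rule typed_MArr[OF tg])
    show "set ?fs \<subseteq> MArr C.M" by (rule set_subset_nthI) (use typed_MArr[OF t] in simp)
    show "MSrc C.M (C.mor w ?ys g) = map (MTgt C.M) ?fs"
      by (rule nth_equalityI) (use t' l in simp_all)
  qed
  have "snd G (MComp C.M (C.mor w ?ys g) ?fs) = MComp D.M (snd G (C.mor w ?ys g)) (map (snd G) ?fs)"
    by (rule G_MComp[OF co])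
  also have "snd G (C.mor w ?ys g) = D.mor w (map (Cod D) ?es) (G_word w ?ys g)"
  proof -
    have "map Go ?ys = map (Cod D) ?es"
      by (rule nth_equalityI) (use t G_word_arr l in simp_all)
    thus ?thesis using G_word_mor[OF tg] by simp
  qed
  also have "MComp D.M (D.mor w (map (Cod D) ?es) (G_word w ?ys g)) (map (snd G) ?fs) =
     D.mor (wgamma w ws) (concat (map (map Go) xss)) (G_word w ?ys g \<cdot> evA D w ?es)"
  proof (rule D.mor_MComp)
    have "map Go ?ys = map (Cod D) ?es"
      by (rule nth_equalityI) (use t G_word_arr l in simp_all)
    thus "Dom D (G_word w ?ys g) = evO D w (map (Cod D) ?es)" using gA by simp
    show "set (concat (map (map Go) xss)) \<subseteq> Ob D" using X by auto
  qed (use w gA ws t t' G_word_arr G_word_mor in simp_all)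
  also have "concat (map (map Go) xss) = map Go (concat xss)" by (simp add: map_concat)
  finally show "snd G (C.mor (wgamma w ws) (concat xss) (g \<cdot>\<^bsub>C\<^esub> evA C w hs)) =
    D.mor (wgamma w ws) (map Go (concat xss)) (G_word w ?ys g \<cdot> evA D w ?es)"
    unfolding comp .
  have esA: "set ?es \<subseteq> Arr D" by (rule set_subset_nthI) (use t G_word_arr in simp)
  have cod: "map (Cod D) ?es = map Go ?ys"
    by (rule nth_equalityI) (use t G_word_arr l in simp_all)
  have de: "map (Dom D) ?es = map2 (evO D) ws (map (map Go) xss)"
    by (rule nth_equalityI) (use t G_word_arr l in simp_all)
  have eA: "evA D w ?es \<in> Arr D" "Cod D (evA D w ?es) = evO D w (map Go ?ys)"
    "Dom D (evA D w ?es) = evO D (wgamma w ws) (map Go (concat xss))"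
    using D.evA_simps[OF esA, of w] w D.evO_wgamma[OF ws(2), of w] unfolding cod de by (simp_all add: map_concat)
  show "G_word w ?ys g \<cdot> evA D w ?es \<in> Arr D"
    "Dom D (G_word w ?ys g \<cdot> evA D w ?es) = evO D (wgamma w ws) (map Go (concat xss))"
    using gA eA by simp_all
qed

lemma G_word_wact:
  assumes t: "typed w xs f" and \<sigma>: "\<sigma> permutes {..<length xs}"
  shows "G_word (wact w \<sigma>) (permute_list \<sigma> xs) f = G_word w xs f"
proof (rule G_word_unique)
  have t': "set xs \<subseteq> Ob C" "w \<in> Y (length xs)" "f \<in> Arr C" "Dom C f = evO C w xs"
    using t by (simp_all add: typed_def)
  show "typed (wact w \<sigma>) (permute_list \<sigma> xs) f"
    using t' \<sigma> by (simp add: typed_def Y_wact C.evO_wact)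
  have "snd G (C.mor (wact w \<sigma>) (permute_list \<sigma> xs) f) = snd G (MAct C.M \<sigma> (C.mor w xs f))"
    using C.mor_MAct[OF t' \<sigma>] by simp
  also have "\<dots> = MAct D.M \<sigma> (snd G (C.mor w xs f))"
    using multifunctor typed_MArr[OF t] \<sigma> by (simp add: multifunctor_def)
  also have "\<dots> = D.mor (wact w \<sigma>) (permute_list \<sigma> (map Go xs)) (G_word w xs f)"
    unfolding G_word_mor[OF t]
    by (rule D.mor_MAct) (use G_word_arr[OF t] Go_set[OF t'(1)] t' \<sigma> in simp_all)
  finally show "snd G (C.mor (wact w \<sigma>) (permute_list \<sigma> xs) f) =
     D.mor (wact w \<sigma>) (map Go (permute_list \<sigma> xs)) (G_word w xs f)"
    using \<sigma> by (simp add: permute_list_map)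
  show "G_word w xs f \<in> Arr D" "Dom D (G_word w xs f) = evO D (wact w \<sigma>) (map Go (permute_list \<sigma> xs))"
    using G_word_arr[OF t] D.evO_wact[of w "map Go xs" \<sigma>] t' \<sigma> by (simp_all add: permute_list_map)
qed

abbreviation G_map :: "'a1 \<Rightarrow> 'a2" where
  "G_map f \<equiv> G_word (WVar 0) [Dom C f] f"

abbreviation G_xi :: "'o1 \<Rightarrow> 'o1 \<Rightarrow> 'a2" where
  "G_xi a b \<equiv> G_word m_word [a, b] (idn C (a \<oplus>\<^bsub>C\<^esub> b))"

lemma typed_simps [simp]:
  "f \<in> Arr C \<Longrightarrow> typed (WVar 0) [Dom C f] f"
  "a \<in> Ob C \<Longrightarrow> typed (WVar 0) [a] (idn C a)"
  "\<lbrakk>a \<in> Ob C; b \<in> Ob C\<rbrakk> \<Longrightarrow> typed m_word [a, b] (idn C (a \<oplus>\<^bsub>C\<^esub> b))"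
  "typed WE [] (idn C (munit C))"
  by (simp_all add: typed_def Y_var m_word_Y)

text \<open>Composition with a unary morphism, that is, substitution into the word \<open>x\<^sub>1\<close>.\<close>

lemma G_word_post:
  assumes "typed w xs f" "g \<in> Arr C" "Dom C g = Cod C f"
  shows "G_word w xs (g \<cdot>\<^bsub>C\<^esub> f) = G_map g \<cdot> G_word w xs f"
  using G_word_gamma[of "WVar 0" "[xs]" g "[f]" "[w]"] assms by (simp add: Y_var wgamma_var)

text \<open>Substitution into the word \<open>x\<^sub>1 \<oplus> x\<^sub>2\<close>.\<close>

lemma G_word_ten:
  assumes "typed u xs f" "typed v ys g"
  shows "G_word (wgamma m_word [u, v]) (xs @ ys) (f \<boxplus>\<^bsub>C\<^esub> g) =
    G_xi (Cod C f) (Cod C g) \<cdot> (G_word u xs f \<boxplus> G_word v ys g)"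
proof -
  have a: "f \<in> Arr C" "g \<in> Arr C" using assms by (simp_all add: typed_def)
  have "G_word (wgamma m_word [u, v]) (concat [xs, ys]) (idn C (Cod C f \<oplus>\<^bsub>C\<^esub> Cod C g) \<cdot>\<^bsub>C\<^esub> evA C m_word [f, g]) =
    G_word m_word (map (Cod C) [f, g]) (idn C (Cod C f \<oplus>\<^bsub>C\<^esub> Cod C g)) \<cdot>
     evA D m_word (map (\<lambda>s. G_word ([u, v] ! s) ([xs, ys] ! s) ([f, g] ! s)) [0..<length [xs, ys]])"
    by (rule G_word_gamma) (use assms a in \<open>auto simp: m_word_Y less_Suc_eq\<close>)
  thus ?thesis using a by (simp add: upt_rec)
qed

lemma G_map_simps [simp]:
  assumes "f \<in> Arr C" "Dom C f = a"
  shows "G_word (WVar 0) [a] f \<in> Arr D" "Dom D (G_word (WVar 0) [a] f) = Go a"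
    "Cod D (G_word (WVar 0) [a] f) = Go (Cod C f)"
  using G_word_arr[of "WVar 0" "[a]" f] assms C.Dom_in'[OF assms(1)] by (simp_all add: typed_def Y_var)

lemma G_xi_simps [simp]:
  assumes "a \<in> Ob C" "b \<in> Ob C"
  shows "G_xi a b \<in> Arr D" "Dom D (G_xi a b) = Go a \<oplus> Go b" "Cod D (G_xi a b) = Go (a \<oplus>\<^bsub>C\<^esub> b)"
  using G_word_arr[of m_word "[a, b]" "idn C (a \<oplus>\<^bsub>C\<^esub> b)"] assms by simp_all

lemma G_eta_simps [simp]:
  "G_word WE [] (idn C (munit C)) \<in> Arr D" "Dom D (G_word WE [] (idn C (munit C))) = munit D"
  "Cod D (G_word WE [] (idn C (munit C))) = Go (munit C)"
  using G_word_arr[of WE "[]" "idn C (munit C)"] by simp_all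

lemma G_word_structure:
  assumes "typed v xs f" "canonical C xs u v h" "canonical D (map Go xs) u v h'" "u \<in> Y (length xs)"
  shows "G_word u xs (f \<cdot>\<^bsub>C\<^esub> h) = G_word v xs f \<cdot> h'"
proof -
  have "set xs \<subseteq> Ob C" using assms(1) by (simp add: typed_def)
  hence "can C u v xs = h" "can D u v (map Go xs) = h'"
    using C.can_eqI[OF assms(2)] D.can_eqI[OF assms(3)] Go_set assms(4) by simp_all
  thus ?thesis using G_word_change[OF assms(1,4)] by simp
qed

text \<open>The tensor product of two arrows is presented at \<open>x\<^sub>1 \<oplus> x\<^sub>2\<close>, and this word results both from
  substituting it into \<open>x\<^sub>1\<close> and from substituting \<open>x\<^sub>1\<close> twice into it.\<close>

lemma G_xi_natural:
  assumes "f \<in> Arr C" "g \<in> Arr C"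
  shows "G_map (f \<boxplus>\<^bsub>C\<^esub> g) \<cdot> G_xi (Dom C f) (Dom C g) = G_xi (Cod C f) (Cod C g) \<cdot> (G_map f \<boxplus> G_map g)"
proof -
  have "G_word m_word [Dom C f, Dom C g] (f \<boxplus>\<^bsub>C\<^esub> g) = G_xi (Cod C f) (Cod C g) \<cdot> (G_map f \<boxplus> G_map g)"
    using G_word_ten[of "WVar 0" "[Dom C f]" f "WVar 0" "[Dom C g]" g] assms by (simp add: wgamma_m_word)
  thus ?thesis
    using G_word_post[of m_word "[Dom C f, Dom C g]" "idn C (Dom C f \<oplus>\<^bsub>C\<^esub> Dom C g)" "f \<boxplus>\<^bsub>C\<^esub> g"] assms by simp
qed

text \<open>The composite of \<open>\<xi>\<close> with the unit map is \<open>G_word\<close> at the word \<open>x\<^sub>1 \<oplus> e\<close>, and the unit isomorphism is the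
  canonical isomorphism from this word to \<open>x\<^sub>1\<close>.\<close>

lemma G_xi_runit:
  assumes a: "a \<in> Ob C"
  shows "G_map (runit C a) \<cdot> (G_xi a (munit C) \<cdot> (idn D (Go a) \<boxplus> G_word WE [] (idn C (munit C)))) = runit D (Go a)"
proof -
  let ?w = "WTen (WVar 0) WE"
  have 1: "G_word ?w [a] (idn C (a \<oplus>\<^bsub>C\<^esub> munit C)) =
      G_xi a (munit C) \<cdot> (idn D (Go a) \<boxplus> G_word WE [] (idn C (munit C)))"
    using G_word_ten[of "WVar 0" "[a]" "idn C a" WE "[]" "idn C (munit C)"] a by (simp add: wgamma_m_word G_word_idn)
  have t: "typed ?w [a] (idn C (a \<oplus>\<^bsub>C\<^esub> munit C))" using a by (simp add: typed_def m_word_Y)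
  have "G_word ?w [a] (idn C a \<cdot>\<^bsub>C\<^esub> runit C a) = G_word (WVar 0) [a] (idn C a) \<cdot> runit D (Go a)"
    by (rule G_word_structure)
     (use a can_runit[of C "[a]" "WVar 0"] can_runit[of D "map Go [a]" "WVar 0"] in \<open>simp_all add: m_word_Y\<close>)
  hence "G_word ?w [a] (runit C a) = runit D (Go a)" using a by (simp add: G_word_idn)
  thus ?thesis using G_word_post[OF t, of "runit C a"] a by (simp add: 1)
qed

text \<open>The two iterated structure maps are \<open>G_word\<close> at the two bracketings of three variables, which are
  related by the associator.\<close>

lemma G_xi_assc:
  assumes a: "a \<in> Ob C" "b \<in> Ob C" "c \<in> Ob C"
  shows "G_map (assc C a b c) \<cdot> (G_xi (a \<oplus>\<^bsub>C\<^esub> b) c \<cdot> (G_xi a b \<boxplus> idn D (Go c))) =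
    G_xi a (b \<oplus>\<^bsub>C\<^esub> c) \<cdot> ((idn D (Go a) \<boxplus> G_xi b c) \<cdot> assc D (Go a) (Go b) (Go c))"
proof -
  let ?u = "WTen m_word (WVar (Suc (Suc 0)))"
  let ?v = "WTen (WVar 0) (WTen (WVar (Suc 0)) (WVar (Suc (Suc 0))))"
  have 1: "G_word ?u [a, b, c] (idn C ((a \<oplus>\<^bsub>C\<^esub> b) \<oplus>\<^bsub>C\<^esub> c)) = G_xi (a \<oplus>\<^bsub>C\<^esub> b) c \<cdot> (G_xi a b \<boxplus> idn D (Go c))"
    using G_word_ten[of m_word "[a, b]" "idn C (a \<oplus>\<^bsub>C\<^esub> b)" "WVar 0" "[c]" "idn C c"] a
    by (simp add: wgamma_m_word G_word_idn)
  have 2: "G_word ?v [a, b, c] (idn C (a \<oplus>\<^bsub>C\<^esub> (b \<oplus>\<^bsub>C\<^esub> c))) = G_xi a (b \<oplus>\<^bsub>C\<^esub> c) \<cdot> (idn D (Go a) \<boxplus> G_xi b c)"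
    using G_word_ten[of "WVar 0" "[a]" "idn C a" m_word "[b, c]" "idn C (b \<oplus>\<^bsub>C\<^esub> c)"] a
    by (simp add: wgamma_m_word G_word_idn)
  have t: "typed ?u [a, b, c] (idn C ((a \<oplus>\<^bsub>C\<^esub> b) \<oplus>\<^bsub>C\<^esub> c))" "typed ?v [a, b, c] (idn C (a \<oplus>\<^bsub>C\<^esub> (b \<oplus>\<^bsub>C\<^esub> c)))"
    using a by (simp_all add: typed_def m_word_Y)
  have "G_word ?u [a, b, c] (idn C (a \<oplus>\<^bsub>C\<^esub> (b \<oplus>\<^bsub>C\<^esub> c)) \<cdot>\<^bsub>C\<^esub> assc C a b c) =
     G_word ?v [a, b, c] (idn C (a \<oplus>\<^bsub>C\<^esub> (b \<oplus>\<^bsub>C\<^esub> c))) \<cdot> assc D (Go a) (Go b) (Go c)"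
    by (rule G_word_structure[OF t(2)])
     (use can_assc[of C "[a, b, c]" "WVar 0" "WVar (Suc 0)" "WVar (Suc (Suc 0))"]
        can_assc[of D "map Go [a, b, c]" "WVar 0" "WVar (Suc 0)" "WVar (Suc (Suc 0))"] in \<open>simp_all add: m_word_Y\<close>)
  thus ?thesis using G_word_post[OF t(1), of "assc C a b c"] a by (simp add: 1 2)
qed

text \<open>The symmetry relates the words \<open>x\<^sub>1 \<oplus> x\<^sub>2\<close> and \<open>x\<^sub>2 \<oplus> x\<^sub>1\<close>, and the second is the image of the first under
  the transposition, so that preservation of the group action by \<open>G\<close> gives the axiom.\<close>

lemma G_xi_sym:
  assumes a: "a \<in> Ob C" "b \<in> Ob C"
  shows "G_map (sym C a b) \<cdot> G_xi a b = G_xi b a \<cdot> sym D (Go a) (Go b)"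
proof -
  let ?v = "WTen (WVar (Suc 0)) (WVar 0)" and ?\<tau> = "Transposition.transpose 0 (Suc 0)"
  have \<tau>: "?\<tau> permutes {..<length [b, a]}" by (rule permutes_swap_id) simp_all
  have "wact m_word ?\<tau> = ?v" by (simp add: wact_def)
  moreover have "permute_list ?\<tau> [b, a] = [a, b]" by (simp add: permute_list_def upt_rec)
  ultimately have 1: "G_word ?v [a, b] (idn C (b \<oplus>\<^bsub>C\<^esub> a)) = G_xi b a"
    using G_word_wact[of m_word "[b, a]" "idn C (b \<oplus>\<^bsub>C\<^esub> a)" ?\<tau>] a \<tau> by simp
  have t: "typed ?v [a, b] (idn C (b \<oplus>\<^bsub>C\<^esub> a))" using a by (simp add: typed_def m_word_Y)
  have "G_word m_word [a, b] (idn C (b \<oplus>\<^bsub>C\<^esub> a) \<cdot>\<^bsub>C\<^esub> sym C a b) = G_word ?v [a, b] (idn C (b \<oplus>\<^bsub>C\<^esub> a)) \<cdot> sym D (Go a) (Go b)"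
    by (rule G_word_structure[OF t])
     (use can_sym[of C "[a, b]" "WVar 0" "WVar (Suc 0)"]
        can_sym[of D "map Go [a, b]" "WVar 0" "WVar (Suc 0)"] in \<open>simp_all add: m_word_Y\<close>)
  thus ?thesis
    using G_word_post[of m_word "[a, b]" "idn C (a \<oplus>\<^bsub>C\<^esub> b)" "sym C a b"] a by (simp add: 1)
qed

text \<open>The lax functor read off from \<open>G\<close> at the words \<open>x\<^sub>1\<close>, \<open>e\<close> and \<open>x\<^sub>1 \<oplus> x\<^sub>2\<close>.\<close>

definition lax_of :: "('o1, 'a1, 'o2, 'a2) lax" where
  "lax_of = \<lparr>FOb = Go, FArr = restrict G_map (Arr C), Feta = G_word WE [] (idn C (munit C)),
     Fxi = (\<lambda>a b. if a \<in> Ob C \<and> b \<in> Ob C then G_xi a b else undefined)\<rparr>"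

lemma lax_smf_lax_of: "lax_smf C D lax_of"
proof -
  have fct: "is_functor C D Go (restrict G_map (Arr C))"
    unfolding is_functor_def
  proof (intro conjI ballI impI)
    show "category C" "category D" by unfold_locales
    fix f g assume "f \<in> Arr C" "g \<in> Arr C" "Cod C f = Dom C g"
    thus "restrict G_map (Arr C) (g \<cdot>\<^bsub>C\<^esub> f) = restrict G_map (Arr C) g \<cdot> restrict G_map (Arr C) f"
      using G_word_post[of "WVar 0" "[Dom C f]" f g] by simp
  qed (simp_all add: hom_def G_word_idn)
  have ext: "Go \<in> extensional (Ob C)" using multifunctor by (simp add: multifunctor_def)
  show ?thesis
    unfolding lax_smf_def
    using fct ext G_xi_natural G_xi_runit G_xi_assc G_xi_sym
    by (simp add: lax_of_def hom_def)
qed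

sublocale L: lax_choice C \<kappa> D \<mu> lax_of
  by unfold_locales (rule lax_smf_lax_of)

lemma xi_word_append:
  "set (wvars w) \<subseteq> {..<length xs} \<Longrightarrow> L.xi_word w (xs @ ys) = L.xi_word w xs \<and> evO C w (xs @ ys) = evO C w xs"
  by (induction w) (auto simp: nth_append)

lemma lax_of_simps [simp]:
  "FOb lax_of = Go" "f \<in> Arr C \<Longrightarrow> FArr lax_of f = G_map f" "Feta lax_of = G_word WE [] (idn C (munit C))"
  "\<lbrakk>a \<in> Ob C; b \<in> Ob C\<rbrakk> \<Longrightarrow> Fxi lax_of a b = G_xi a b"
  by (simp_all add: lax_of_def)

text \<open>The words \<open>k\<^sub>n\<close> are obtained from \<open>e\<close> and \<open>x\<^sub>1\<close> by repeated substitution into \<open>x\<^sub>1 \<oplus> x\<^sub>2\<close>.\<close>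

lemma G_word_kword:
  "\<lbrakk>set xs \<subseteq> Ob C; length xs = n\<rbrakk> \<Longrightarrow> G_word (kword n) xs (idn C (evO C (kword n) xs)) = L.xi_word (kword n) xs"
proof (induction n arbitrary: xs rule: kword.induct)
  case 1
  then show ?case by simp
next
  case (2 xs)
  then obtain a where "xs = [a]" by (cases xs) auto
  thus ?case using 2 by (simp add: G_word_idn)
next
  case (3 n)
  obtain ys y where xs: "xs = ys @ [y]" using 3(3) by (cases xs rule: rev_cases) auto
  have y: "set ys \<subseteq> Ob C" "y \<in> Ob C" "length ys = Suc n" using 3(2,3) xs by auto
  have k: "kword (Suc n) \<in> Y (length ys)" using kword_Y y by simp
  have t: "typed (kword (Suc n)) ys (idn C (evO C (kword (Suc n)) ys))"
    using y k by (simp add: typed_def del: kword.simps)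
  have r: "L.xi_word (kword (Suc n)) (ys @ [y]) = L.xi_word (kword (Suc n)) ys"
     "evO C (kword (Suc n)) (ys @ [y]) = evO C (kword (Suc n)) ys"
    using xi_word_append[of "kword (Suc n)" ys "[y]"] k by (simp_all add: Y_range del: kword.simps)
  have o: "evO C (kword (Suc n)) ys \<in> Ob C" using y k by (simp del: kword.simps)
  have IH: "G_word (kword (Suc n)) ys (idn C (evO C (kword (Suc n)) ys)) = L.xi_word (kword (Suc n)) ys"
    by (rule 3(1)) (use y in simp_all)
  have "G_word (kword (Suc (Suc n))) xs (idn C (evO C (kword (Suc (Suc n))) xs)) =
    G_word (wgamma m_word [kword (Suc n), WVar 0]) (ys @ [y])
      (idn C (evO C (kword (Suc n)) ys) \<boxplus>\<^bsub>C\<^esub> idn C y)"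
  proof -
    have "kword (Suc (Suc n)) = wgamma m_word [kword (Suc n), WVar 0]" by simp
    moreover have "idn C (evO C (kword (Suc (Suc n))) xs) = idn C (evO C (kword (Suc n)) ys) \<boxplus>\<^bsub>C\<^esub> idn C y"
      unfolding kword_Suc xs using y o r(2) by (simp add: nth_append del: kword.simps)
    ultimately show ?thesis unfolding xs by simp
  qed
  also have "\<dots> = G_xi (evO C (kword (Suc n)) ys) y \<cdot>
      (L.xi_word (kword (Suc n)) ys \<boxplus> idn D (Go y))"
    using G_word_ten[OF t, of "WVar 0" "[y]" "idn C y"] y o IH by (simp add: G_word_idn del: kword.simps)
  also have "\<dots> = L.xi_word (kword (Suc (Suc n))) xs"
    unfolding kword_Suc xs using y o r by (simp add: nth_append del: kword.simps)
  finally show ?case .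
qed

text \<open>The equation holds at \<open>k\<^sub>n\<close>, and both sides behave in the same way under the canonical isomorphism from
  \<open>k\<^sub>n\<close> to \<open>w\<close>.\<close>

lemma G_word_eq_xi_word:
  assumes "typed w xs f"
  shows "G_word w xs f = G_map f \<cdot> L.xi_word w xs"
proof -
  have t: "set xs \<subseteq> Ob C" "w \<in> Y (length xs)" "f \<in> Arr C" "Dom C f = evO C w xs"
    using assms by (simp_all add: typed_def)
  let ?k = "kword (length xs)" and ?ys = "map Go xs"
  have ys: "set ?ys \<subseteq> Ob D" "w \<in> Y (length ?ys)" "?k \<in> Y (length ?ys)" "?k \<in> Y (length xs)"
    using Go_set[OF t(1)] t(2) kword_Y by simp_all
  have ti: "typed w xs (idn C (evO C w xs))" "typed ?k xs (idn C (evO C ?k xs))"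
    using t ys by (simp_all add: typed_def)
  have c: "can C ?k w xs \<in> Arr C" "Dom C (can C ?k w xs) = evO C ?k xs" "Cod C (can C ?k w xs) = evO C w xs"
    using t ys by simp_all
  have "G_word w xs (idn C (evO C w xs)) \<cdot> can D ?k w ?ys = G_word ?k xs (can C ?k w xs)"
    using G_word_change[OF ti(1) ys(4)] c by simp
  also have "\<dots> = G_map (can C ?k w xs) \<cdot> L.xi_word ?k xs"
    using G_word_post[OF ti(2), of "can C ?k w xs"] c t ys G_word_kword[OF t(1)] by simp
  also have "\<dots> = L.xi_word w xs \<cdot> can D ?k w ?ys"
    using L.xi_word_can[OF t(1) ys(4) t(2)] c by simp
  finally have e: "G_word w xs (idn C (evO C w xs)) \<cdot> can D ?k w ?ys = L.xi_word w xs \<cdot> can D ?k w ?ys" .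
  have "(G_word w xs (idn C (evO C w xs)) \<cdot> can D ?k w ?ys) \<cdot> can D w ?k ?ys =
     (L.xi_word w xs \<cdot> can D ?k w ?ys) \<cdot> can D w ?k ?ys"
    unfolding e ..
  hence "G_word w xs (idn C (evO C w xs)) = L.xi_word w xs"
    using G_word_arr[OF ti(1)] L.xi_word_simps[OF t(1,2)] t ys by simp
  thus ?thesis using G_word_post[OF ti(1) t(3)] t by simp
qed

lemma UF_lax_of: "UF C \<kappa> D \<mu> lax_of = G"
proof (rule prod_eqI)
  have ext: "Go \<in> extensional (Ob C)" "snd G \<in> extensional (MArr C.M)"
    using multifunctor by (simp_all add: multifunctor_def)
  show "fst (UF C \<kappa> D \<mu> lax_of) = fst G"
    using ext(1) by (simp add: L.fst_UF extensional_restrict)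
  show "snd (UF C \<kappa> D \<mu> lax_of) = snd G"
  proof (rule extensionalityI[OF L.snd_UF_extensional ext(2)])
    fix f assume f: "f \<in> MArr C.M"
    have t: "typed (\<kappa> (fst f)) (fst f) (snd f)" using f by (simp add: C.MArr_iff typed_def)
    have "snd (UF C \<kappa> D \<mu> lax_of) f = D.mor (\<kappa> (fst f)) (map Go (fst f)) (G_word (\<kappa> (fst f)) (fst f) (snd f))"
      using L.UF_arr[of "fst f" "snd f"] f G_word_eq_xi_word[OF t] by (simp add: C.MArr_iff)
    also have "\<dots> = snd G f" using G_word_mor[OF t] C.mor_self[OF f] by simp
    finally show "snd (UF C \<kappa> D \<mu> lax_of) f = snd G f" .
  qed
qed

end

section \<open>The equivalence\<close>

lemma lax_eqI:
  assumes "lax_smf C D F" "lax_smf C D F'"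
    and "\<And>a. a \<in> Ob C \<Longrightarrow> FOb F a = FOb F' a" "\<And>f. f \<in> Arr C \<Longrightarrow> FArr F f = FArr F' f"
    and "Feta F = Feta F'" "\<And>a b. \<lbrakk>a \<in> Ob C; b \<in> Ob C\<rbrakk> \<Longrightarrow> Fxi F a b = Fxi F' a b"
  shows "F = F'"
proof (rule lax.equality)
  have ext: "FOb F \<in> extensional (Ob C)" "FOb F' \<in> extensional (Ob C)"
    "FArr F \<in> extensional (Arr C)" "FArr F' \<in> extensional (Arr C)"
    "\<And>a b. \<not> (a \<in> Ob C \<and> b \<in> Ob C) \<Longrightarrow> Fxi F a b = undefined"
    "\<And>a b. \<not> (a \<in> Ob C \<and> b \<in> Ob C) \<Longrightarrow> Fxi F' a b = undefined"
    using assms(1,2) by (simp_all add: lax_smf_def)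
  show "FOb F = FOb F'" by (rule extensionalityI[OF ext(1,2) assms(3)])
  show "FArr F = FArr F'" by (rule extensionalityI[OF ext(3,4) assms(4)])
  show "Fxi F = Fxi F'"
  proof (intro HOL.ext)
    fix a b show "Fxi F a b = Fxi F' a b"
      by (cases "a \<in> Ob C \<and> b \<in> Ob C") (simp_all add: assms(6) ext(5,6))
  qed
qed (use assms(5) in simp_all)

text \<open>By \<open>UF_mor\<close> the multifunctor determines all composites \<open>F f \<cdot> xi_word w xs\<close>.  At the words \<open>x\<^sub>1\<close>, \<open>e\<close> and
  \<open>x\<^sub>1 \<oplus> x\<^sub>2\<close> these are the components of \<open>F\<close>.\<close>

lemma (in lax_choice) UF_determines:
  assumes "lax_choice C \<kappa> D \<mu> F'" "UF C \<kappa> D \<mu> F = UF C \<kappa> D \<mu> F'"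
  shows "F = F'"
proof -
  interpret L: lax_choice C \<kappa> D \<mu> F' by (rule assms(1))
  have ext: "FOb F \<in> extensional (Ob C)" "FOb F' \<in> extensional (Ob C)"
    using lax L.lax by (simp_all add: lax_smf_def)
  have "restrict (FOb F) (Ob C) = restrict (FOb F') (Ob C)"
    using fst_UF L.fst_UF assms(2) by metis
  hence o: "FOb F = FOb F'" using ext by (simp add: extensional_restrict)
  have *: "FArr F f \<cdot> xi_word w xs = FArr F' f \<cdot> L.xi_word w xs"
    if "set xs \<subseteq> Ob C" "w \<in> Y (length xs)" "f \<in> Arr C" "Dom C f = evO C w xs" for w xs f
  proof (rule D.mor_inject)
    show "D.mor w (map (FOb F) xs) (FArr F f \<cdot> xi_word w xs) =
        D.mor w (map (FOb F) xs) (FArr F' f \<cdot> L.xi_word w xs)"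
      using UF_mor[OF that] L.UF_mor[OF that] assms(2) o by simp
    show "FArr F' f \<cdot> L.xi_word w xs \<in> Arr D"
      "Dom D (FArr F' f \<cdot> L.xi_word w xs) = evO D w (map (FOb F) xs)"
      using that o by simp_all
    show "set (map (FOb F) xs) \<subseteq> Ob D" using that(1) by auto
  qed (use that in simp_all)
  show ?thesis
  proof (rule lax_eqI[OF lax L.lax])
    show "FOb F a = FOb F' a" for a by (simp add: o)
    show "FArr F f = FArr F' f" if "f \<in> Arr C" for f
      using *[of "[Dom C f]" "WVar 0" f] that o
        D.cmp_idn[of "FArr F f" "FOb F' (Dom C f)"] by (simp add: Y_var)
    show "Feta F = Feta F'"
      using *[of "[]" WE "idn C (munit C)"] by (simp add: m_word_Y)
    fix x y assume xy: "x \<in> Ob C" "y \<in> Ob C"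
    have r: "Fxi F x y \<in> Arr D" "Dom D (Fxi F x y) = FOb F' x \<oplus> FOb F' y"
      "Cod D (Fxi F x y) = FOb F' (x \<oplus>\<^bsub>C\<^esub> y)" using xy o by simp_all
    show "Fxi F x y = Fxi F' x y"
      using *[of "[x, y]" m_word "idn C (x \<oplus>\<^bsub>C\<^esub> y)"] xy r by (simp add: m_word_Y o)
  qed
qed

lemma UF_bijective:
  assumes C: "smc_choice C \<kappa>" and D: "smc_choice D \<mu>"
  shows "lax_smf C D F \<Longrightarrow> multifunctor (Umult C \<kappa>) (Umult D \<mu>) (UF C \<kappa> D \<mu> F)"
    and "multifunctor (Umult C \<kappa>) (Umult D \<mu>) G \<Longrightarrow> \<exists>!F. lax_smf C D F \<and> UF C \<kappa> D \<mu> F = G"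
proof -
  interpret C: smc_choice C \<kappa> by (rule C)
  interpret D: smc_choice D \<mu> by (rule D)
  have L: "lax_choice C \<kappa> D \<mu> F" if "lax_smf C D F" for F
    using that by unfold_locales
  show "multifunctor (Umult C \<kappa>) (Umult D \<mu>) (UF C \<kappa> D \<mu> F)" if "lax_smf C D F"
    by (rule lax_choice.multifunctor_UF[OF L[OF that]])
  assume "multifunctor (Umult C \<kappa>) (Umult D \<mu>) G"
  then interpret G: multifunctor_choice C \<kappa> D \<mu> G by unfold_locales
  show "\<exists>!F. lax_smf C D F \<and> UF C \<kappa> D \<mu> F = G"
  proof (rule ex1I)
    show "lax_smf C D G.lax_of \<and> UF C \<kappa> D \<mu> G.lax_of = G"
      using G.lax_smf_lax_of G.UF_lax_of by blast
    fix F assume F: "lax_smf C D F \<and> UF C \<kappa> D \<mu> F = G"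
    show "F = G.lax_of"
      by (rule lax_choice.UF_determines[OF L L]) (use F G.lax_smf_lax_of G.UF_lax_of in auto)
  qed
qed

lemma multifunctor_id: "multicategory M \<Longrightarrow> multifunctor M M (mfun_id M)"
proof -
  assume "multicategory M"
  then interpret multicategory M .
  have s: "map (\<lambda>f\<in>MArr M. f) fs = fs" if "set fs \<subseteq> MArr M" for fs
    using that by (intro map_idI) auto
  have o: "map (\<lambda>a\<in>MOb M. a) (MSrc M f) = MSrc M f" if "f \<in> MArr M" for f
    using src_in[OF that] by (intro map_idI) auto
  show ?thesis
    unfolding multifunctor_def mfun_id_def
    using comp_in act_in id_in tgt_in s o by (auto simp: composable_def multicategory_axioms)
qed

lemma multifunctor_comp:
  assumes "multifunctor M N G" "multifunctor N P H"
  shows "multifunctor M P (mfun_comp M H G)"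
proof -
  have G: "\<And>a. a \<in> MOb M \<Longrightarrow> fst G a \<in> MOb N"
    "\<And>f. f \<in> MArr M \<Longrightarrow> snd G f \<in> MArr N"
    "\<And>f. f \<in> MArr M \<Longrightarrow> MSrc N (snd G f) = map (fst G) (MSrc M f)"
    "\<And>f. f \<in> MArr M \<Longrightarrow> MTgt N (snd G f) = fst G (MTgt M f)"
    "\<And>a. a \<in> MOb M \<Longrightarrow> snd G (MId M a) = MId N (fst G a)"
    "\<And>g fs. composable M g fs \<Longrightarrow> snd G (MComp M g fs) = MComp N (snd G g) (map (snd G) fs)"
    "\<And>f \<sigma>. \<lbrakk>f \<in> MArr M; \<sigma> permutes {..<length (MSrc M f)}\<rbrakk> \<Longrightarrow> snd G (MAct M \<sigma> f) = MAct N \<sigma> (snd G f)"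
    using assms(1) unfolding multifunctor_def by blast+
  have H: "\<And>a. a \<in> MOb N \<Longrightarrow> fst H a \<in> MOb P"
    "\<And>f. f \<in> MArr N \<Longrightarrow> snd H f \<in> MArr P"
    "\<And>f. f \<in> MArr N \<Longrightarrow> MSrc P (snd H f) = map (fst H) (MSrc N f)"
    "\<And>f. f \<in> MArr N \<Longrightarrow> MTgt P (snd H f) = fst H (MTgt N f)"
    "\<And>a. a \<in> MOb N \<Longrightarrow> snd H (MId N a) = MId P (fst H a)"
    "\<And>g fs. composable N g fs \<Longrightarrow> snd H (MComp N g fs) = MComp P (snd H g) (map (snd H) fs)"
    "\<And>f \<sigma>. \<lbrakk>f \<in> MArr N; \<sigma> permutes {..<length (MSrc N f)}\<rbrakk> \<Longrightarrow> snd H (MAct N \<sigma> f) = MAct P \<sigma> (snd H f)"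
    using assms(2) unfolding multifunctor_def by blast+
  interpret M: multicategory M using assms(1) by (simp add: multifunctor_def)
  interpret P: multicategory P using assms(2) by (simp add: multifunctor_def)
  let ?K = "mfun_comp M H G"
  have o: "fst ?K a = fst H (fst G a)" if "a \<in> MOb M" for a using that by (simp add: mfun_comp_def compose_def)
  have a: "snd ?K f = snd H (snd G f)" if "f \<in> MArr M" for f using that by (simp add: mfun_comp_def compose_def)
  show ?thesis
    unfolding multifunctor_def
  proof (intro conjI ballI allI impI)
    show "multicategory M" "multicategory P" by unfold_locales
    show "fst ?K \<in> extensional (MOb M)" "snd ?K \<in> extensional (MArr M)" by (simp_all add: mfun_comp_def)
    show "fst ?K a \<in> MOb P" if "a \<in> MOb M" for a using that by (simp add: o G H)
    show "snd ?K f \<in> MArr P" if "f \<in> MArr M" for f using that by (simp add: a G H)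
    show "MTgt P (snd ?K f) = fst ?K (MTgt M f)" if "f \<in> MArr M" for f
      using that M.tgt_in[OF that] by (simp add: a o G H)
    show "MSrc P (snd ?K f) = map (fst ?K) (MSrc M f)" if "f \<in> MArr M" for f
      using that M.src_in[OF that] by (auto simp: a o G H)
    show "snd ?K (MId M a) = MId P (fst ?K a)" if "a \<in> MOb M" for a
      using that M.id_in[OF that] by (simp add: a o G H)
    show "snd ?K (MAct M \<sigma> f) = MAct P \<sigma> (snd ?K f)" if "f \<in> MArr M" "\<sigma> permutes {..<length (MSrc M f)}" for f \<sigma>
      using that M.act_in[OF that] by (simp add: a G H)
    fix g fs assume c: "composable M g fs"
    have c': "composable N (snd G g) (map (snd G) fs)"
      using c by (auto simp: composable_def G)
    have m: "map (snd ?K) fs = map (snd H) (map (snd G) fs)"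
      using c by (auto simp: composable_def a)
    have "snd ?K (MComp M g fs) = snd H (snd G (MComp M g fs))"
      by (rule a) (use M.comp_in[OF c] in blast)
    also have "\<dots> = MComp P (snd H (snd G g)) (map (snd H) (map (snd G) fs))"
      by (simp only: G(6)[OF c] H(6)[OF c'])
    also have "snd H (snd G g) = snd ?K g"
      by (rule a[symmetric]) (use c in \<open>simp add: composable_def\<close>)
    finally show "snd ?K (MComp M g fs) = MComp P (snd ?K g) (map (snd ?K) fs)"
      by (simp only: m)
  qed
qed

lemma mfun_comp_id:
  assumes "multifunctor M N G"
  shows "mfun_comp M (mfun_id N) G = G" "mfun_comp M G (mfun_id M) = G"
proof -
  have G: "\<And>a. a \<in> MOb M \<Longrightarrow> fst G a \<in> MOb N" "\<And>f. f \<in> MArr M \<Longrightarrow> snd G f \<in> MArr N"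
    "fst G \<in> extensional (MOb M)" "snd G \<in> extensional (MArr M)"
    using assms unfolding multifunctor_def by blast+
  show "mfun_comp M (mfun_id N) G = G"
  proof (rule prod_eqI)
    show "fst (mfun_comp M (mfun_id N) G) = fst G"
      by (rule extensionalityI[OF _ G(3)]) (simp_all add: mfun_comp_def mfun_id_def compose_def G)
    show "snd (mfun_comp M (mfun_id N) G) = snd G"
      by (rule extensionalityI[OF _ G(4)]) (simp_all add: mfun_comp_def mfun_id_def compose_def G)
  qed
  show "mfun_comp M G (mfun_id M) = G"
  proof (rule prod_eqI)
    show "fst (mfun_comp M G (mfun_id M)) = fst G"
      by (rule extensionalityI[OF _ G(3)]) (simp_all add: mfun_comp_def mfun_id_def compose_def G)
    show "snd (mfun_comp M G (mfun_id M)) = snd G"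
      by (rule extensionalityI[OF _ G(4)]) (simp_all add: mfun_comp_def mfun_id_def compose_def G)
  qed
qed

lemma mfun_comp_assoc:
  assumes "multifunctor M N G"
  shows "mfun_comp M (mfun_comp N K H) G = mfun_comp M K (mfun_comp M H G)"
  using assms by (auto simp: mfun_comp_def compose_def multifunctor_def fun_eq_iff)

lemma category_MultCat: "category MultCat"
  by unfold_locales
    (auto simp: MultCat_def hom_def multifunctor_id mfun_comp_id mfun_comp_assoc
       intro: multifunctor_comp)

text \<open>The identity multifunctor has \<open>G_word w xs f = f\<close>, so the lax functor read off from it is \<open>lax_id C\<close>.\<close>

lemma lax_id_transport:
  assumes "smc_choice C \<kappa>"
  shows "lax_smf C C (lax_id C) \<and> UF C \<kappa> C \<kappa> (lax_id C) = mfun_id (Umult C \<kappa>)"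
proof -
  interpret C: smc_choice C \<kappa> by (rule assms)
  interpret I: multifunctor_choice C \<kappa> C \<kappa> "mfun_id C.M"
    by unfold_locales (rule multifunctor_id[OF C.multicategory_Umult])
  have o: "map I.Go xs = xs" if "set xs \<subseteq> Ob C" for xs
    using that by (intro map_idI) (auto simp: mfun_id_def)
  have G_word: "I.G_word w xs f = f" if "I.typed w xs f" for w xs f
    by (rule I.G_word_unique[OF that])
      (use that I.typed_MArr[OF that] o[of xs] in \<open>simp_all add: I.typed_def, simp add: mfun_id_def\<close>)
  have "lax_id C = I.lax_of"
  proof (rule lax.equality)
    show "FArr (lax_id C) = FArr I.lax_of"
      by (rule ext) (simp add: lax_id_def I.lax_of_def G_word)
    show "Fxi (lax_id C) = Fxi I.lax_of"
      by (intro ext) (simp add: lax_id_def I.lax_of_def G_word)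
    show "FOb (lax_id C) = FOb I.lax_of"
      unfolding I.lax_of_simps by (simp add: lax_id_def mfun_id_def)
  qed (simp_all add: lax_id_def I.lax_of_def G_word)
  thus ?thesis using I.lax_smf_lax_of I.UF_lax_of by simp
qed

text \<open>The composite of \<open>UF G\<close> and \<open>UF F\<close> is a multifunctor, and \<open>UF_mor\<close>, applied twice, computes its
  \<open>G_word\<close>.  The lax functor read off from it is \<open>lax_comp C E G F\<close>; in particular no axiom of a lax
  functor has to be checked for the composite.\<close>

lemma lax_comp_transport:
  assumes C: "smc_choice C \<kappa>" and D: "smc_choice D \<mu>" and E: "smc_choice E \<nu>"
    and lF: "lax_smf C D F" and lG: "lax_smf D E G"
  shows "lax_smf C E (lax_comp C E G F) \<and>
    UF C \<kappa> E \<nu> (lax_comp C E G F) = mfun_comp (Umult C \<kappa>) (UF D \<mu> E \<nu> G) (UF C \<kappa> D \<mu> F)"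
proof -
  interpret C: smc_choice C \<kappa> by (rule C)
  interpret D: smc_choice D \<mu> by (rule D)
  interpret E: smc_choice E \<nu> by (rule E)
  interpret F: lax_choice C \<kappa> D \<mu> F by unfold_locales (rule lF)
  interpret G: lax_choice D \<mu> E \<nu> G by unfold_locales (rule lG)
  let ?K = "mfun_comp C.M (UF D \<mu> E \<nu> G) (UF C \<kappa> D \<mu> F)"
  interpret K: multifunctor_choice C \<kappa> E \<nu> ?K
    by unfold_locales (rule multifunctor_comp[OF F.multifunctor_UF G.multifunctor_UF])
  have o: "fst ?K a = FOb G (FOb F a)" if "a \<in> Ob C" for a
    using that by (simp add: mfun_comp_def compose_def F.fst_UF G.fst_UF)
  have G_word: "K.G_word w xs f = FArr G (FArr F f \<cdot>\<^bsub>D\<^esub> F.xi_word w xs) \<cdot>\<^bsub>E\<^esub> G.xi_word w (map (FOb F) xs)"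
    if t: "K.typed w xs f" for w xs f
  proof (rule K.G_word_unique[OF t])
    have c: "set xs \<subseteq> Ob C" "w \<in> Y (length xs)" "f \<in> Arr C" "Dom C f = evO C w xs"
      using t by (simp_all add: K.typed_def)
    have ys: "set (map (FOb F) xs) \<subseteq> Ob D" using c(1) by auto
    have m: "map K.Go xs = map (FOb G) (map (FOb F) xs)" using c(1) o by auto
    have "snd ?K (C.mor w xs f) = snd (UF D \<mu> E \<nu> G) (snd (UF C \<kappa> D \<mu> F) (C.mor w xs f))"
      using K.typed_MArr[OF t] by (simp add: mfun_comp_def compose_def)
    also have "\<dots> = E.mor w (map K.Go xs)
        (FArr G (FArr F f \<cdot>\<^bsub>D\<^esub> F.xi_word w xs) \<cdot>\<^bsub>E\<^esub> G.xi_word w (map (FOb F) xs))"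
      unfolding F.UF_mor[OF c] m by (rule G.UF_mor) (use c ys in simp_all)
    finally show "snd ?K (C.mor w xs f) = E.mor w (map K.Go xs)
        (FArr G (FArr F f \<cdot>\<^bsub>D\<^esub> F.xi_word w xs) \<cdot>\<^bsub>E\<^esub> G.xi_word w (map (FOb F) xs))" .
    show "FArr G (FArr F f \<cdot>\<^bsub>D\<^esub> F.xi_word w xs) \<cdot>\<^bsub>E\<^esub> G.xi_word w (map (FOb F) xs) \<in> Arr E"
      "Dom E (FArr G (FArr F f \<cdot>\<^bsub>D\<^esub> F.xi_word w xs) \<cdot>\<^bsub>E\<^esub> G.xi_word w (map (FOb F) xs)) =
        evO E w (map K.Go xs)"
      unfolding m using c ys by simp_all
  qed
  have "lax_comp C E G F = K.lax_of"
  proof (rule lax.equality)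
    show "FOb (lax_comp C E G F) = FOb K.lax_of"
      unfolding K.lax_of_simps
      by (rule ext) (simp add: lax_comp_def mfun_comp_def compose_def F.fst_UF G.fst_UF)
    show "FArr (lax_comp C E G F) = FArr K.lax_of"
      by (rule ext) (simp add: lax_comp_def compose_def K.lax_of_def G_word)
    show "Fxi (lax_comp C E G F) = Fxi K.lax_of"
      by (intro ext) (simp add: lax_comp_def K.lax_of_def G_word)
  qed (simp_all add: lax_comp_def K.lax_of_def G_word)
  thus ?thesis using K.lax_smf_lax_of K.UF_lax_of by simp
qed

text \<open>With the left-parenthesized words as auxiliary choice, \<open>UF\<close> is injective and turns each equation into
  the corresponding one for multifunctors.\<close>

lemma category_SMCat: "category SMCat"
proof -
  have k: "smc_choice C kchoice" if "symmetric_monoidal_category C" for C :: "('a, 'b) smc"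
    using that kchoice by (simp add: smc_choice_def smc_choice_axioms_def)
  note id = lax_id_transport[OF k] and comp = lax_comp_transport[OF k k k]
  have inj: "F = F'"
    if "symmetric_monoidal_category C" "symmetric_monoidal_category D" "lax_smf C D F" "lax_smf C D F'"
      "UF C kchoice D kchoice F = UF C kchoice D kchoice F'"
    for C D :: "('a, 'b) smc" and F F'
  proof -
    have "lax_choice C kchoice D kchoice F" "lax_choice C kchoice D kchoice F'"
      using that k[OF that(1)] k[OF that(2)]
      by (simp_all add: lax_choice_def lax_functor_def lax_functor_axioms_def smc_choice_def)
    thus ?thesis using that(5) by (rule lax_choice.UF_determines)
  qed
  note mf = UF_bijective(1)[OF k k]
  have left: "lax_comp C D (lax_id D) F = F" and right: "lax_comp C D F (lax_id C) = F"
    if s: "symmetric_monoidal_category C" "symmetric_monoidal_category D" "lax_smf C D F"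
    for C D :: "('a, 'b) smc" and F
    by (rule inj[OF s(1,2)]; use s id comp mfun_comp_id[OF mf[OF s]] in simp)+
  have assoc: "lax_comp A D (lax_comp B D H G) F = lax_comp A D H (lax_comp A C G F)"
    if s: "symmetric_monoidal_category A" "symmetric_monoidal_category B"
      "symmetric_monoidal_category C" "symmetric_monoidal_category D"
      and "lax_smf A B F" "lax_smf B C G" "lax_smf C D H"
    for A B C D :: "('a, 'b) smc" and F G H
    by (rule inj[OF s(1,4)]) (use that comp mfun_comp_assoc[OF mf[OF s(1,2)]] in simp_all)
  show ?thesis
    by unfold_locales
      (auto simp: SMCat_def hom_def id left right assoc intro: comp[THEN conjunct1])
qed

theorem theorem2p4:
  fixes K :: "('o1, 'a1) smc \<Rightarrow> 'o1 list \<Rightarrow> word"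
    and L :: "('o2, 'a2) smc \<Rightarrow> 'o2 list \<Rightarrow> word"
  assumes K: "\<And>C. symmetric_monoidal_category C \<Longrightarrow> word_choice C (K C)"
    and L: "\<And>D. symmetric_monoidal_category D \<Longrightarrow> word_choice D (L D)"
  shows "(\<forall>C D. symmetric_monoidal_category C \<longrightarrow> symmetric_monoidal_category D \<longrightarrow>
            (\<forall>F. lax_smf C D F \<longrightarrow>
               multifunctor (Umult C (K C)) (Umult D (L D)) (UF C (K C) D (L D) F)) \<and>
            (\<forall>G. multifunctor (Umult C (K C)) (Umult D (L D)) G \<longrightarrow>
               (\<exists>!F. lax_smf C D F \<and> UF C (K C) D (L D) F = G)))
       \<and> is_functor SMCat MultCat
            (\<lambda>C. Umult C (K C))
            (\<lambda>(C, F, D). (Umult C (K C), UF C (K C) D (K D) F, Umult D (K D)))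
       \<and> is_fully_faithful SMCat MultCat
            (\<lambda>C. Umult C (K C))
            (\<lambda>(C, F, D). (Umult C (K C), UF C (K C) D (K D) F, Umult D (K D)))"
proof -
  have cK: "smc_choice C (K C)" if "symmetric_monoidal_category C" for C
    using that K[OF that] by (simp add: smc_choice_def smc_choice_axioms_def)
  have cL: "smc_choice D (L D)" if "symmetric_monoidal_category D" for D
    using that L[OF that] by (simp add: smc_choice_def smc_choice_axioms_def)
  have mK: "multicategory (Umult C (K C))" if "symmetric_monoidal_category C" for C
    by (rule smc_choice.multicategory_Umult[OF cK[OF that]])
  let ?U = "\<lambda>C. Umult C (K C)"
  let ?UF = "\<lambda>(C, F, D). (Umult C (K C), UF C (K C) D (K D) F, Umult D (K D))"
  have "is_functor SMCat MultCat ?U ?UF"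
    unfolding is_functor_def
  proof (intro conjI ballI impI)
    show "category SMCat" "category MultCat" by (rule category_SMCat category_MultCat)+
    show "?U C \<in> Ob MultCat" if "C \<in> Ob SMCat" for C
      using that mK by (simp add: SMCat_def MultCat_def)
    show "?UF f \<in> hom MultCat (?U (Dom SMCat f)) (?U (Cod SMCat f))" if "f \<in> Arr SMCat" for f
      using that mK UF_bijective(1)[OF cK cK] by (auto simp: SMCat_def MultCat_def hom_def)
    show "?UF (idn SMCat C) = idn MultCat (?U C)" if "C \<in> Ob SMCat" for C
      using that lax_id_transport[OF cK] by (simp add: SMCat_def MultCat_def)
    show "?UF (g \<cdot>\<^bsub>SMCat\<^esub> f) = ?UF g \<cdot>\<^bsub>MultCat\<^esub> ?UF f"
      if "f \<in> Arr SMCat" "g \<in> Arr SMCat" "Cod SMCat f = Dom SMCat g" for f g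
      using that lax_comp_transport[OF cK cK cK] by (auto simp: SMCat_def MultCat_def)
  qed
  moreover have "is_fully_faithful SMCat MultCat ?U ?UF"
    unfolding is_fully_faithful_def
  proof (intro ballI)
    fix C D :: "('o1, 'a1) smc"
    assume "C \<in> Ob SMCat" "D \<in> Ob SMCat"
    hence C: "symmetric_monoidal_category C" and D: "symmetric_monoidal_category D"
      by (simp_all add: SMCat_def)
    note U = UF_bijective[OF cK[OF C] cK[OF D]]
    have S: "hom SMCat C D = {(C, F, D) | F. lax_smf C D F}"
      using C D by (auto simp: SMCat_def hom_def)
    have M: "hom MultCat (?U C) (?U D) = {(?U C, G, ?U D) | G. multifunctor (?U C) (?U D) G}"
      using mK[OF C] mK[OF D] by (auto simp: MultCat_def hom_def)
    show "bij_betw ?UF (hom SMCat C D) (hom MultCat (?U C) (?U D))"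
      unfolding bij_betw_def
    proof
      show "inj_on ?UF (hom SMCat C D)"
        unfolding S inj_on_def using U by fastforce
      show "?UF ` hom SMCat C D = hom MultCat (?U C) (?U D)"
      proof (intro equalityI subsetI)
        fix h assume "h \<in> ?UF ` hom SMCat C D"
        then obtain F where F: "lax_smf C D F" "h = ?UF (C, F, D)" unfolding S by blast
        hence "h = (?U C, UF C (K C) D (K D) F, ?U D)" by simp
        thus "h \<in> hom MultCat (?U C) (?U D)" unfolding M using U(1)[OF F(1)] by blast
      next
        fix h assume "h \<in> hom MultCat (?U C) (?U D)"
        then obtain G where h: "h = (?U C, G, ?U D)" "multifunctor (?U C) (?U D) G" unfolding M by auto
        then obtain F where F: "lax_smf C D F" "UF C (K C) D (K D) F = G" using U(2) by blast
        have "h = ?UF (C, F, D)" using h(1) F(2) by simp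
        moreover have "(C, F, D) \<in> hom SMCat C D" unfolding S using F(1) by auto
        ultimately show "h \<in> ?UF ` hom SMCat C D" by (rule image_eqI)
      qed
    qed
  qed
  moreover have "\<forall>C D. symmetric_monoidal_category C \<longrightarrow> symmetric_monoidal_category D \<longrightarrow>
            (\<forall>F. lax_smf C D F \<longrightarrow>
               multifunctor (Umult C (K C)) (Umult D (L D)) (UF C (K C) D (L D) F)) \<and>
            (\<forall>G. multifunctor (Umult C (K C)) (Umult D (L D)) G \<longrightarrow>
               (\<exists>!F. lax_smf C D F \<and> UF C (K C) D (L D) F = G))"
    using UF_bijective[OF cK cL] by simp
  ultimately show ?thesis by blast
qed

end
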